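(* Let $X_\Omega$ be a compact star-shaped toric domain in $\mathbb{R}^4$ with smooth boundary. Then $X_\Omega$ is dynamically convex if and only if $X_\Omega$ is a strictly monotone toric domain.
   Context: A domain is the closure of an open set. If $\Omega$ is a domain in $\mathbb{R}^n_{\ge 0}$, the toric domain is $X_\Omega=\{z\in\mathbb{C}^n=\mathbb{R}^{2n} : \pi(|z_1|^2,\ldots,|z_n|^2)\in\Omega\}$. Let $\partial_+\Omega$ be the set of $\mu\in\partial\Omega$ with $\mu_j>0$ for all $j$, and $\overline{\partial_+\Omega}$ its closure. A strictly monotone toric domain is a compact toric domain $X_\Omega$ with smooth boundary such that if $\mu\in\overline{\partial_+\Omega}$ and $v$ is a nonzero outward normal vector (to $\overline{\partial_+\Omega}$) at $\mu$, then $v_j>0$ for all $j=1,\ldots,n$. A compact domain $X\subset\mathbb{R}^{2n}$ with smooth boundary is star-shaped if it is star-shaped about the origin with the radial vector field on $\mathbb{R}^{2n}$ transverse to $\partial X$. Then the standard Liouville form $\lambda_0=\frac12\sum_i(x_i\,dy_i-y_i\,dx_i)$ restricts to a contact form on $\partial X$; let $R$ be its Reeb vector field, and let Reeb orbits be the periodic orbits of $R$ (including multiply covered ones). $X$ is dynamically convex if it is star-shaped, compact with smooth boundary, and every Reeb orbit $\gamma$ on $\partial X$ has Conley-Zehnder index $\mathrm{CZ}(\gamma)\ge n+1$ if $\gamma$ is nondegenerate, or in general has minimal Conley-Zehnder index at least $n+1$ (i.e. the minimum of the possible Conley-Zehnder indices of nondegenerate Reeb orbits near $\gamma$ after a perturbation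 is at least $n+1$). Indices are computed with respect to a global symplectic trivialization of the contact structure $\ker(\lambda_0|_{\partial X})$ when $n=2$ (for general $n$, one extending over a disk bounded by $\gamma$). When $n=2$, this condition means that the dynamical rotation number $\rho(\gamma)\in\mathbb{R}$ of the linearized Reeb flow around $\gamma$, with respect to a global trivialization of the contact structure, satisfies $\rho(\gamma)>1$ for every Reeb orbit $\gamma$. *)

theory Defs
  imports "HOL-Analysis.Analysis"
begin

section \<open>Smooth boundaries and tangent vectors\<close>

primrec Ck_on :: "nat \<Rightarrow> ('a::euclidean_space \<Rightarrow> real) \<Rightarrow> 'a set \<Rightarrow> bool" where
  "Ck_on 0 f U \<longleftrightarrow> continuous_on U f"
| "Ck_on (Suc k) f U \<longleftrightarrow> (\<forall>x\<in>U. f differentiable (at x)) \<and>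
     (\<forall>v. Ck_on k (\<lambda>x. frechet_derivative f (at x) v) U)"

definition smooth_on :: "('a::euclidean_space \<Rightarrow> real) \<Rightarrow> 'a set \<Rightarrow> bool" where
  "smooth_on f U \<longleftrightarrow> (\<forall>k. Ck_on k f U)"

text \<open>Near each boundary point, \<open>X\<close> is a sublevel set of a smooth function with nonvanishing
  differential. A closed set with this property is the closure of its interior.\<close>

definition smooth_boundary :: "('a::euclidean_space) set \<Rightarrow> bool" where
  "smooth_boundary X \<longleftrightarrow>
     (\<forall>p\<in>frontier X. \<exists>U f. open U \<and> p \<in> U \<and> smooth_on f U \<and>
        (\<forall>x\<in>U. frechet_derivative f (at x) \<noteq> (\<lambda>_. 0)) \<and>
        X \<inter> U = {x \<in> U. f x \<le> 0})"

text \<open>Initial velocities of curves \<open>[0, \<infinity>) \<rightarrow> S\<close> starting at \<open>p\<close>. If \<open>S\<close> is a hypersurface this is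
  its tangent space at \<open>p\<close>; if \<open>S\<close> is a manifold with boundary and \<open>p\<close> is a boundary point, it is the
  half-space of tangent vectors that do not point out of \<open>S\<close>.\<close>

definition tangent_cone :: "('a::real_normed_vector) set \<Rightarrow> 'a \<Rightarrow> 'a set" where
  "tangent_cone S p =
     {v. \<exists>c. c 0 = p \<and> (\<forall>t\<ge>0. c t \<in> S) \<and> (c has_vector_derivative v) (at 0 within {0..})}"

definition star_shaped_domain :: "('a::euclidean_space) set \<Rightarrow> bool" where
  "star_shaped_domain X \<longleftrightarrow> 0 \<in> X \<and> (\<forall>x\<in>X. closed_segment 0 x \<subseteq> X) \<and>
     (\<forall>z\<in>frontier X. z \<notin> tangent_cone (frontier X) z)"


section \<open>Toric domains\<close>

definition orthant :: "(real ^ 'n) set" where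
  "orthant = {\<mu>. \<forall>j. 0 \<le> \<mu> $ j}"

definition orthant_domain :: "(real ^ 'n) set \<Rightarrow> bool" where
  "orthant_domain \<Omega> \<longleftrightarrow> (\<exists>U. openin (top_of_set orthant) U \<and> \<Omega> = closure U)"

definition toric_domain :: "(real ^ 'n) set \<Rightarrow> (complex ^ 'n) set" where
  "toric_domain \<Omega> = {z. (\<chi> j. pi * (cmod (z $ j))\<^sup>2) \<in> \<Omega>}"

definition boundary_plus :: "(real ^ 'n) set \<Rightarrow> (real ^ 'n) set" where
  "boundary_plus \<Omega> = {\<mu> \<in> frontier \<Omega>. \<forall>j. 0 < \<mu> $ j}"

text \<open>\<open>v\<close> is normal to the hypersurface (with boundary) \<open>closure (boundary_plus \<Omega>)\<close>, and outward with
  respect to \<open>\<Omega>\<close>: no vector pointing from \<open>\<mu>\<close> into \<open>\<Omega>\<close> has positive inner product with it. Orthogonality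
  to the hypersurface excludes the conormals of the coordinate hyperplanes when \<open>\<mu>\<close> lies on one.\<close>

definition outward_normal :: "(real ^ 'n) set \<Rightarrow> real ^ 'n \<Rightarrow> real ^ 'n \<Rightarrow> bool" where
  "outward_normal \<Omega> \<mu> v \<longleftrightarrow> v \<noteq> 0 \<and>
     (\<forall>w\<in>tangent_cone (closure (boundary_plus \<Omega>)) \<mu>. v \<bullet> w = 0) \<and>
     (\<forall>w\<in>tangent_cone \<Omega> \<mu>. v \<bullet> w \<le> 0)"

definition strictly_monotone_toric_domain :: "(complex ^ 'n) set \<Rightarrow> bool" where
  "strictly_monotone_toric_domain X \<longleftrightarrow> compact X \<and> smooth_boundary X \<and>
     (\<exists>\<Omega>. orthant_domain \<Omega> \<and> X = toric_domain \<Omega> \<and>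
        (\<forall>\<mu>\<in>closure (boundary_plus \<Omega>). \<forall>v. outward_normal \<Omega> \<mu> v \<longrightarrow> (\<forall>j. 0 < v $ j)))"


section \<open>Reeb dynamics on the boundary\<close>

text \<open>With \<open>z = x + i y\<close> coordinatewise: \<open>\<omega> = \<Sum>\<^sub>j dx\<^sub>j \<and> dy\<^sub>j\<close>, which is the differential of
  \<open>\<lambda>\<^sub>0 = 1/2 \<Sum>\<^sub>j (x\<^sub>j dy\<^sub>j - y\<^sub>j dx\<^sub>j)\<close>.\<close>

definition symplectic_form :: "complex ^ 'n \<Rightarrow> complex ^ 'n \<Rightarrow> real" where
  "symplectic_form v w = (\<Sum>j\<in>UNIV. Re (v $ j) * Im (w $ j) - Im (v $ j) * Re (w $ j))"

definition liouville_form :: "complex ^ 'n \<Rightarrow> complex ^ 'n \<Rightarrow> real" where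
  "liouville_form z v = (1/2) * (\<Sum>j\<in>UNIV. Re (z $ j) * Im (v $ j) - Im (z $ j) * Re (v $ j))"

definition contact_structure :: "(complex ^ 'n) set \<Rightarrow> complex ^ 'n \<Rightarrow> (complex ^ 'n) set" where
  "contact_structure X z = {v \<in> tangent_cone (frontier X) z. liouville_form z v = 0}"

definition reeb_vector :: "(complex ^ 'n) set \<Rightarrow> complex ^ 'n \<Rightarrow> complex ^ 'n" where
  "reeb_vector X z = (THE R. R \<in> tangent_cone (frontier X) z \<and> liouville_form z R = 1 \<and>
     (\<forall>v\<in>tangent_cone (frontier X) z. symplectic_form R v = 0))"

definition reeb_trajectory :: "(complex ^ 'n) set \<Rightarrow> (real \<Rightarrow> complex ^ 'n) \<Rightarrow> bool" where
  "reeb_trajectory X c \<longleftrightarrow>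
     (\<forall>t. c t \<in> frontier X \<and> (c has_vector_derivative reeb_vector X (c t)) (at t))"

text \<open>\<open>T\<close> need not be the minimal period, so multiply covered orbits are included.\<close>

definition reeb_orbit :: "(complex ^ 'n) set \<Rightarrow> (real \<Rightarrow> complex ^ 'n) \<Rightarrow> real \<Rightarrow> bool" where
  "reeb_orbit X \<gamma> T \<longleftrightarrow> T > 0 \<and> reeb_trajectory X \<gamma> \<and> (\<forall>t. \<gamma> (t + T) = \<gamma> t)"

definition reeb_flow :: "(complex ^ 'n) set \<Rightarrow> real \<Rightarrow> complex ^ 'n \<Rightarrow> complex ^ 'n" where
  "reeb_flow X t z = (THE w. \<exists>c. reeb_trajectory X c \<and> c 0 = z \<and> c t = w)"

text \<open>The flow is only defined on \<open>frontier X\<close>. Its derivative within \<open>frontier X\<close> is determined on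
  tangent vectors of \<open>frontier X\<close>, and is only ever applied to those.\<close>

definition linearized_reeb_flow ::
    "(complex ^ 'n) set \<Rightarrow> real \<Rightarrow> complex ^ 'n \<Rightarrow> complex ^ 'n \<Rightarrow> complex ^ 'n" where
  "linearized_reeb_flow X t z = frechet_derivative (reeb_flow X t) (at z within frontier X)"


section \<open>Rotation numbers and dynamical convexity in dimension four\<close>

definition symplectic_trivialization ::
    "(complex ^ 2) set \<Rightarrow> (complex ^ 2 \<Rightarrow> complex ^ 2) \<Rightarrow> (complex ^ 2 \<Rightarrow> complex ^ 2) \<Rightarrow> bool" where
  "symplectic_trivialization X e1 e2 \<longleftrightarrow>
     continuous_on (frontier X) e1 \<and> continuous_on (frontier X) e2 \<and>
     (\<forall>z\<in>frontier X. e1 z \<in> contact_structure X z \<and> e2 z \<in> contact_structure X z \<and>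
        symplectic_form (e1 z) (e2 z) = 1)"

text \<open>A vector \<open>a e1(z) + b e2(z)\<close> has coordinate \<open>a + i b\<close>, since \<open>\<omega>(e1, e2) = 1\<close>.\<close>

definition triv_coord ::
    "(complex ^ 2 \<Rightarrow> complex ^ 2) \<Rightarrow> (complex ^ 2 \<Rightarrow> complex ^ 2) \<Rightarrow> complex ^ 2 \<Rightarrow> complex ^ 2 \<Rightarrow> complex"
  where
  "triv_coord e1 e2 z w = Complex (symplectic_form w (e2 z)) (symplectic_form (e1 z) w)"

text \<open>The total change on \<open>[0, t]\<close> of a continuous argument of the nonvanishing path \<open>w\<close>.\<close>

definition angle_change :: "(real \<Rightarrow> complex) \<Rightarrow> real \<Rightarrow> real" where
  "angle_change w t = (THE d. \<exists>\<theta>. continuous_on {0..t} \<theta> \<and>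
     (\<forall>s\<in>{0..t}. w s = rcis (cmod (w s)) (\<theta> s)) \<and> d = \<theta> t - \<theta> 0)"

text \<open>The rotation number (in full turns per period \<open>T\<close>) of the linearized Reeb flow along \<open>\<gamma>\<close>, seen in
  the trivialization as a path in \<open>Sp(2)\<close> starting at the identity. The flow over \<open>k\<close> periods is the
  \<open>k\<close>-fold iterate of that over one period, so this is the mean rotation of iterates; it is the same for
  every initial vector.\<close>

definition rotation_number ::
    "(complex ^ 2) set \<Rightarrow> (complex ^ 2 \<Rightarrow> complex ^ 2) \<Rightarrow> (complex ^ 2 \<Rightarrow> complex ^ 2) \<Rightarrow>
     (real \<Rightarrow> complex ^ 2) \<Rightarrow> real \<Rightarrow> real" where
  "rotation_number X e1 e2 \<gamma> T = (THE \<rho>. \<forall>v\<in>contact_structure X (\<gamma> 0) - {0}.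
     (\<lambda>k. angle_change (\<lambda>t. triv_coord e1 e2 (\<gamma> t) (linearized_reeb_flow X t (\<gamma> 0) v)) (real k * T)
            / (2 * pi * real k)) \<longlonglongrightarrow> \<rho>)"

text \<open>Dynamical convexity for \<open>n = 2\<close>, where the bound \<open>n + 1 = 3\<close> on the minimal Conley--Zehnder index
  of an orbit means that its rotation number is greater than 1. All global trivializations are homotopic
  because \<open>frontier X\<close> is a 3-sphere, so the rotation number does not depend on the one chosen.\<close>

definition dynamically_convex :: "(complex ^ 2) set \<Rightarrow> bool" where
  "dynamically_convex X \<longleftrightarrow> compact X \<and> smooth_boundary X \<and> star_shaped_domain X \<and>
     (\<exists>e1 e2. symplectic_trivialization X e1 e2 \<and>
        (\<forall>\<gamma> T. reeb_orbit X \<gamma> T \<longrightarrow> rotation_number X e1 e2 \<gamma> T > 1))"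

end

theory Submission
  imports Defs
begin

text \<open>
  Let \<open>F\<close> be the boundary of \<open>X\<close>. It is invariant under the torus rotating the two coordinates, and the
  Reeb vector field of \<open>F\<close> is tangent to the torus orbits: it rotates \<open>z\<^sub>j\<close> with an angular speed
  \<open>a\<^sub>j\<close> that depends only on the moduli of \<open>z\<close>. The whole proof compares both sides of the equivalence with
  the condition that \<open>a\<^sub>1\<close> and \<open>a\<^sub>2\<close> are positive on all of \<open>F\<close>.

  Monotonicity. The boundary of \<open>\<Omega>\<close> is the level 1 of a homogeneous function on the orthant whose
  gradient at the moment image of \<open>z\<close> is \<open>a / 2\<pi>\<close> (\<open>height_has_derivative\<close>). So \<open>a\<close> is
  an outward normal of \<open>\<Omega>\<close> there, and if its entries are positive, every other one is a positive multiple of it. This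
  gives \<open>strictly_monotone_iff\<close>.

  Dynamics. Linearizing the explicit flow, a vector of the contact plane is carried by the rotation with speeds
  \<open>a\<^sub>1, a\<^sub>2\<close> composed with a shear along the torus. The complex determinant \<open>det (z, \<cdot>)\<close> identifies the contact
  plane at \<open>z\<close> with the complex numbers. In this coordinate the rotation becomes multiplication by
  \<open>exp (i t (a\<^sub>1 + a\<^sub>2))\<close>, and the shear moves the vector along a straight line that misses 0, which
  adds an angle smaller than \<open>\<pi>\<close>. An arbitrary global trivialization is of the form
  \<open>d \<mapsto> A d + B cnj d\<close> with \<open>|B| < |A|\<close> in this coordinate. As \<open>F\<close> is a 3-sphere, \<open>A\<close> has a continuous
  logarithm on \<open>F\<close>, so that this too changes angles by a bounded amount. Hence a Reeb orbit through \<open>z\<close> of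
  period \<open>T\<close> has rotation number \<open>T (a\<^sub>1 + a\<^sub>2) / 2\<pi>\<close> in every trivialization (\<open>rotation_number_eq\<close>).

  If both speeds are positive, the orbit can only close up when \<open>T a\<^sub>j\<close> is a positive multiple of
  \<open>2\<pi>\<close> for some \<open>j\<close>, and the other speed makes the rotation number exceed 1. Conversely, where
  one speed vanishes, the other is positive, and one turn of that coordinate is a closed orbit of rotation number
  exactly 1. Under dynamical convexity the speeds therefore have no zero on the connected set \<open>F\<close>; each of them is
  positive somewhere, because \<open>a\<^sub>1 |z\<^sub>1|\<^sup>2 + a\<^sub>2 |z\<^sub>2|\<^sup>2 = 2\<close>
  (\<open>dynamically_convex_iff\<close>).

  Regularity enters as follows. The boundary is transverse to the radial direction, so the Minkowski functional of \<open>X\<close> is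
  differentiable off the origin, and its gradient is differentiable along \<open>F\<close>. The speeds are quotients of the
  components of the gradient by the coordinates, hence differentiable except where \<open>z\<^sub>j = 0\<close>. There
  \<open>a\<^sub>j\<close> is defined as a limit, and its continuity (\<open>continuous_on_angular_speed\<close>) is what makes the
  flow differentiable at such points and extends the gradient on the orthant up to the axes.
\<close>


section \<open>Tangent cones\<close>

lemma has_vector_derivative_along_curve:
  fixes h :: "'a::real_normed_vector \<Rightarrow> 'b::real_normed_vector"
  assumes h: "(h has_derivative h') (at p within S)"
    and c: "c 0 = p" "\<And>t. 0 \<le> t \<Longrightarrow> c t \<in> S" "(c has_vector_derivative v) (at 0 within {0..})"
  shows "((\<lambda>t. h (c t)) has_vector_derivative h' v) (at 0 within {0..})"
proof -
  have "c ` {0..} \<subseteq> S" using c(2) by auto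
  then have "(h has_derivative h') (at (c 0) within c ` {0..})"
    using h c(1) has_derivative_subset by blast
  then have "((\<lambda>t. h (c t)) has_derivative (\<lambda>x. h' (x *\<^sub>R v))) (at 0 within {0..})"
    using has_derivative_in_compose[of c "\<lambda>x. x *\<^sub>R v" 0 "{0..}" h h'] c(3)
    unfolding has_vector_derivative_def by blast
  moreover have "bounded_linear h'" using h has_derivative_bounded_linear by blast
  ultimately show ?thesis
    unfolding has_vector_derivative_def by (simp add: linear_simps)
qed

lemma vector_derivative_unique_at_0:
  assumes "(c has_vector_derivative v) (at (0::real) within {0..})"
    "(c has_vector_derivative w) (at 0 within {0..})"
  shows "v = w"
proof (rule vector_derivative_unique_within[OF _ assms])
  have "(0::real) islimpt {0<..}" by (rule trivial_limit_at_right_real[unfolded trivial_limit_within, simplified])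
  then show "at (0::real) within {0..} \<noteq> bot"
    by (meson greaterThan_subset_iff islimpt_subset less_eq_real_def order_refl trivial_limit_within subsetI atLeast_iff greaterThan_iff)
qed

text \<open>A derivative within a hypersurface is not unique as a linear map, but its values on velocities of curves in
  the hypersurface are.\<close>

lemma derivative_within_unique_on_tangent_cone:
  assumes "(h has_derivative h1) (at p within S)" "(h has_derivative h2) (at p within S)"
    and "v \<in> tangent_cone S p"
  shows "h1 v = h2 v"
  using assms has_vector_derivative_along_curve vector_derivative_unique_at_0
  unfolding tangent_cone_def by (smt (verit, ccfv_threshold) mem_Collect_eq)

lemma derivative_maps_tangent_cone:
  assumes h: "(h has_derivative h') (at p within S)" "h ` S \<subseteq> S'"
    and v: "v \<in> tangent_cone S p"
  shows "h' v \<in> tangent_cone S' (h p)"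
proof -
  obtain c where c: "c 0 = p" "\<And>t. 0 \<le> t \<Longrightarrow> c t \<in> S" "(c has_vector_derivative v) (at 0 within {0..})"
    using v unfolding tangent_cone_def by auto
  have "((\<lambda>t. h (c t)) has_vector_derivative h' v) (at 0 within {0..})"
    using has_vector_derivative_along_curve[OF h(1)] c by blast
  with c h(2) show ?thesis
    unfolding tangent_cone_def by (intro CollectI exI[of _ "\<lambda>t. h (c t)"]) auto
qed

text \<open>Given \<open>v\<close> in the kernel of the differential, the intermediate value theorem yields, for each small \<open>t\<close>, a zero of
  \<open>f\<close> at distance \<open>o(t)\<close> from \<open>p + t v\<close> in a fixed transverse direction \<open>n\<close>. Membership in
  the tangent cone only concerns the derivative at time 0 of a curve that need not be continuous elsewhere. So the curve may
  pick, for each \<open>t\<close> separately, a zero that is nearly closest to \<open>p + t v\<close>.\<close>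

lemma tangent_cone_level_set:
  fixes f :: "'a::real_normed_vector \<Rightarrow> real"
  assumes U: "open U" "p \<in> U" and f: "continuous_on U f" "f p = 0"
    and f': "(f has_derivative f') (at p)" "f' \<noteq> (\<lambda>_. 0)"
    and S: "S \<inter> U = {x \<in> U. f x = 0}"
  shows "tangent_cone S p = {v. f' v = 0}"
proof (intro equalityI subsetI)
  fix v assume "v \<in> tangent_cone S p"
  then obtain c where c: "c 0 = p" "\<And>t. 0 \<le> t \<Longrightarrow> c t \<in> S" "(c has_vector_derivative v) (at 0 within {0..})"
    unfolding tangent_cone_def by auto
  have d: "((\<lambda>t. f (c t)) has_vector_derivative f' v) (at 0 within {0..})"
    by (rule has_vector_derivative_along_curve[OF has_derivative_at_withinI[OF f'(1)], of _ UNIV]) (use c in auto)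
  have "continuous (at 0 within {0..}) c"
    using c(3) has_vector_derivative_continuous by blast
  then have "(c \<longlongrightarrow> p) (at 0 within {0..})" using c(1) by (simp add: continuous_within)
  then have "eventually (\<lambda>t. c t \<in> U) (at 0 within {0..})"
    using U topological_tendstoD by blast
  then have "eventually (\<lambda>t. f (c t) = 0) (at 0 within {0..})"
    unfolding eventually_at_filter
    by (rule eventually_mono) (use c(2) S in auto)
  then have "((\<lambda>t. 0::real) has_vector_derivative f' v) (at 0 within {0..})"
    using d unfolding has_vector_derivative_def
    by - (erule has_derivative_transform_eventually, assumption, use c f in auto)
  then show "v \<in> {v. f' v = 0}"
    using vector_derivative_unique_at_0 has_vector_derivative_const by blast
next
  fix v assume "v \<in> {v. f' v = 0}"
  then have v: "f' v = 0" by simp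
  have lin: "bounded_linear f'" using f'(1) has_derivative_bounded_linear by blast
  obtain n0 where "f' n0 \<noteq> 0" using f'(2) by auto
  define n where "n = n0 /\<^sub>R f' n0"
  have n: "f' n = 1" using \<open>f' n0 \<noteq> 0\<close> lin by (simp add: n_def linear_simps)
  define Z where "Z t = {s. p + t *\<^sub>R v + s *\<^sub>R n \<in> U \<and> f (p + t *\<^sub>R v + s *\<^sub>R n) = 0}" for t
  have root: "\<exists>\<delta>>0. \<forall>t. 0 < t \<and> t < \<delta> \<longrightarrow> (\<exists>s\<in>Z t. \<bar>s\<bar> \<le> e * t)" if e: "0 < e" for e
  proof -
    define K where "K = norm v + e * norm n + 1"
    have K: "K > 0" using e by (simp add: K_def add_nonneg_pos)
    obtain r where r: "r > 0" "ball p r \<subseteq> U" using U open_contains_ball by blast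
    obtain d where d: "d > 0" "\<And>y. norm (y - p) < d \<Longrightarrow> \<bar>f y - f p - f' (y - p)\<bar> \<le> e / (2*K) * norm (y - p)"
      using f'(1)[unfolded has_derivative_at_alt] K e
      by (metis divide_pos_pos mult_pos_pos real_norm_def zero_less_numeral)
    define \<delta> where "\<delta> = min r d / K"
    have \<delta>: "\<delta> > 0" using r d K by (simp add: \<delta>_def)
    moreover have "\<exists>s\<in>Z t. \<bar>s\<bar> \<le> e * t" if t: "0 < t" "t < \<delta>" for t
    proof -
      let ?x = "\<lambda>s. p + t *\<^sub>R v + s *\<^sub>R n"
      have nr: "norm (?x s - p) < K * t" if "\<bar>s\<bar> \<le> e * t" for s
      proof -
        have "norm (?x s - p) \<le> norm (t *\<^sub>R v) + norm (s *\<^sub>R n)"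
          by (metis add_diff_cancel_left' group_cancel.add1 norm_triangle_ineq)
        also have "\<dots> \<le> t * norm v + e * t * norm n"
          using that t by (simp add: mult_right_mono)
        also have "\<dots> < K * t" using t by (simp add: K_def algebra_simps)
        finally show ?thesis .
      qed
      have Kt: "K * t < min r d" using t K by (simp add: \<delta>_def field_simps)
      have inU: "?x s \<in> U" if "\<bar>s\<bar> \<le> e * t" for s
      proof -
        have "dist p (?x s) < r" using nr[OF that] Kt by (subst dist_commute) (simp add: dist_norm)
        then have "?x s \<in> ball p r" by simp
        then show ?thesis using r(2) by blast
      qed
      have est: "\<bar>f (?x s) - s\<bar> \<le> e * t / 2" if s: "\<bar>s\<bar> \<le> e * t" for s
      proof -
        have "?x s - p = t *\<^sub>R v + s *\<^sub>R n" by simp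
        then have "f' (?x s - p) = s" using lin v n by (simp add: linear_simps)
        then have "\<bar>f (?x s) - s\<bar> \<le> e / (2*K) * norm (?x s - p)"
          using d(2)[of "?x s"] nr[OF s] Kt f(2) by auto
        also have "\<dots> \<le> e / (2*K) * (K * t)"
          using nr[OF s] e K by (intro mult_left_mono) auto
        finally show ?thesis using K by simp
      qed
      have "continuous_on {- (e*t)..e*t} (\<lambda>s. f (?x s))"
        by (rule continuous_on_compose2[OF f(1)]) (auto intro!: continuous_intros inU)
      moreover have "f (?x (- (e*t))) \<le> 0" "0 \<le> f (?x (e*t))"
        using est[of "- (e*t)"] est[of "e*t"] mult_pos_pos[OF e t(1)] by linarith+
      ultimately obtain s where "- (e*t) \<le> s" "s \<le> e*t" "f (?x s) = 0"
        using IVT'[of "\<lambda>s. f (?x s)" "- (e*t)" 0 "e*t"] e t by auto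
      then show ?thesis using inU[of s] by (intro bexI[of _ s]) (auto simp: Z_def)
    qed
    ultimately show ?thesis by blast
  qed
  \<comment> \<open>The infimum over \<open>Z t\<close> might not be attained; the slack \<open>t\<^sup>2\<close> is still \<open>o(t)\<close>.\<close>
  define I where "I t = Inf (abs ` Z t)" for t
  have bd: "bdd_below (abs ` Z t)" for t by (rule bdd_belowI2[of _ 0]) auto
  have "\<exists>s. (Z t \<noteq> {} \<longrightarrow> s \<in> Z t \<and> \<bar>s\<bar> < I t + t\<^sup>2) " if "0 < t" for t
  proof (cases "Z t = {}")
    case False
    then show ?thesis
      using cInf_lessD[of "abs ` Z t" "I t + t\<^sup>2"] that by (auto simp: I_def)
  qed auto
  then obtain s where s: "\<And>t. 0 < t \<Longrightarrow> Z t \<noteq> {} \<Longrightarrow> s t \<in> Z t \<and> \<bar>s t\<bar> < I t + t\<^sup>2" by metis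
  define c where "c t = (if 0 < t \<and> Z t \<noteq> {} then p + t *\<^sub>R v + s t *\<^sub>R n else p)" for t
  have "p \<in> S" using S U f by auto
  then have cS: "c t \<in> S" for t
    using s[of t] S by (auto simp: c_def Z_def)
  have "((\<lambda>t. (c t - c 0 - (t - 0) *\<^sub>R v) /\<^sub>R norm (t - 0)) \<longlongrightarrow> 0) (at 0 within {0..})"
  proof (rule tendstoI)
    fix \<epsilon> :: real assume \<epsilon>: "\<epsilon> > 0"
    define e where "e = \<epsilon> / (2 * (norm n + 1))"
    have e: "e > 0" using \<epsilon> by (simp add: e_def add_nonneg_pos)
    obtain \<delta> where \<delta>: "\<delta> > 0" "\<And>t. 0 < t \<Longrightarrow> t < \<delta> \<Longrightarrow> \<exists>s\<in>Z t. \<bar>s\<bar> \<le> e * t"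
      using root[OF e] by blast
    have "dist ((c t - c 0 - (t - 0) *\<^sub>R v) /\<^sub>R norm (t - 0)) 0 < \<epsilon>"
      if t: "0 < t" "t < min \<delta> e" for t
    proof -
      obtain s' where s': "s' \<in> Z t" "\<bar>s'\<bar> \<le> e * t" using \<delta> t by auto
      have "I t \<le> e * t" unfolding I_def
        using cInf_lower[OF imageI[OF s'(1)] bd[of t]] s'(2) by linarith
      moreover have "t\<^sup>2 < e * t" using t by (simp add: power2_eq_square)
      ultimately have st: "\<bar>s t\<bar> < 2 * e * t" using s[of t] t s' by force
      have "(c t - c 0 - (t - 0) *\<^sub>R v) /\<^sub>R norm (t - 0) = (s t / t) *\<^sub>R n"
        using t s'(1) by (auto simp: c_def algebra_simps divide_inverse)
      then have "dist ((c t - c 0 - (t - 0) *\<^sub>R v) /\<^sub>R norm (t - 0)) 0 = \<bar>s t\<bar> / t * norm n"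
        using t by simp
      also have "\<dots> \<le> 2 * e * norm n"
        using st t by (intro mult_right_mono) (auto simp: field_simps)
      also have "\<dots> < 2 * e * (norm n + 1)" using e by simp
      also have "\<dots> = \<epsilon>" by (simp add: e_def add_nonneg_eq_0_iff field_simps)
      finally show ?thesis .
    qed
    moreover have "min \<delta> e > 0" using \<delta> e by simp
    ultimately show "eventually (\<lambda>t. dist ((c t - c 0 - (t - 0) *\<^sub>R v) /\<^sub>R norm (t - 0)) 0 < \<epsilon>) (at 0 within {0..})"
      unfolding eventually_at by (intro exI[of _ "min \<delta> e"]) (auto simp: dist_real_def)
  qed
  then have "(c has_vector_derivative v) (at 0 within {0..})"
    unfolding has_vector_derivative_def has_derivative_within
    by (auto intro!: bounded_linear_intros simp: c_def divide_inverse diff_diff_eq)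
  then show "v \<in> tangent_cone S p"
    using cS unfolding tangent_cone_def by (intro CollectI exI[of _ c]) (auto simp: c_def)
qed


section \<open>Star-shaped domains with smooth boundary\<close>

lemma orthogonal_to_hyperplane_imp_parallel:
  fixes m n :: "'a::real_inner"
  assumes "n \<noteq> 0" "\<And>v. n \<bullet> v = 0 \<Longrightarrow> m \<bullet> v = 0"
  shows "m = (m \<bullet> n / (n \<bullet> n)) *\<^sub>R n"
proof -
  define w where "w = m - (m \<bullet> n / (n \<bullet> n)) *\<^sub>R n"
  have "n \<bullet> w = 0" using assms(1) by (simp add: w_def inner_diff_right inner_commute)
  then have "m \<bullet> w = 0" "n \<bullet> w = 0" using assms(2) by auto
  then have "w \<bullet> w = 0" by (simp add: w_def inner_diff_left)
  then show ?thesis by (simp add: w_def)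
qed

lemma smooth_on_gradient:
  fixes f :: "'a::euclidean_space \<Rightarrow> real"
  assumes "smooth_on f U"
  obtains n where "\<And>x. x \<in> U \<Longrightarrow> (f has_derivative (\<lambda>v. n x \<bullet> v)) (at x)"
    "\<And>x. x \<in> U \<Longrightarrow> n differentiable (at x)"
proof
  let ?n = "\<lambda>x. \<Sum>b\<in>Basis. frechet_derivative f (at x) b *\<^sub>R b"
  have C: "Ck_on 0 f U" "Ck_on (Suc (Suc 0)) f U" using assms unfolding smooth_on_def by blast+
  fix x assume x: "x \<in> U"
  have D: "(f has_derivative frechet_derivative f (at x)) (at x)"
    using C x by (simp add: frechet_derivative_works)
  then have lin: "linear (frechet_derivative f (at x))"
    using has_derivative_linear by blast
  have "frechet_derivative f (at x) v = ?n x \<bullet> v" for v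
  proof -
    have "frechet_derivative f (at x) v = frechet_derivative f (at x) (\<Sum>b\<in>Basis. (v \<bullet> b) *\<^sub>R b)"
      by (simp add: euclidean_representation)
    also have "\<dots> = (\<Sum>b\<in>Basis. (v \<bullet> b) * frechet_derivative f (at x) b)"
      by (simp add: linear_sum[OF lin] linear_scale[OF lin])
    also have "\<dots> = ?n x \<bullet> v"
      by (simp add: inner_sum_left inner_commute[of v] mult.commute)
    finally show ?thesis .
  qed
  then show "(f has_derivative (\<lambda>v. ?n x \<bullet> v)) (at x)"
    by (intro has_derivative_eq_rhs[OF D] ext)
  show "?n differentiable (at x)"
  proof (intro differentiable_sum ballI differentiable_scaleR differentiable_const finite_Basis)
    fix b :: 'a
    show "(\<lambda>x. frechet_derivative f (at x) b) differentiable (at x)"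
      using C(2) x by simp
  qed
qed

locale smooth_star_domain =
  fixes X :: "'a::euclidean_space set"
  assumes compact_X: "compact X" and smooth_boundary_X: "smooth_boundary X"
    and star_shaped_X: "star_shaped_domain X"
begin

lemma zero_mem_interior: "0 \<in> interior X"
proof -
  have "c \<in> tangent_cone S c" if "c = 0" "c \<in> S" for c :: 'a and S
    using that unfolding tangent_cone_def by (intro CollectI exI[of _ "\<lambda>_. 0"]) auto
  then have "0 \<notin> frontier X" using star_shaped_X unfolding star_shaped_domain_def by auto
  moreover have "0 \<in> X" using star_shaped_X unfolding star_shaped_domain_def by auto
  ultimately show ?thesis
    using frontier_def closure_subset by fastforce
qed

lemma frontier_subset: "frontier X \<subseteq> X"
  using compact_X compact_imp_closed frontier_subset_eq by blast

lemma frontier_nonzero: "z \<in> frontier X \<Longrightarrow> z \<noteq> 0"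
  using zero_mem_interior frontier_def by fastforce

lemma scale_mem: "z \<in> X \<Longrightarrow> 0 \<le> t \<Longrightarrow> t \<le> 1 \<Longrightarrow> t *\<^sub>R z \<in> X"
  using star_shaped_X unfolding star_shaped_domain_def closed_segment_def by fastforce

text \<open>The gradient \<open>n\<close> is part of the data, so that the second order regularity of the boundary takes the form of
  differentiability of \<open>n\<close>.\<close>

definition defining_function :: "'a set \<Rightarrow> ('a \<Rightarrow> real) \<Rightarrow> ('a \<Rightarrow> 'a) \<Rightarrow> bool" where
  "defining_function U f n \<longleftrightarrow> open U \<and>
     (\<forall>x\<in>U. (f has_derivative (\<lambda>v. n x \<bullet> v)) (at x) \<and> n x \<noteq> 0 \<and> n differentiable (at x)) \<and>
     X \<inter> U = {x \<in> U. f x \<le> 0}"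

lemma ex_defining_function:
  assumes "p \<in> frontier X"
  obtains U f n where "p \<in> U" "defining_function U f n"
proof -
  from bspec[OF smooth_boundary_X[unfolded smooth_boundary_def] assms]
  obtain U f where U: "open U" "p \<in> U" "smooth_on f U"
     "\<forall>x\<in>U. frechet_derivative f (at x) \<noteq> (\<lambda>_. 0)" "X \<inter> U = {x \<in> U. f x \<le> 0}"
    by (elim exE conjE) (rule that)
  obtain n where n: "\<And>x. x \<in> U \<Longrightarrow> (f has_derivative (\<lambda>v. n x \<bullet> v)) (at x)"
    "\<And>x. x \<in> U \<Longrightarrow> n differentiable (at x)"
    using smooth_on_gradient[OF U(3)] by blast
  have "n x \<noteq> 0" if "x \<in> U" for x
    using bspec[OF U(4) that] frechet_derivative_at[OF n(1)[OF that]] by auto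
  then have "defining_function U f n"
    using U n unfolding defining_function_def by blast
  then show ?thesis using that U(2) by blast
qed

context
  fixes U f n
  assumes df: "defining_function U f n"
begin

lemma defining_function_open: "open U"
  and defining_function_derivative: "\<And>x. x \<in> U \<Longrightarrow> (f has_derivative (\<lambda>v. n x \<bullet> v)) (at x)"
  and defining_function_gradient_nonzero: "\<And>x. x \<in> U \<Longrightarrow> n x \<noteq> 0"
  and defining_function_gradient_differentiable: "\<And>x. x \<in> U \<Longrightarrow> n differentiable (at x)"
  and defining_function_sublevel: "\<And>x. x \<in> U \<Longrightarrow> x \<in> X \<longleftrightarrow> f x \<le> 0"
  using df unfolding defining_function_def by auto

lemma defining_function_continuous: "continuous_on U f"
  using defining_function_derivative by (meson continuous_at_imp_continuous_on has_derivative_continuous)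

lemma defining_function_leaves:
  assumes x: "x \<in> U" "f x = 0" "n x \<bullet> v > 0"
  shows "eventually (\<lambda>h. x + h *\<^sub>R v \<notin> X) (at_right 0)"
proof -
  have "((\<lambda>h. f (x + h *\<^sub>R v)) has_derivative (\<lambda>h. n x \<bullet> (h *\<^sub>R v))) (at 0)"
    by (rule has_derivative_compose[of "\<lambda>h. x + h *\<^sub>R v" "\<lambda>h. h *\<^sub>R v" _ UNIV f])
       (auto intro!: derivative_eq_intros defining_function_derivative x)
  then have "DERIV (\<lambda>h. f (x + h *\<^sub>R v)) 0 :> n x \<bullet> v"
    unfolding has_field_derivative_def by (rule has_derivative_eq_rhs) (simp add: fun_eq_iff)
  from DERIV_pos_inc_right[OF this x(3)]
  have "eventually (\<lambda>h. f (x + h *\<^sub>R v) > 0) (at_right 0)"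
    using x(2) unfolding eventually_at_right_field by auto
  moreover have "((\<lambda>h. x + h *\<^sub>R v) \<longlongrightarrow> x + 0 *\<^sub>R v) (at_right 0)" by (intro tendsto_intros)
  then have "eventually (\<lambda>h. x + h *\<^sub>R v \<in> U) (at_right 0)"
    by (rule topological_tendstoD) (use defining_function_open x in auto)
  ultimately show ?thesis
    by eventually_elim (use defining_function_sublevel in force)
qed

lemma defining_function_frontier: "frontier X \<inter> U = {x \<in> U. f x = 0}"
proof (intro equalityI subsetI)
  fix x assume x: "x \<in> frontier X \<inter> U"
  then have "f x \<le> 0" using frontier_subset defining_function_sublevel by blast
  moreover have "\<not> f x < 0"
  proof
    assume "f x < 0"
    have "open (f -` {..<0} \<inter> U)"
      using defining_function_continuous defining_function_open by (simp add: continuous_on_open_vimage)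
    moreover have "f -` {..<0} \<inter> U \<subseteq> X" using defining_function_sublevel by auto
    ultimately have "x \<in> interior X" using x \<open>f x < 0\<close> by (intro interiorI) auto
    then show False using x by (simp add: frontier_def)
  qed
  ultimately show "x \<in> {x \<in> U. f x = 0}" using x by auto
next
  fix x assume x: "x \<in> {x \<in> U. f x = 0}"
  then have "x \<in> X" using defining_function_sublevel by auto
  have out: "eventually (\<lambda>h. x + h *\<^sub>R n x \<notin> X) (at_right 0)"
    using defining_function_leaves[of x "n x"] defining_function_gradient_nonzero x by auto
  have "x \<notin> interior X"
  proof
    assume "x \<in> interior X"
    moreover have "((\<lambda>h. x + h *\<^sub>R n x) \<longlongrightarrow> x + 0 *\<^sub>R n x) (at_right 0)"
      by (intro tendsto_intros)
    ultimately have "eventually (\<lambda>h. x + h *\<^sub>R n x \<in> interior X) (at_right 0)"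
      by (intro topological_tendstoD) auto
    with out have "eventually (\<lambda>h::real. False) (at_right 0)"
      by eventually_elim (use interior_subset in blast)
    then show False by simp
  qed
  then show "x \<in> frontier X \<inter> U" using x \<open>x \<in> X\<close> closure_subset by (auto simp: frontier_def)
qed

lemma defining_function_tangent_cone:
  assumes y: "y \<in> frontier X" "y \<in> U"
  shows "tangent_cone (frontier X) y = {v. n y \<bullet> v = 0}"
proof (rule tangent_cone_level_set[OF defining_function_open y(2) defining_function_continuous _
      defining_function_derivative _ defining_function_frontier])
  show "f y = 0" using defining_function_frontier y by blast
  show "(\<lambda>v. n y \<bullet> v) \<noteq> (\<lambda>_. 0)"
    using defining_function_gradient_nonzero[OF y(2)] by (metis inner_eq_zero_iff)
qed (rule y)

text \<open>The radial direction is transverse to the boundary, so \<open>n y \<bullet> y\<close> does not vanish; if it were negative, the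
  segment from \<open>y\<close> to the origin would leave \<open>X\<close>.\<close>

lemma defining_function_gradient_inner_self:
  assumes y: "y \<in> frontier X" "y \<in> U"
  shows "n y \<bullet> y > 0"
proof -
  have "n y \<bullet> y \<noteq> 0"
    using star_shaped_X y defining_function_tangent_cone[OF y] unfolding star_shaped_domain_def by auto
  moreover have "\<not> n y \<bullet> y < 0"
  proof
    assume "n y \<bullet> y < 0"
    moreover have "f y = 0" using defining_function_frontier y by blast
    ultimately have "eventually (\<lambda>h. y + h *\<^sub>R (- y) \<notin> X) (at_right 0)"
      using y by (intro defining_function_leaves) auto
    moreover have "eventually (\<lambda>h::real. h \<in> {0<..<1}) (at_right 0)"
      by (rule eventually_at_right_real) simp
    ultimately have "eventually (\<lambda>h::real. False) (at_right 0)"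
    proof eventually_elim
      case (elim h)
      have "y + h *\<^sub>R (- y) = (1 - h) *\<^sub>R y" by (simp add: algebra_simps)
      also have "\<dots> \<in> X" using y frontier_subset elim by (intro scale_mem) auto
      finally show False using elim by blast
    qed
    then show False by simp
  qed
  ultimately show ?thesis by linarith
qed

end

text \<open>This turns out to be the gradient of the Minkowski functional of \<open>X\<close> at \<open>y\<close>.\<close>

definition conormal :: "'a \<Rightarrow> 'a" where
  "conormal y = (THE n. (\<forall>v\<in>tangent_cone (frontier X) y. n \<bullet> v = 0) \<and> n \<bullet> y = 1)"

lemma conormal_eqI:
  assumes y: "y \<in> frontier X" and m: "\<And>v. v \<in> tangent_cone (frontier X) y \<Longrightarrow> m \<bullet> v = 0" "m \<bullet> y = 1"
  shows "conormal y = m"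
  unfolding conormal_def
proof (rule the_equality)
  show "(\<forall>v\<in>tangent_cone (frontier X) y. m \<bullet> v = 0) \<and> m \<bullet> y = 1" using m by auto
  fix k assume k: "(\<forall>v\<in>tangent_cone (frontier X) y. k \<bullet> v = 0) \<and> k \<bullet> y = 1"
  obtain U f n where U: "y \<in> U" "defining_function U f n"
    using ex_defining_function[OF y] by blast
  note tc = defining_function_tangent_cone[OF U(2) y U(1)]
  note nz = defining_function_gradient_nonzero[OF U(2,1)]
  have "k = (k \<bullet> n y / (n y \<bullet> n y)) *\<^sub>R n y" "m = (m \<bullet> n y / (n y \<bullet> n y)) *\<^sub>R n y"
    using orthogonal_to_hyperplane_imp_parallel[OF nz] k m tc by auto
  then obtain a b where ab: "k = a *\<^sub>R n y" "m = b *\<^sub>R n y" by blast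
  then have "a * (n y \<bullet> y) = b * (n y \<bullet> y)" using k m(2) by simp
  then show "k = m" using ab defining_function_gradient_inner_self[OF U(2) y U(1)] by simp
qed

lemma defining_function_conormal:
  assumes "defining_function U f n" "y \<in> frontier X" "y \<in> U"
  shows "conormal y = n y /\<^sub>R (n y \<bullet> y)"
  using defining_function_gradient_inner_self[OF assms] defining_function_tangent_cone[OF assms]
  by (intro conormal_eqI assms) auto

lemma tangent_cone_frontier:
  assumes y: "y \<in> frontier X"
  shows "tangent_cone (frontier X) y = {v. conormal y \<bullet> v = 0}"
proof -
  obtain U f n where U: "y \<in> U" "defining_function U f n"
    using ex_defining_function[OF y] by blast
  show ?thesis
    using defining_function_gradient_inner_self[OF U(2) y U(1)]
      defining_function_tangent_cone[OF U(2) y U(1)] defining_function_conormal[OF U(2) y U(1)] by auto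
qed

lemma conormal_inner_self:
  assumes y: "y \<in> frontier X"
  shows "conormal y \<bullet> y = 1"
proof -
  obtain U f n where U: "y \<in> U" "defining_function U f n"
    using ex_defining_function[OF y] by blast
  show ?thesis
    using defining_function_gradient_inner_self[OF U(2) y U(1)]
      defining_function_conormal[OF U(2) y U(1)] by auto
qed

lemma conormal_differentiable:
  assumes p: "p \<in> frontier X"
  shows "conormal differentiable (at p within frontier X)"
proof -
  obtain U f n where U: "p \<in> U" "defining_function U f n"
    using ex_defining_function[OF p] by blast
  obtain d where d: "d > 0" "ball p d \<subseteq> U"
    using U defining_function_open open_contains_ball by blast
  have n: "n differentiable (at p)" using U defining_function_gradient_differentiable by blast
  have "(\<lambda>y. n y /\<^sub>R (n y \<bullet> y)) differentiable (at p)"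
    using defining_function_gradient_inner_self[OF U(2) p U(1)] n
    by (intro differentiable_scaleR differentiable_inverse differentiable_inner) auto
  then have "(\<lambda>y. n y /\<^sub>R (n y \<bullet> y)) differentiable (at p within frontier X)"
    using differentiable_at_withinI by blast
  then show ?thesis
  proof (rule differentiable_transform_within[OF _ d(1) p])
    fix y assume "y \<in> frontier X" "dist y p < d"
    then show "n y /\<^sub>R (n y \<bullet> y) = conormal y"
      using defining_function_conormal[OF U(2), of y] d(2) by (auto simp: dist_commute)
  qed
qed

lemma continuous_on_conormal: "continuous_on (frontier X) conormal"
  using conormal_differentiable
  by (simp add: continuous_on_eq_continuous_within differentiable_imp_continuous_within)


section \<open>The Minkowski functional\<close>

definition minkowski :: "'a \<Rightarrow> real" where
  "minkowski z = Inf {c. 0 < c \<and> z /\<^sub>R c \<in> X}"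

lemma minkowski_le_iff:
  assumes c: "0 < c"
  shows "minkowski z \<le> c \<longleftrightarrow> z /\<^sub>R c \<in> X"
proof -
  let ?S = "{c. 0 < c \<and> z /\<^sub>R c \<in> X}"
  obtain r where r: "r > 0" "ball 0 r \<subseteq> X" using zero_mem_interior mem_interior by blast
  have bd: "bdd_below ?S" by (rule bdd_belowI[of _ 0]) auto
  define k where "k = (norm z + 1) / r"
  have k: "k > 0" using r by (simp add: k_def add_nonneg_pos)
  have "norm (z /\<^sub>R k) < r" using r k by (simp add: k_def field_simps add_nonneg_pos)
  then have "k \<in> ?S" using r k by auto
  then have ne: "?S \<noteq> {}" by blast
  have up: "b \<in> ?S" if "a \<in> ?S" "a \<le> b" for a b
  proof -
    have "(a / b) *\<^sub>R (z /\<^sub>R a) \<in> X" using that by (intro scale_mem[of "z /\<^sub>R a"]) auto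
    moreover have "(a / b) *\<^sub>R (z /\<^sub>R a) = z /\<^sub>R b" using that by (auto simp: divide_inverse)
    ultimately show ?thesis using that by auto
  qed
  show ?thesis
  proof
    assume "z /\<^sub>R c \<in> X"
    then show "minkowski z \<le> c" unfolding minkowski_def using c bd by (intro cInf_lower) auto
  next
    assume le: "minkowski z \<le> c"
    have *: "b \<in> ?S" if "c < b" for b
    proof -
      have "Inf ?S < b" using le that unfolding minkowski_def by simp
      then obtain a where "a \<in> ?S" "a < b" using cInf_lessD[OF ne] by blast
      then show ?thesis using up[of a b] by simp
    qed
    have lim: "((\<lambda>b. z /\<^sub>R b) \<longlongrightarrow> z /\<^sub>R c) (at_right c)"
      using c by (intro tendsto_intros) auto
    have ev: "eventually (\<lambda>b. z /\<^sub>R b \<in> X) (at_right c)"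
      unfolding eventually_at_right_field using * by (intro exI[of _ "c+1"]) auto
    show "z /\<^sub>R c \<in> X"
      by (rule Lim_in_closed_set[OF compact_imp_closed[OF compact_X] ev _ lim]) simp
  qed
qed

lemma minkowski_le_1_iff: "minkowski z \<le> 1 \<longleftrightarrow> z \<in> X"
  using minkowski_le_iff[of 1 z] by simp

lemma minkowski_nonneg: "0 \<le> minkowski z"
proof (rule ccontr)
  assume *: "\<not> 0 \<le> minkowski z"
  show False
  proof (cases "{c. 0 < c \<and> z /\<^sub>R c \<in> X} = {}")
    case True
    then have "1 \<notin> {c. 0 < c \<and> z /\<^sub>R c \<in> X}" by blast
    then have "\<not> minkowski z \<le> 1" using minkowski_le_iff[of 1 z] by simp
    then show False using * by simp
  next
    case False
    then have "0 \<le> minkowski z" unfolding minkowski_def by (intro cInf_greatest) auto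
    then show False using * by simp
  qed
qed

lemma minkowski_pos:
  assumes "z \<noteq> 0"
  shows "0 < minkowski z"
proof -
  obtain B where B: "\<And>x. x \<in> X \<Longrightarrow> norm x \<le> B" "B > 0"
    using compact_X compact_imp_bounded bounded_pos by metis
  have "norm z / B \<le> c" if "0 < c" "minkowski z \<le> c" for c
  proof -
    have "norm (z /\<^sub>R c) \<le> B" using minkowski_le_iff B that by blast
    then show ?thesis using that B by (simp add: field_simps)
  qed
  from this[of "norm z / B / 2"] have "\<not> minkowski z \<le> norm z / B / 2"
    using assms B(2) by (auto simp: field_simps)
  moreover have "0 \<le> norm z / B / 2" using B(2) by simp
  ultimately show ?thesis by linarith
qed

lemma minkowski_scale:
  assumes t: "0 < t"
  shows "minkowski (t *\<^sub>R z) = t * minkowski z"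
proof -
  have *: "minkowski (t *\<^sub>R z) \<le> c \<longleftrightarrow> t * minkowski z \<le> c" if "0 < c" for c
  proof -
    have "minkowski (t *\<^sub>R z) \<le> c \<longleftrightarrow> z /\<^sub>R (c / t) \<in> X"
      using minkowski_le_iff[OF that] by (simp add: field_simps)
    also have "\<dots> \<longleftrightarrow> minkowski z \<le> c / t"
      using minkowski_le_iff[of "c/t"] that t by simp
    finally show ?thesis using t by (simp add: field_simps)
  qed
  have nonneg: "0 \<le> minkowski (t *\<^sub>R z)" "0 \<le> t * minkowski z" using minkowski_nonneg t by simp_all
  show ?thesis
  proof (rule antisym; rule field_le_epsilon)
    fix e :: real assume "0 < e"
    then show "minkowski (t *\<^sub>R z) \<le> t * minkowski z + e" "t * minkowski z \<le> minkowski (t *\<^sub>R z) + e"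
      using *[of "t * minkowski z + e"] *[of "minkowski (t *\<^sub>R z) + e"] nonneg by auto
  qed
qed

text \<open>A boundary point with functional less than 1 could be stretched radially inside \<open>X\<close>, although a defining function
  increases strictly in the radial direction there.\<close>

lemma frontier_iff_minkowski: "z \<in> frontier X \<longleftrightarrow> minkowski z = 1"
proof
  assume z: "z \<in> frontier X"
  then have "z \<noteq> 0" "minkowski z \<le> 1" using frontier_nonzero frontier_subset minkowski_le_1_iff by auto
  obtain U f n where U: "z \<in> U" "defining_function U f n"
    using ex_defining_function[OF z] by blast
  have "f z = 0" using defining_function_frontier[OF U(2)] U(1) z by blast
  then have out: "eventually (\<lambda>h. z + h *\<^sub>R z \<notin> X) (at_right 0)"
    using defining_function_leaves[OF U(2,1)] defining_function_gradient_inner_self[OF U(2) z U(1)] by blast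
  have "\<not> minkowski z < 1"
  proof
    assume less: "minkowski z < 1"
    define d where "d = 1 / minkowski z - 1"
    have d: "d > 0" using less minkowski_pos[OF \<open>z \<noteq> 0\<close>] by (simp add: d_def field_simps)
    have "z + h *\<^sub>R z \<in> X" if "0 < h" "h < d" for h
    proof -
      have "minkowski (z + h *\<^sub>R z) = (1 + h) * minkowski z"
        using minkowski_scale[of "1 + h" z] that by (simp add: algebra_simps)
      also have "\<dots> \<le> 1" using that less minkowski_pos[OF \<open>z \<noteq> 0\<close>] by (simp add: d_def field_simps)
      finally show ?thesis using minkowski_le_1_iff by blast
    qed
    then have "eventually (\<lambda>h. z + h *\<^sub>R z \<in> X) (at_right 0)"
      unfolding eventually_at_right_field using d by blast
    with out have "eventually (\<lambda>h::real. False) (at_right 0)" by eventually_elim blast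
    then show False by simp
  qed
  with \<open>minkowski z \<le> 1\<close> show "minkowski z = 1" by simp
next
  assume 1: "minkowski z = 1"
  then have "z \<in> X" using minkowski_le_1_iff[of z] by simp
  moreover have "z \<notin> interior X"
  proof
    assume "z \<in> interior X"
    moreover have "((\<lambda>h. (1 + h) *\<^sub>R z) \<longlongrightarrow> (1 + 0) *\<^sub>R z) (at_right 0)"
      by (intro tendsto_intros)
    ultimately have "eventually (\<lambda>h. (1 + h) *\<^sub>R z \<in> interior X) (at_right 0)"
      by (intro topological_tendstoD) auto
    moreover have "eventually (\<lambda>h::real. h > 0) (at_right 0)"
      by (rule eventually_at_right_less)
    ultimately have "eventually (\<lambda>h::real. False) (at_right 0)"
    proof eventually_elim
      case (elim h)
      then have "minkowski ((1 + h) *\<^sub>R z) \<le> 1" using minkowski_le_1_iff interior_subset by blast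
      then show False using minkowski_scale[of "1+h" z] elim 1 by simp
    qed
    then show False by simp
  qed
  ultimately show "z \<in> frontier X" using closure_subset by (auto simp: frontier_def)
qed

lemma normalize_mem_frontier:
  assumes "z \<noteq> 0"
  shows "z /\<^sub>R minkowski z \<in> frontier X"
  using minkowski_scale[of "inverse (minkowski z)" z] minkowski_pos[OF assms] by (simp add: frontier_iff_minkowski)

text \<open>The inequality \<open>minkowski y \<le> c\<close> says that \<open>f (y / c) \<le> 0\<close> for a defining function \<open>f\<close>. The derivative of
  \<open>f (y / c)\<close> as a function of \<open>(y, c)\<close> at \<open>(p, 1)\<close> decides this sign as soon as \<open>c\<close> differs
  from the linear prediction \<open>1 + conormal p \<bullet> (y - p)\<close> by \<open>e |y - p|\<close>.\<close>

lemma minkowski_has_derivative_at_frontier: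
  assumes p: "p \<in> frontier X"
  shows "(minkowski has_derivative (\<lambda>v. conormal p \<bullet> v)) (at p)"
  unfolding has_derivative_at_alt
proof (intro conjI allI impI)
  let ?l = "\<lambda>v. conormal p \<bullet> v"
  show "bounded_linear ?l" by (rule bounded_linear_inner_right)
  fix e :: real assume e: "e > 0"
  obtain U f n where U: "p \<in> U" and df: "defining_function U f n"
    using ex_defining_function[OF p] by blast
  define k where "k = n p \<bullet> p"
  have k: "k > 0" unfolding k_def by (rule defining_function_gradient_inner_self[OF df p U])
  have N: "n p = k *\<^sub>R conormal p"
    using defining_function_conormal[OF df p U] k by (simp add: k_def)
  have fp: "f p = 0" using defining_function_frontier[OF df] p U by blast
  have "((\<lambda>w. f (fst w /\<^sub>R snd w)) has_derivative (\<lambda>w. k * (?l (fst w) - snd w))) (at (p, 1))"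
  proof (rule has_derivative_eq_rhs)
    have "((\<lambda>w::'a\<times>real. fst w /\<^sub>R snd w) has_derivative (\<lambda>w. fst w - snd w *\<^sub>R p)) (at (p, 1))"
      by (auto intro!: derivative_eq_intros simp: algebra_simps)
    then show "((\<lambda>w. f (fst w /\<^sub>R snd w)) has_derivative (\<lambda>w. n p \<bullet> (fst w - snd w *\<^sub>R p))) (at (p, 1))"
      by (rule has_derivative_compose) (simp add: defining_function_derivative[OF df U])
    show "(\<lambda>w. n p \<bullet> (fst w - snd w *\<^sub>R p)) = (\<lambda>w. k * (?l (fst w) - snd w))"
      using conormal_inner_self[OF p] by (auto simp: N inner_diff_right algebra_simps)
  qed
  then have dphi: "\<And>e. 0 < e \<Longrightarrow> \<exists>d>0. \<forall>w. norm (w - (p, 1)) < d \<longrightarrow>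
      norm (f (fst w /\<^sub>R snd w) - f (p /\<^sub>R 1) - k * (?l (fst (w - (p, 1))) - snd (w - (p, 1)))) \<le> e * norm (w - (p, 1))"
    unfolding has_derivative_at_alt by auto
  \<comment> \<open>The points \<open>(y, c)\<close> considered below satisfy \<open>norm ((y, c) - (p, 1)) \<le> M * norm (y - p)\<close>.\<close>
  define M where "M = 1 + norm (conormal p) + e"
  have M: "M > 0" using e by (simp add: M_def add_nonneg_pos add_pos_nonneg)
  define e' where "e' = k * e / (2 * M)"
  have e': "e' > 0" using k e M by (simp add: e'_def)
  obtain d where d: "d > 0" "\<And>w. norm (w - (p, 1)) < d \<Longrightarrow>
      \<bar>f (fst w /\<^sub>R snd w) - k * (?l (fst (w - (p, 1))) - snd (w - (p, 1)))\<bar> \<le> e' * norm (w - (p, 1))"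
    using dphi[OF e'] fp by auto
  have "((\<lambda>w::'a\<times>real. fst w /\<^sub>R snd w) \<longlongrightarrow> fst (p, 1::real) /\<^sub>R snd (p, 1::real)) (at (p, 1))"
    by (intro tendsto_intros) auto
  then have "eventually (\<lambda>w::'a\<times>real. fst w /\<^sub>R snd w \<in> U) (at (p, 1))"
    using U defining_function_open[OF df] by (intro topological_tendstoD) auto
  then obtain d2 where "d2 > 0" and
      near: "\<forall>w::'a\<times>real. w \<noteq> (p, 1) \<and> dist w (p, 1) < d2 \<longrightarrow> fst w /\<^sub>R snd w \<in> U"
    unfolding eventually_at by auto
  have d2: "d2 > 0" "fst w /\<^sub>R snd w \<in> U" if "norm (w - (p,1)) < d2" for w :: "'a \<times> real"
  proof -
    show "fst w /\<^sub>R snd w \<in> U"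
      using near[rule_format, of w] that U by (cases "w = (p, 1)") (auto simp: dist_norm)
  qed fact
  define D where "D = min (min d d2) 1 / M"
  have D: "D > 0" using d \<open>d2 > 0\<close> M by (simp add: D_def)
  show "\<exists>d>0. \<forall>y. norm (y - p) < d \<longrightarrow> norm (minkowski y - minkowski p - ?l (y - p)) \<le> e * norm (y - p)"
  proof (intro exI[of _ D] conjI allI impI D)
    fix y assume y: "norm (y - p) < D"
    show "norm (minkowski y - minkowski p - ?l (y - p)) \<le> e * norm (y - p)"
    proof (cases "y = p")
      case False
      define m where "m = norm (y - p)"
      have m: "m > 0" using False by (simp add: m_def)
      have mM: "M * m < min (min d d2) 1" using y M by (simp add: D_def m_def field_simps)
      have ly: "\<bar>?l (y - p)\<bar> \<le> norm (conormal p) * m"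
        unfolding m_def by (rule Cauchy_Schwarz_ineq2)
      have *: "1 + ?l (y - p) + s * e * m > 0 \<and> y /\<^sub>R (1 + ?l (y - p) + s * e * m) \<in> U \<and>
         \<bar>f (y /\<^sub>R (1 + ?l (y - p) + s * e * m)) + k * (s * e * m)\<bar> \<le> k * e * m / 2"
        if s: "s = 1 \<or> s = -1" for s :: real
      proof -
        define c where "c = 1 + ?l (y - p) + s * e * m"
        have se: "\<bar>s * e * m\<bar> = e * m" using s e m by auto
        have c1: "\<bar>c - 1\<bar> \<le> norm (conormal p) * m + e * m"
          unfolding c_def using ly se by linarith
        have "norm ((y, c) - (p, 1)) \<le> norm (y - p) + norm (c - 1)"
          using norm_Pair_le[of "y - p" "c - 1"] by simp
        also have "\<dots> \<le> M * m" using c1 by (simp add: m_def M_def algebra_simps)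
        finally have nw: "norm ((y, c) - (p, 1)) \<le> M * m" .
        have "\<bar>c - 1\<bar> < M * m" using c1 m by (simp add: M_def algebra_simps)
        then have "c > 0" using mM by linarith
        moreover have "y /\<^sub>R c \<in> U" using d2(2)[of "(y,c)"] nw mM by simp
        moreover have "\<bar>f (y /\<^sub>R c) + k * (s * e * m)\<bar> \<le> e' * norm ((y, c) - (p, 1))"
          using d(2)[of "(y,c)"] nw mM by (simp add: c_def algebra_simps)
        moreover have "e' * norm ((y, c) - (p, 1)) \<le> e' * (M * m)"
          using nw e' by (intro mult_left_mono) auto
        moreover have "e' * (M * m) = k * e * m / 2" using M by (simp add: e'_def)
        ultimately show ?thesis unfolding c_def by linarith
      qed
      have kem: "k * e * m > 0" using k e m by simp
      let ?c = "1 + ?l (y - p) + e * m" and ?c' = "1 + ?l (y - p) - e * m"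
      have A: "\<bar>f (y /\<^sub>R ?c) + k * e * m\<bar> \<le> k * e * m / 2" "?c > 0" "y /\<^sub>R ?c \<in> U"
        using *[of 1] by (simp_all add: mult.assoc)
      have "f (y /\<^sub>R ?c) \<le> 0" using A(1) kem by linarith
      with A have "y /\<^sub>R ?c \<in> X" using defining_function_sublevel[OF df] by blast
      then have up: "minkowski y \<le> ?c" using minkowski_le_iff[OF A(2)] by blast
      have B: "\<bar>f (y /\<^sub>R ?c') - k * e * m\<bar> \<le> k * e * m / 2" "?c' > 0" "y /\<^sub>R ?c' \<in> U"
        using *[of "-1"] by (simp_all add: mult.assoc)
      have "f (y /\<^sub>R ?c') > 0" using B(1) kem by linarith
      with B have "y /\<^sub>R ?c' \<notin> X" using defining_function_sublevel[OF df] by force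
      then have lo: "?c' < minkowski y" using minkowski_le_iff[OF B(2)] by force
      have "minkowski p = 1" using p frontier_iff_minkowski by blast
      then show ?thesis using up lo unfolding m_def real_norm_def by linarith
    qed simp
  qed
qed

lemma minkowski_has_derivative:
  assumes z: "z \<noteq> 0"
  shows "(minkowski has_derivative (\<lambda>v. conormal (z /\<^sub>R minkowski z) \<bullet> v)) (at z)"
proof -
  define g where "g = minkowski z"
  have g: "g > 0" using minkowski_pos[OF z] by (simp add: g_def)
  have "((\<lambda>y. minkowski (y /\<^sub>R g)) has_derivative (\<lambda>v. conormal (z /\<^sub>R g) \<bullet> (v /\<^sub>R g))) (at z)"
  proof (rule has_derivative_compose[of "\<lambda>y. y /\<^sub>R g" "\<lambda>v. v /\<^sub>R g"])
    show "((\<lambda>y. y /\<^sub>R g) has_derivative (\<lambda>v. v /\<^sub>R g)) (at z)" by (intro derivative_intros)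
    show "(minkowski has_derivative (\<lambda>v. conormal (z /\<^sub>R g) \<bullet> v)) (at (z /\<^sub>R g))"
      unfolding g_def by (intro minkowski_has_derivative_at_frontier normalize_mem_frontier z)
  qed
  then have "((\<lambda>y. g * minkowski (y /\<^sub>R g)) has_derivative (\<lambda>v. g * (conormal (z /\<^sub>R g) \<bullet> (v /\<^sub>R g)))) (at z)"
    by (intro has_derivative_mult_right)
  moreover have "(\<lambda>y. g * minkowski (y /\<^sub>R g)) = minkowski"
    using g by (simp add: minkowski_scale mult.assoc[symmetric])
  moreover have "(\<lambda>v. g * (conormal (z /\<^sub>R g) \<bullet> (v /\<^sub>R g))) = (\<lambda>v. conormal (z /\<^sub>R g) \<bullet> v)"
    using g by (simp add: mult.assoc[symmetric])
  ultimately show ?thesis by (simp add: g_def)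
qed

lemma continuous_on_minkowski: "continuous_on (- {0}) minkowski"
  by (intro continuous_at_imp_continuous_on ballI has_derivative_continuous[OF minkowski_has_derivative]) auto

lemma frontier_homeomorphic_sphere: "frontier X homeomorphic sphere (0::'a) 1"
proof -
  have "continuous_on (sphere (0::'a) 1) minkowski"
    by (rule continuous_on_subset[OF continuous_on_minkowski]) auto
  moreover have minkowski_nonzero: "minkowski u \<noteq> 0" if "norm u = 1" for u
    using minkowski_pos[of u] that by force
  ultimately have "homeomorphism (frontier X) (sphere (0::'a) 1) (\<lambda>z. z /\<^sub>R norm z) (\<lambda>u. u /\<^sub>R minkowski u)"
  proof (intro homeomorphismI continuous_intros image_subsetI)
    fix z assume z: "z \<in> frontier X"
    then have "z \<noteq> 0" "minkowski z = 1" using frontier_nonzero frontier_iff_minkowski by auto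
    then show "z /\<^sub>R norm z /\<^sub>R minkowski (z /\<^sub>R norm z) = z"
      using minkowski_scale[of "inverse (norm z)" z] by simp
  next
    fix u :: 'a assume u: "u \<in> sphere 0 1"
    then have "u \<noteq> 0" by auto
    then have "minkowski u > 0" using minkowski_pos by blast
    then show "u /\<^sub>R minkowski u /\<^sub>R norm (u /\<^sub>R minkowski u) = u" using u by simp
    show "u /\<^sub>R minkowski u \<in> frontier X" using normalize_mem_frontier \<open>u \<noteq> 0\<close> by blast
  qed (auto dest: frontier_nonzero simp: minkowski_nonzero)
  then show ?thesis using homeomorphic_def by blast
qed

lemma connected_frontier:
  assumes "2 \<le> DIM('a)"
  shows "connected (frontier X)"
proof -
  have "connected (sphere (0::'a) 1)" using assms by (rule connected_sphere)
  then show ?thesis by (simp add: homeomorphic_connectedness[OF frontier_homeomorphic_sphere])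
qed

lemma Borsukian_frontier:
  assumes "3 \<le> DIM('a)"
  shows "Borsukian (frontier X)"
proof -
  have "simply_connected (sphere (0::'a) 1)" using assms by (rule simply_connected_sphere)
  then have "Borsukian (sphere (0::'a) 1)"
    by (rule simply_connected_imp_Borsukian[OF _ locally_path_connected_sphere])
  then show ?thesis by (simp add: homeomorphic_Borsukian_eq[OF frontier_homeomorphic_sphere])
qed

end


section \<open>Torus symmetry and angular speeds\<close>

lemma inner_complex_vec: "v \<bullet> w = (\<Sum>j\<in>UNIV. Re (cnj (v $ j) * w $ j))" for v w :: "complex ^ 'n"
  by (simp add: inner_vec_def inner_complex_def)

lemma symplectic_form_eq_inner: "symplectic_form v w = (\<i> *s v) \<bullet> w"
  by (simp add: symplectic_form_def inner_complex_vec algebra_simps)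

lemma liouville_form_eq_inner: "liouville_form z v = (\<i> *s z) \<bullet> v / 2"
  by (simp add: liouville_form_def inner_complex_vec algebra_simps)

lemma inner_i_i: "(\<i> *s v) \<bullet> (\<i> *s w) = v \<bullet> w" for v w :: "complex ^ 'n"
  by (simp add: inner_complex_vec algebra_simps)

lemma inner_i_self: "v \<bullet> (\<i> *s v) = 0" for v :: "complex ^ 'n"
  by (simp add: inner_complex_vec algebra_simps)

lemma inner_i_left: "(\<i> *s v) \<bullet> w = - (v \<bullet> (\<i> *s w))" for v w :: "complex ^ 'n"
  by (simp add: inner_complex_vec algebra_simps sum_negf[symmetric] del: sum_negf)

lemma has_derivative_vec_lambda:
  fixes f :: "'i::finite \<Rightarrow> 'a::real_normed_vector \<Rightarrow> 'b::euclidean_space"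
  assumes "\<And>i. (f i has_derivative f' i) net"
  shows "((\<lambda>x. \<chi> i. f i x) has_derivative (\<lambda>h. \<chi> i. f' i h)) net"
proof -
  have eq: "(\<chi> i. g i) = (\<Sum>i\<in>UNIV. axis i (g i))" for g :: "'i \<Rightarrow> 'b"
    by (simp add: vec_eq_iff axis_def)
  have "linear (axis i :: 'b \<Rightarrow> 'b ^ 'i)" for i
    by (rule linearI) (simp_all add: vec_eq_iff axis_def)
  then have "bounded_linear (axis i :: 'b \<Rightarrow> 'b ^ 'i)" for i
    by (simp add: linear_conv_bounded_linear)
  then show ?thesis
    unfolding eq by (intro has_derivative_sum bounded_linear.has_derivative[of "axis _"] assms)
qed

lemma has_vector_derivative_cis:
  "((\<lambda>t. cis (t * c) * x) has_vector_derivative \<i> * of_real c * (cis (t * c) * x)) (at t within S)"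
  unfolding has_vector_derivative_def
  by (rule has_derivative_eq_rhs, (rule derivative_intros)+) (simp add: fun_eq_iff scaleR_conv_of_real)

definition rot :: "real ^ 'n \<Rightarrow> complex ^ 'n \<Rightarrow> complex ^ 'n" where
  "rot \<theta> z = (\<chi> j. cis (\<theta> $ j) * z $ j)"

definition moduli :: "complex ^ 'n \<Rightarrow> complex ^ 'n" where
  "moduli z = (\<chi> j. of_real (cmod (z $ j)))"

lemma rot_nth [simp]: "rot \<theta> z $ j = cis (\<theta> $ j) * z $ j"
  by (simp add: rot_def)

lemma moduli_nth [simp]: "moduli z $ j = of_real (cmod (z $ j))"
  by (simp add: moduli_def)

lemma moduli_eq_iff: "moduli z = moduli w \<longleftrightarrow> (\<forall>j. cmod (z $ j) = cmod (w $ j))"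
  by (simp add: vec_eq_iff)

lemma moduli_moduli [simp]: "moduli (moduli z) = moduli z"
  by (simp add: vec_eq_iff)

lemma moduli_rot [simp]: "moduli (rot \<theta> z) = moduli z"
  by (simp add: vec_eq_iff norm_mult)

lemma moduli_eq_imp_rot:
  assumes "moduli w = moduli z"
  obtains \<theta> where "w = rot \<theta> z"
proof
  show "w = rot (\<chi> j. Arg (w $ j) - Arg (z $ j)) z"
  proof (simp add: vec_eq_iff, rule allI)
    fix j
    have "w $ j = rcis (cmod (z $ j)) (Arg (w $ j))"
      using assms rcis_cmod_Arg[of "w $ j"] by (simp add: moduli_eq_iff)
    also have "\<dots> = cis (Arg (w $ j) - Arg (z $ j)) * rcis (cmod (z $ j)) (Arg (z $ j))"
      by (simp add: rcis_def cis_mult mult.left_commute)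
    finally show "w $ j = cis (Arg (w $ j) - Arg (z $ j)) * z $ j"
      by (simp add: rcis_cmod_Arg)
  qed
qed

lemma continuous_on_moduli: "continuous_on S moduli"
  unfolding moduli_def by (intro continuous_intros)

lemma bounded_linear_rot: "bounded_linear (rot \<theta>)"
  unfolding linear_conv_bounded_linear[symmetric]
  by (rule linearI) (simp_all add: vec_eq_iff algebra_simps)

lemma inner_rot: "rot \<theta> v \<bullet> w = v \<bullet> rot (- \<theta>) w"
  by (simp add: inner_complex_vec cis_cnj algebra_simps)

lemma rot_minus [simp]: "rot \<theta> (rot (- \<theta>) z) = z" "rot (- \<theta>) (rot \<theta> z) = z"
  by (simp_all add: vec_eq_iff mult.assoc[symmetric] cis_mult)

lemma torus_curve_derivative:
  "((\<lambda>t. rot (t *\<^sub>R a) z) has_vector_derivative (\<chi> j. \<i> * of_real (a $ j) * z $ j)) (at 0 within {0..})"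
  unfolding has_vector_derivative_def rot_def
proof (rule has_derivative_eq_rhs, rule has_derivative_vec_lambda)
  fix j
  have "((\<lambda>t. cis (t * a $ j) * z $ j) has_vector_derivative \<i> * of_real (a $ j) * z $ j) (at 0 within {0..})"
    using has_vector_derivative_cis[of "a $ j" "z $ j" 0 "{0..}"] by simp
  then show "((\<lambda>t. cis ((t *\<^sub>R a) $ j) * z $ j) has_derivative (\<lambda>t. t *\<^sub>R (\<i> * of_real (a $ j) * z $ j)))
     (at 0 within {0..})"
    by (simp add: has_vector_derivative_def)
qed (simp add: fun_eq_iff vec_eq_iff)

locale toric_star_domain = smooth_star_domain "toric_domain \<Omega>" for \<Omega> :: "(real ^ 'n) set"
begin

abbreviation "X \<equiv> toric_domain \<Omega>"
abbreviation "F \<equiv> frontier X"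

lemma conormal_nonzero: "z \<in> F \<Longrightarrow> conormal z \<noteq> 0"
  using conormal_inner_self[of z] by force

text \<open>The symplectic form is \<open>(i v) \<bullet> w\<close>, so a vector is in the kernel of its restriction to the tangent space iff
  its product with \<open>i\<close> is normal to the boundary.\<close>

lemma reeb_vector_eq:
  assumes z: "z \<in> F"
  shows "reeb_vector X z = 2 *\<^sub>R (\<i> *s conormal z)"
  unfolding reeb_vector_def
proof (rule the_equality)
  have "\<i> *s (\<i> *s v) = - v" for v :: "complex ^ 'n" by (simp add: vec_eq_iff)
  then have ii: "\<i> *s (2 *\<^sub>R (\<i> *s v)) = - 2 *\<^sub>R v" for v :: "complex ^ 'n" by (simp add: vec_eq_iff)
  show "2 *\<^sub>R (\<i> *s conormal z) \<in> tangent_cone F z \<and> liouville_form z (2 *\<^sub>R (\<i> *s conormal z)) = 1 \<and>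
    (\<forall>v\<in>tangent_cone F z. symplectic_form (2 *\<^sub>R (\<i> *s conormal z)) v = 0)"
    using conormal_inner_self[OF z]
    by (auto simp: tangent_cone_frontier[OF z] inner_i_self liouville_form_eq_inner inner_i_i
        symplectic_form_eq_inner ii inner_commute)
  fix R assume R: "R \<in> tangent_cone F z \<and> liouville_form z R = 1 \<and>
     (\<forall>v\<in>tangent_cone F z. symplectic_form R v = 0)"
  have "\<i> *s R = ((\<i> *s R) \<bullet> conormal z / (conormal z \<bullet> conormal z)) *\<^sub>R conormal z"
    using R by (intro orthogonal_to_hyperplane_imp_parallel conormal_nonzero z)
      (auto simp: symplectic_form_eq_inner tangent_cone_frontier[OF z])
  then obtain c where c: "\<i> *s R = c *\<^sub>R conormal z" by blast
  have "R = - (\<i> *s (\<i> *s R))" by (simp add: vec_eq_iff)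
  also have "\<dots> = (- c) *\<^sub>R (\<i> *s conormal z)" unfolding c by (simp add: vec_eq_iff)
  finally have R': "R = (- c) *\<^sub>R (\<i> *s conormal z)" .
  have "2 = (\<i> *s z) \<bullet> R" using R by (simp add: liouville_form_eq_inner)
  also have "\<dots> = - c" unfolding R' using conormal_inner_self[OF z] by (simp add: inner_i_i inner_commute)
  finally show "R = 2 *\<^sub>R (\<i> *s conormal z)" using R' by simp
qed

lemma minkowski_cong:
  assumes "moduli z = moduli w"
  shows "minkowski z = minkowski w"
proof -
  have "(z /\<^sub>R c \<in> X) = (w /\<^sub>R c \<in> X)" for c :: real
    using assms unfolding toric_domain_def by (simp add: moduli_eq_iff)
  then show ?thesis unfolding minkowski_def by simp
qed

lemma mem_frontier_cong: "moduli z = moduli w \<Longrightarrow> z \<in> F \<longleftrightarrow> w \<in> F"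
  using minkowski_cong[of z w] by (simp add: frontier_iff_minkowski)

lemma rot_mem_frontier [simp]: "rot \<theta> z \<in> F \<longleftrightarrow> z \<in> F"
  by (rule mem_frontier_cong) simp

lemma moduli_mem_frontier [simp]: "moduli z \<in> F \<longleftrightarrow> z \<in> F"
  by (rule mem_frontier_cong) simp

lemma conormal_rot:
  assumes z: "z \<in> F"
  shows "conormal (rot \<theta> z) = rot \<theta> (conormal z)"
proof (rule conormal_eqI)
  show "rot \<theta> z \<in> F" using z by simp
  show "rot \<theta> (conormal z) \<bullet> rot \<theta> z = 1"
    using conormal_inner_self[OF z] by (simp add: inner_rot)
  fix v assume v: "v \<in> tangent_cone F (rot \<theta> z)"
  have "rot (- \<theta>) v \<in> tangent_cone F (rot (- \<theta>) (rot \<theta> z))"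
    by (rule derivative_maps_tangent_cone[OF bounded_linear_imp_has_derivative[OF bounded_linear_rot] _ v]) auto
  then show "rot \<theta> (conormal z) \<bullet> v = 0"
    using tangent_cone_frontier[OF z] by (simp add: inner_rot)
qed

lemma torus_direction_tangent:
  assumes z: "z \<in> F"
  shows "(\<chi> j. \<i> * of_real (a $ j) * z $ j) \<in> tangent_cone F z"
proof -
  show ?thesis
    using torus_curve_derivative[of a z] unfolding tangent_cone_def
    by (intro CollectI exI[of _ "\<lambda>t. rot (t *\<^sub>R a) z"]) (use z in \<open>auto simp: vec_eq_iff\<close>)
qed

text \<open>The conormal is orthogonal to the torus orbit through \<open>z\<close>.\<close>

lemma conormal_component_real:
  assumes z: "z \<in> F"
  shows "Im (cnj (z $ j) * conormal z $ j) = 0"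
proof -
  have "conormal z \<bullet> (\<chi> k. \<i> * of_real (axis j 1 $ k) * z $ k) = 0"
    using torus_direction_tangent[OF z] tangent_cone_frontier[OF z] by blast
  also have "conormal z \<bullet> (\<chi> k. \<i> * of_real (axis j 1 $ k) * z $ k) =
     (\<Sum>k\<in>UNIV. if k = j then Re (cnj (conormal z $ j) * (\<i> * z $ j)) else 0)"
    unfolding inner_complex_vec by (rule sum.cong) (auto simp: axis_def)
  finally show ?thesis by (simp add: algebra_simps)
qed

text \<open>The rotation by \<open>\<pi>\<close> of the \<open>j\<close>-th coordinate fixes \<open>z\<close>, hence also its conormal.\<close>

lemma conormal_component_zero:
  assumes z: "z \<in> F" "z $ j = 0"
  shows "conormal z $ j = 0"
proof -
  have "rot (axis j pi) z = z" using z(2) by (simp add: vec_eq_iff axis_def)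
  then have "conormal z $ j = rot (axis j pi) (conormal z) $ j"
    using conormal_rot[OF z(1), of "axis j pi"] by simp
  then show ?thesis by (simp add: axis_def)
qed

definition angular_ratio :: "'n \<Rightarrow> complex ^ 'n \<Rightarrow> real" where
  "angular_ratio j z = 2 * Re (cnj (z $ j) * conormal z $ j) / (cmod (z $ j))\<^sup>2"

text \<open>Where \<open>z\<^sub>j = 0\<close> the quotient is 0/0 and the speed is the limit of the quotient. Taking the limit at
  \<open>moduli z\<close> through points with nonnegative real coordinates makes the definition invariant under the torus from the outset.\<close>

definition angular_speed :: "'n \<Rightarrow> complex ^ 'n \<Rightarrow> real" where
  "angular_speed j z = (if z $ j \<noteq> 0 then angular_ratio j z
     else Lim (at (moduli z) within {w \<in> F. w $ j \<noteq> 0 \<and> moduli w = w}) (angular_ratio j))"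

lemma angular_ratio_cong:
  assumes "z \<in> F" "moduli w = moduli z"
  shows "angular_ratio j w = angular_ratio j z"
proof -
  obtain \<theta> where "w = rot \<theta> z" using moduli_eq_imp_rot[OF assms(2)] .
  moreover have "cnj (cis t * x) * (cis t * y) = cnj x * y" for t x y
  proof -
    have "cnj (cis t * x) * (cis t * y) = (cis (- t) * cis t) * (cnj x * y)"
      by (simp add: cis_cnj)
    then show ?thesis by (simp add: cis_mult)
  qed
  ultimately show ?thesis
    unfolding angular_ratio_def by (simp only: conormal_rot[OF assms(1)] rot_nth norm_mult norm_cis mult_1)
qed

lemma angular_speed_cong:
  assumes "z \<in> F" "moduli w = moduli z"
  shows "angular_speed j w = angular_speed j z"
proof -
  have "w $ j = 0 \<longleftrightarrow> z $ j = 0"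
    using assms(2) unfolding moduli_eq_iff by (metis norm_eq_zero)
  then show ?thesis
    using angular_ratio_cong[OF assms, of j] assms(2) by (simp add: angular_speed_def)
qed

lemma angular_speed_rot [simp]: "z \<in> F \<Longrightarrow> angular_speed j (rot \<theta> z) = angular_speed j z"
  by (rule angular_speed_cong) auto

lemma conormal_component:
  assumes z: "z \<in> F"
  shows "2 * conormal z $ j = of_real (angular_speed j z) * z $ j"
proof (cases "z $ j = 0")
  case True
  then show ?thesis using conormal_component_zero[OF z] by simp
next
  case False
  define w where "w = cnj (z $ j) * conormal z $ j"
  have w: "w = of_real (Re w)" using conormal_component_real[OF z] by (simp add: w_def complex_eq_iff)
  have "z $ j * w = of_real ((cmod (z $ j))\<^sup>2) * conormal z $ j"
    using complex_norm_square[of "z $ j"] by (simp add: w_def)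
  then have "of_real ((cmod (z $ j))\<^sup>2) * conormal z $ j = z $ j * of_real (Re w)" using w by simp
  then show ?thesis
    using False by (simp add: angular_speed_def angular_ratio_def w_def[symmetric] field_simps)
qed

lemma reeb_vector_component:
  assumes z: "z \<in> F"
  shows "reeb_vector X z $ j = \<i> * of_real (angular_speed j z) * z $ j"
  using conormal_component[OF z, of j] by (simp add: reeb_vector_eq[OF z] scaleR_conv_of_real mult.left_commute mult.assoc)

lemma inner_conormal:
  assumes z: "z \<in> F"
  shows "2 * (conormal z \<bullet> v) = (\<Sum>j\<in>UNIV. angular_speed j z * Re (cnj (z $ j) * v $ j))"
proof -
  have "2 * Re (cnj (conormal z $ j) * v $ j) = angular_speed j z * Re (cnj (z $ j) * v $ j)" for j
  proof -
    have "2 * Re (cnj (conormal z $ j) * v $ j) = Re (cnj (2 * conormal z $ j) * v $ j)" by simp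
    also have "\<dots> = angular_speed j z * Re (cnj (z $ j) * v $ j)"
      unfolding conormal_component[OF z] by (simp add: algebra_simps)
    finally show ?thesis .
  qed
  then show ?thesis by (simp add: inner_complex_vec sum_distrib_left)
qed

lemma sum_angular_speed:
  assumes z: "z \<in> F"
  shows "(\<Sum>j\<in>UNIV. angular_speed j z * (cmod (z $ j))\<^sup>2) = 2"
proof -
  have "Re (cnj x * x) = (cmod x)\<^sup>2" for x by (simp add: cmod_def power2_eq_square)
  then show ?thesis
    using inner_conormal[OF z, of z] conormal_inner_self[OF z] by simp
qed

lemma angular_ratio_differentiable:
  assumes z: "z \<in> F" "z $ j \<noteq> 0"
  shows "angular_ratio j differentiable (at z within F)"
proof -
  obtain D where D: "(conormal has_derivative D) (at z within F)"
    using conormal_differentiable[OF z(1)] unfolding differentiable_def by blast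
  have n: "((\<lambda>x. conormal x $ j) has_derivative (\<lambda>v. D v $ j)) (at z within F)"
    using bounded_linear.has_derivative[OF bounded_linear_vec_nth D] .
  have i: "((\<lambda>x::complex^'n. x $ j) has_derivative (\<lambda>v. v $ j)) (at z within F)"
    by (rule bounded_linear.has_derivative[OF bounded_linear_vec_nth has_derivative_ident])
  have sq: "(cmod y)\<^sup>2 = y \<bullet> y" for y :: complex by (simp add: power2_norm_eq_inner)
  have "Re (cnj x * y) = x \<bullet> y" for x y by (simp add: inner_complex_def)
  then have eq: "angular_ratio j = (\<lambda>x. 2 * ((x $ j) \<bullet> conormal x $ j) / ((x $ j) \<bullet> (x $ j)))"
    unfolding angular_ratio_def sq by simp
  show ?thesis unfolding eq
    by (intro differentiable_divide differentiable_mult differentiable_inner differentiableI[OF n]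
        differentiableI[OF i] differentiable_const) (use z in auto)
qed

lemma angular_speed_differentiable:
  assumes z: "z \<in> F" "z $ j \<noteq> 0"
  shows "angular_speed j differentiable (at z within F)"
proof -
  have "open {x::complex^'n. x $ j \<noteq> 0}"
    by (intro open_Collect_neq continuous_intros)
  then obtain d where d: "d > 0" "\<And>x. dist x z < d \<Longrightarrow> x $ j \<noteq> 0"
    using z unfolding open_dist by auto
  show ?thesis
    by (rule differentiable_transform_within[OF angular_ratio_differentiable[OF z] d(1) z(1)])
       (use d(2) in \<open>auto simp: angular_speed_def\<close>)
qed

end


section \<open>Continuity of the angular speeds on the axes\<close>

lemma two_indices:
  fixes j :: 2
  obtains i where "i \<noteq> j" "UNIV = {i, j}"
proof (cases "j = 1")
  case True
  then show ?thesis using that[of 2] UNIV_2 by auto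
next
  case False
  then have "j = 2" using exhaust_2 by blast
  then show ?thesis using that[of 1] UNIV_2 by auto
qed

locale toric_star_domain_4 = toric_star_domain \<Omega> for \<Omega> :: "(real ^ 2) set"
begin

text \<open>Points \<open>w\<close> with nonnegative real coordinates have the form \<open>p + u e\<^sub>i + s e\<^sub>j\<close> with
  real \<open>u\<close> and \<open>s > 0\<close>. The Minkowski functional is 1 at both \<open>w\<close> and \<open>p\<close>, and its gradient
  at \<open>p\<close> has only an \<open>i\<close>-th component, so \<open>u = o(s)\<close>. The \<open>j\<close>-th component of the conormal vanishes at
  \<open>p\<close>; its first order expansion there, divided by \<open>s\<close>, converges to its partial derivative in the direction
  \<open>e\<^sub>j\<close>.\<close>

lemma tendsto_angular_ratio_at_axis:
  assumes p: "p \<in> F" "p $ j = 0" "moduli p = p"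
  defines "S \<equiv> {w \<in> F. w $ j \<noteq> 0 \<and> moduli w = w}"
  obtains \<beta> where "(angular_ratio j \<longlongrightarrow> \<beta>) (at p within S)"
proof -
  obtain i where i: "i \<noteq> j" "UNIV = {i, j}" by (rule two_indices)
  have sum2: "(\<Sum>k\<in>UNIV. g k) = g i + g j" for g :: "2 \<Rightarrow> real"
    using i by (simp add: i(2))
  have all2: "(\<forall>k. Q k) \<longleftrightarrow> Q i \<and> Q j" for Q
    using ball_UNIV[of Q] unfolding i(2) by simp
  define r where "r = cmod (p $ i)"
  have pi: "p $ i = of_real r" using p(3) unfolding r_def by (metis moduli_nth)
  define n where "n = Re (conormal p $ i)"
  have "n * r = 1"
    using conormal_inner_self[OF p(1)] p(2) by (simp add: inner_complex_vec sum2 pi n_def)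
  have r: "r > 0" using \<open>n * r = 1\<close> by (cases "r = 0") (auto simp: r_def)
  define u where "u w = cmod (w $ i) - r" for w
  define s where "s w = cmod (w $ j)" for w
  have S: "w \<in> F" "s w > 0" "w - p = u w *\<^sub>R axis i 1 + s w *\<^sub>R axis j 1"
     "w $ j = of_real (s w)" "norm (w - p) \<le> \<bar>u w\<bar> + s w" if "w \<in> S" for w
  proof -
    show "w \<in> F" "s w > 0" using that by (auto simp: S_def s_def)
    have "moduli w = w" using that by (simp add: S_def)
    then have w: "w $ i = of_real (cmod (w $ i))" "w $ j = of_real (cmod (w $ j))"
      by (metis moduli_nth)+
    then show "w $ j = of_real (s w)" by (simp add: s_def)
    show eq: "w - p = u w *\<^sub>R axis i 1 + s w *\<^sub>R axis j 1"
      unfolding vec_eq_iff all2 using w pi p(2) i(1)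
      by (simp add: axis_def u_def s_def scaleR_conv_of_real[where 'a=complex])
    have "norm (w - p) \<le> (\<Sum>k\<in>UNIV. norm ((w - p) $ k))"
      unfolding norm_vec_def by (rule L2_set_le_sum) simp
    also have "\<dots> = \<bar>u w\<bar> + s w"
      unfolding sum2 eq using i(1) \<open>s w > 0\<close> by (simp add: axis_def)
    finally show "norm (w - p) \<le> \<bar>u w\<bar> + s w" .
  qed
  have inS: "eventually (\<lambda>w. w \<in> S) (at p within S)" by (simp add: eventually_at_filter)
  have small: "eventually (\<lambda>w. \<bar>u w\<bar> \<le> e * s w) (at p within S)" if e: "e > 0" for e
  proof -
    \<comment> \<open>Chosen so that \<open>|u| / r \<le> e' (|u| + s)\<close> is equivalent to \<open>|u| \<le> e s\<close>.\<close>
    define e' where "e' = e / (r * (1 + e))"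
    have e': "e' > 0" using e r by (simp add: e'_def)
    have "(minkowski has_derivative (\<lambda>v. conormal p \<bullet> v)) (at p within S)"
      using minkowski_has_derivative_at_frontier[OF p(1)] by (rule has_derivative_at_withinI)
    then have "eventually (\<lambda>w. norm (minkowski w - minkowski p - conormal p \<bullet> (w - p)) \<le> e' * norm (w - p)) (at p within S)"
      unfolding has_derivative_within_alt2 using e' by simp
    with inS show ?thesis
    proof eventually_elim
      case (elim w)
      note S = S[OF elim(1)]
      have "minkowski w = 1" "minkowski p = 1" using S(1) p(1) frontier_iff_minkowski by blast+
      moreover have "conormal p \<bullet> (w - p) = n * u w"
        unfolding S(3) inner_complex_vec sum2 using i(1) conormal_component_zero[OF p(1,2)]
        by (simp add: axis_def n_def)
      ultimately have "\<bar>n * u w\<bar> \<le> e' * norm (w - p)" using elim(2) by simp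
      also have "\<dots> \<le> e' * (\<bar>u w\<bar> + s w)" using S(5) e' by simp
      finally have "\<bar>n * u w\<bar> \<le> e' * (\<bar>u w\<bar> + s w)" .
      moreover have "n = 1 / r" using \<open>n * r = 1\<close> r by (simp add: field_simps)
      ultimately have "\<bar>u w\<bar> / r \<le> e / (r * (1 + e)) * (\<bar>u w\<bar> + s w)" using r by (simp add: e'_def abs_mult)
      then have "\<bar>u w\<bar> * (1 + e) \<le> e * (\<bar>u w\<bar> + s w)" using r e by (simp add: field_simps add_pos_pos)
      then show ?case by (simp add: algebra_simps)
    qed
  qed
  obtain D where "(conormal has_derivative D) (at p within F)"
    using conormal_differentiable[OF p(1)] unfolding differentiable_def by blast
  then have D: "(conormal has_derivative D) (at p within S)"
    by (rule has_derivative_subset) (auto simp: S_def)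
  then have linD: "linear D" using has_derivative_linear by blast
  define \<beta> where "\<beta> = 2 * Re (D (axis j 1) $ j)"
  have "(angular_ratio j \<longlongrightarrow> \<beta>) (at p within S)"
  proof (rule tendstoI)
    fix e :: real assume e: "e > 0"
    define K where "K = cmod (D (axis i 1) $ j)"
    have K: "K \<ge> 0" by (simp add: K_def)
    define e1 where "e1 = min 1 (e / (8 * (K + 1)))"
    have e1: "e1 > 0" "e1 \<le> 1" using e K by (auto simp: e1_def add_nonneg_pos)
    have "e1 * (K + 1) \<le> e / (8 * (K + 1)) * (K + 1)"
      using K by (intro mult_right_mono) (auto simp: e1_def)
    also have "\<dots> = e / 8" using K by (simp add: field_simps)
    finally have e1K: "e1 * (K + 1) \<le> e / 8" .
    have "eventually (\<lambda>w. norm (conormal w - conormal p - D (w - p)) \<le> e / 16 * norm (w - p)) (at p within S)"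
      using D[unfolded has_derivative_within_alt2, THEN conjunct2, rule_format, of "e / 16"] e by simp
    with inS small[OF e1(1)] show "eventually (\<lambda>w. dist (angular_ratio j w) \<beta> < e) (at p within S)"
    proof eventually_elim
      case (elim w)
      note S = S[OF elim(1)]
      let ?N = "conormal w $ j"
      have "norm ((conormal w - conormal p - D (w - p)) $ j) \<le> e / 16 * norm (w - p)"
        by (rule order_trans[OF Finite_Cartesian_Product.norm_nth_le elim(3)])
      also have "(conormal w - conormal p - D (w - p)) $ j
          = ?N - u w *\<^sub>R D (axis i 1) $ j - s w *\<^sub>R D (axis j 1) $ j"
        unfolding S(3) using conormal_component_zero[OF p(1,2)]
        by (simp add: linear_add[OF linD] linear_scale[OF linD])
      finally have "norm (?N - u w *\<^sub>R D (axis i 1) $ j - s w *\<^sub>R D (axis j 1) $ j) \<le> e / 16 * (\<bar>u w\<bar> + s w)"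
        using mult_left_mono[OF S(5), of "e / 16"] e by linarith
      also have "\<dots> \<le> e / 16 * (2 * s w)"
      proof -
        have "e1 * s w \<le> 1 * s w" using e1 S(2) by (intro mult_right_mono) auto
        then show ?thesis using elim(2) e by (intro mult_left_mono) auto
      qed
      finally have *: "norm (?N - u w *\<^sub>R D (axis i 1) $ j - s w *\<^sub>R D (axis j 1) $ j) \<le> e / 8 * s w" by simp
      have "norm (u w *\<^sub>R D (axis i 1) $ j) = \<bar>u w\<bar> * K" by (simp add: K_def)
      also have "\<dots> \<le> (e1 * s w) * K" using elim(2) K by (intro mult_right_mono)
      also have "\<dots> \<le> e / 8 * s w"
      proof -
        have "e1 * K \<le> e / 8" using e1K e1 by (simp add: algebra_simps)
        then have "(e1 * K) * s w \<le> e / 8 * s w" using S(2) by (intro mult_right_mono) auto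
        then show ?thesis by (simp add: algebra_simps)
      qed
      finally have **: "norm (u w *\<^sub>R D (axis i 1) $ j) \<le> e / 8 * s w" .
      have "norm (?N - s w *\<^sub>R D (axis j 1) $ j) \<le>
        norm (?N - u w *\<^sub>R D (axis i 1) $ j - s w *\<^sub>R D (axis j 1) $ j) + norm (u w *\<^sub>R D (axis i 1) $ j)"
        using norm_triangle_ineq[of "?N - u w *\<^sub>R D (axis i 1) $ j - s w *\<^sub>R D (axis j 1) $ j" "u w *\<^sub>R D (axis i 1) $ j"]
        by (simp add: algebra_simps)
      with * ** have "norm (?N - s w *\<^sub>R D (axis j 1) $ j) \<le> e / 4 * s w" by simp
      then have "\<bar>Re ?N - s w * Re (D (axis j 1) $ j)\<bar> \<le> e / 4 * s w"
        using abs_Re_le_cmod[of "?N - s w *\<^sub>R D (axis j 1) $ j"] by simp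
      then have "\<bar>2 * Re ?N - s w * \<beta>\<bar> \<le> e / 2 * s w"
      proof -
        have "2 * Re ?N - s w * \<beta> = 2 * (Re ?N - s w * Re (D (axis j 1) $ j))"
          by (simp add: \<beta>_def algebra_simps)
        with \<open>\<bar>Re ?N - s w * Re (D (axis j 1) $ j)\<bar> \<le> e / 4 * s w\<close> show ?thesis
          by (simp only: abs_mult) simp
      qed
      moreover have "angular_ratio j w = 2 * Re ?N / s w"
        unfolding angular_ratio_def S(4) using S(2) by (simp add: power2_eq_square)
      moreover have "\<bar>angular_ratio j w - \<beta>\<bar> * s w = \<bar>(angular_ratio j w - \<beta>) * s w\<bar>"
        using S(2) by (simp add: abs_mult)
      moreover have "(angular_ratio j w - \<beta>) * s w = 2 * Re ?N - s w * \<beta>"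
        unfolding \<open>angular_ratio j w = 2 * Re ?N / s w\<close> using S(2) by (simp add: field_simps)
      ultimately have "\<bar>angular_ratio j w - \<beta>\<bar> * s w \<le> e / 2 * s w"
        by simp
      then have "\<bar>angular_ratio j w - \<beta>\<bar> \<le> e / 2" using S(2) by (simp only: mult_le_cancel_right_pos)
      then show ?case using e by (simp add: dist_real_def)
    qed
  qed
  then show ?thesis by (rule that)
qed

text \<open>The boundary meets a coordinate line in a single circle, since every ray from the origin meets it once. A limit along the
  boundary at a point of this circle therefore only has to be computed off the coordinate line.\<close>

lemma moduli_eq_at_axis:
  assumes p: "p \<in> F" "p $ j = 0" and q: "q \<in> F" "q $ j = 0"
  shows "moduli q = moduli p"
proof -
  obtain i where i: "i \<noteq> j" "UNIV = {i, j}" by (rule two_indices)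
  have all2: "(\<forall>k. Q k) \<longleftrightarrow> Q i \<and> Q j" for Q
    using ball_UNIV[of Q] unfolding i(2) by simp
  have "p \<noteq> 0" "q \<noteq> 0" using p q frontier_nonzero by auto
  then have nz: "p $ i \<noteq> 0" "q $ i \<noteq> 0" using p(2) q(2) unfolding vec_eq_iff all2 by auto
  define c where "c = cmod (q $ i) / cmod (p $ i)"
  have c: "c > 0" using nz by (simp add: c_def)
  have eq: "moduli q = c *\<^sub>R moduli p"
    unfolding vec_eq_iff all2 using p(2) q(2) nz by (simp add: c_def scaleR_conv_of_real[where 'a=complex])
  have "minkowski (moduli q) = 1" "minkowski (moduli p) = 1"
    using p q by (simp_all add: frontier_iff_minkowski[symmetric])
  then have "c = 1" using minkowski_scale[OF c, of "moduli p"] eq by simp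
  then show ?thesis using eq by simp
qed

lemma angular_speed_tendsto_at_axis:
  assumes p: "p \<in> F" "p $ j = 0"
  shows "(angular_speed j \<longlongrightarrow> angular_speed j p) (at p within F)"
proof -
  define S where "S = {w \<in> F. w $ j \<noteq> 0 \<and> moduli w = w}"
  have "(angular_ratio j \<longlongrightarrow> angular_speed j p) (at (moduli p) within S)"
  proof (cases "at (moduli p) within S = bot")
    case False
    obtain \<beta> where \<beta>: "(angular_ratio j \<longlongrightarrow> \<beta>) (at (moduli p) within S)"
      using tendsto_angular_ratio_at_axis[of "moduli p" j] p unfolding S_def by auto
    then have "Lim (at (moduli p) within S) (angular_ratio j) = \<beta>"
      by (rule tendsto_Lim[OF False])
    then show ?thesis using \<beta> p(2) by (simp add: angular_speed_def S_def)
  qed simp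
  moreover have "filterlim moduli (at (moduli p) within S) (at p within {w \<in> F. w $ j \<noteq> 0})"
    unfolding filterlim_at
  proof
    show "(moduli \<longlongrightarrow> moduli p) (at p within {w \<in> F. w $ j \<noteq> 0})"
      using tendsto_within_subset[OF bspec[OF continuous_on_moduli[of UNIV, unfolded continuous_on_def] UNIV_I]]
      by simp
    have "moduli w \<in> S \<and> moduli w \<noteq> moduli p" if "w \<in> F" "w $ j \<noteq> 0" for w
      using that p(2) by (auto simp: S_def moduli_eq_iff intro!: exI[of _ j])
    then show "\<forall>\<^sub>F x in at p within {w \<in> F. w $ j \<noteq> 0}. moduli x \<in> S \<and> moduli x \<noteq> moduli p"
      by (simp add: eventually_at_filter)
  qed
  ultimately have "((\<lambda>w. angular_ratio j (moduli w)) \<longlongrightarrow> angular_speed j p) (at p within {w \<in> F. w $ j \<noteq> 0})"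
    by (rule filterlim_compose)
  then have 1: "(angular_speed j \<longlongrightarrow> angular_speed j p) (at p within {w \<in> F. w $ j \<noteq> 0})"
  proof (rule Lim_transform_eventually)
    have "angular_ratio j (moduli w) = angular_speed j w" if "w \<in> F" "w $ j \<noteq> 0" for w
      using that angular_ratio_cong[of w "moduli w" j] by (simp add: angular_speed_def)
    then show "\<forall>\<^sub>F w in at p within {w \<in> F. w $ j \<noteq> 0}. angular_ratio j (moduli w) = angular_speed j w"
      by (simp add: eventually_at_filter)
  qed
  have 2: "(angular_speed j \<longlongrightarrow> angular_speed j p) (at p within {w \<in> F. w $ j = 0})"
  proof (rule tendsto_eventually)
    have "angular_speed j w = angular_speed j p" if "w \<in> F" "w $ j = 0" for w
      using that moduli_eq_at_axis[OF p that] by (intro angular_speed_cong p)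
    then show "\<forall>\<^sub>F w in at p within {w \<in> F. w $ j = 0}. angular_speed j w = angular_speed j p"
      by (simp add: eventually_at_filter)
  qed
  have "F = {w \<in> F. w $ j \<noteq> 0} \<union> {w \<in> F. w $ j = 0}" by blast
  then show ?thesis using Lim_Un[OF 1 2] by simp
qed

lemma continuous_on_angular_speed: "continuous_on F (angular_speed j)"
  unfolding continuous_on_def
proof
  fix p assume p: "p \<in> F"
  show "(angular_speed j \<longlongrightarrow> angular_speed j p) (at p within F)"
  proof (cases "p $ j = 0")
    case False
    then show ?thesis
      using differentiable_imp_continuous_within[OF angular_speed_differentiable[OF p]]
      by (simp add: continuous_within)
  qed (rule angular_speed_tendsto_at_axis[OF p])
qed

end


section \<open>Outward normals of the moment image\<close>

text \<open>By the mean value inequality on the convex set \<open>D\<close>, the function \<open>h - k x0 \<bullet> (\<cdot>)\<close> has arbitrarily small Lipschitz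
  constants near \<open>x0\<close>, and by continuity these bounds persist on \<open>S\<close>.\<close>

lemma derivative_extends_to_boundary:
  fixes h :: "'a::euclidean_space \<Rightarrow> real"
  assumes D: "open D" "convex D" "D \<subseteq> S" "S \<subseteq> closure D" and x0: "x0 \<in> S"
    and cont: "continuous_on S h"
    and der: "\<And>x. x \<in> D \<Longrightarrow> (h has_derivative (\<lambda>v. k x \<bullet> v)) (at x)"
    and k: "(k \<longlongrightarrow> k x0) (at x0 within S)"
  shows "(h has_derivative (\<lambda>v. k x0 \<bullet> v)) (at x0 within S)"
  unfolding has_derivative_within_alt
proof (intro conjI allI impI)
  show "bounded_linear (\<lambda>v. k x0 \<bullet> v)" by (rule bounded_linear_inner_right)
  fix e :: real assume e: "e > 0"
  obtain d where d: "d > 0" "\<And>x. x \<in> S \<Longrightarrow> x \<noteq> x0 \<Longrightarrow> dist x x0 < d \<Longrightarrow> dist (k x) (k x0) < e"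
    using tendstoD[OF k e] unfolding eventually_at by auto
  define \<phi> where "\<phi> x = h x - k x0 \<bullet> x" for x
  define B where "B = D \<inter> ball x0 d"
  have lip: "norm (\<phi> x - \<phi> y) \<le> e * norm (x - y)" if "x \<in> B" "y \<in> B" for x y
  proof (rule differentiable_bound[of B \<phi> "\<lambda>z v. (k z - k x0) \<bullet> v"])
    show "convex B" unfolding B_def using D(2) convex_ball by (rule convex_Int)
    fix z assume z: "z \<in> B"
    have "(\<phi> has_derivative (\<lambda>v. k z \<bullet> v - k x0 \<bullet> v)) (at z)"
      unfolding \<phi>_def using z by (intro derivative_intros der) (simp add: B_def)
    then show "(\<phi> has_derivative (\<lambda>v. (k z - k x0) \<bullet> v)) (at z within B)"
      by (simp add: inner_diff_left has_derivative_at_withinI)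
    have "norm (k z - k x0) \<le> e"
      using d(2)[of z] z D(3) e by (cases "z = x0") (auto simp: B_def dist_norm norm_minus_commute)
    then show "onorm (\<lambda>v. (k z - k x0) \<bullet> v) \<le> e"
      using e by (intro onorm_bound)
        (auto intro: order_trans[OF Cauchy_Schwarz_ineq2 mult_right_mono])
  qed (use that in auto)
  have cl: "x \<in> closure B" if "x \<in> S" "dist x x0 < d" for x
  proof -
    have "x \<in> ball x0 d \<inter> closure D" using that D(4) by (auto simp: dist_commute)
    then have "x \<in> closure (ball x0 d \<inter> D)" using open_Int_closure_subset[OF open_ball] by blast
    then show ?thesis by (simp add: B_def Int_commute)
  qed
  have contp: "continuous_on S \<phi>" unfolding \<phi>_def by (intro continuous_intros cont)
  have BS: "B \<subseteq> S" using D(3) by (auto simp: B_def)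
  show "\<exists>d>0. \<forall>y\<in>S. norm (y - x0) < d \<longrightarrow> norm (h y - h x0 - k x0 \<bullet> (y - x0)) \<le> e * norm (y - x0)"
  proof (intro exI[of _ d] conjI ballI impI d(1))
    fix y assume y: "y \<in> S" "norm (y - x0) < d"
    have "y \<in> closure B" "x0 \<in> closure B" using cl[of y] cl[of x0] y x0 d(1) by (simp_all add: dist_norm)
    then obtain a b where a: "\<forall>n. a n \<in> B" "a \<longlonglongrightarrow> y" and b: "\<forall>n. b n \<in> B" "b \<longlonglongrightarrow> x0"
      unfolding closure_sequential by (elim exE conjE) (rule that)
    have pa: "(\<lambda>n. \<phi> (a n)) \<longlonglongrightarrow> \<phi> y"
      by (rule continuous_on_tendsto_compose[OF contp a(2) y(1)], rule always_eventually) (use a BS in blast)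
    have pb: "(\<lambda>n. \<phi> (b n)) \<longlonglongrightarrow> \<phi> x0"
      by (rule continuous_on_tendsto_compose[OF contp b(2) x0], rule always_eventually) (use b BS in blast)
    have "norm (\<phi> y - \<phi> x0) \<le> e * norm (y - x0)"
      by (rule LIMSEQ_le[OF tendsto_norm[OF tendsto_diff[OF pa pb]]
            tendsto_mult_left[OF tendsto_norm[OF tendsto_diff[OF a(2) b(2)]], of e]])
         (use lip a b in auto)
    then show "norm (h y - h x0 - k x0 \<bullet> (y - x0)) \<le> e * norm (y - x0)"
      by (simp add: \<phi>_def inner_diff_right algebra_simps)
  qed
qed

lemma one_sided_derivative_nonpos:
  fixes f :: "real \<Rightarrow> real"
  assumes "(f has_vector_derivative d) (at 0 within {0..})" "\<And>t. 0 \<le> t \<Longrightarrow> f t \<le> f 0"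
  shows "d \<le> 0"
proof (rule tendsto_upperbound)
  show "((\<lambda>t. (f t - f 0) / (t - 0)) \<longlongrightarrow> d) (at 0 within {0..})"
    using assms(1) unfolding has_real_derivative_iff_has_vector_derivative[symmetric] has_field_derivative_iff .
  show "\<forall>\<^sub>F t in at 0 within {0..}. (f t - f 0) / (t - 0) \<le> 0"
    unfolding eventually_at_filter using assms(2) by (auto simp: divide_nonpos_pos intro!: always_eventually divide_nonpos_nonneg)
  have "at (0::real) within {0<..} \<noteq> bot" by (rule trivial_limit_at_right_real)
  then show "at (0::real) within {0..} \<noteq> bot"
    using at_le[of "{0<..}" "{0..}" "0::real"] by (auto simp: bot_unique subset_iff)
qed

definition moment_map :: "complex ^ 'n \<Rightarrow> real ^ 'n" where
  "moment_map z = (\<chi> j. pi * (cmod (z $ j))\<^sup>2)"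

definition moment_section :: "real ^ 'n \<Rightarrow> complex ^ 'n" where
  "moment_section x = (\<chi> j. of_real (sqrt (x $ j / pi)))"

lemma toric_domain_iff: "z \<in> toric_domain \<Omega> \<longleftrightarrow> moment_map z \<in> \<Omega>"
  by (simp add: toric_domain_def moment_map_def)

lemma moment_map_orthant [simp]: "moment_map z \<in> orthant"
  by (simp add: moment_map_def orthant_def)

lemma moment_map_section: "x \<in> orthant \<Longrightarrow> moment_map (moment_section x) = x"
  by (simp add: moment_map_def moment_section_def orthant_def vec_eq_iff)

lemma moment_section_map: "moment_section (moment_map z) = moduli z"
  by (simp add: moment_map_def moment_section_def vec_eq_iff)

lemma moment_section_scale: "moment_section (t *\<^sub>R x) = sqrt t *\<^sub>R moment_section x"
  by (simp add: moment_section_def vec_eq_iff real_sqrt_mult scaleR_conv_of_real[where 'a=complex] flip: times_divide_eq_right)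

lemma moment_section_nonzero: "x \<in> orthant \<Longrightarrow> x \<noteq> 0 \<Longrightarrow> moment_section x \<noteq> 0"
  by (auto simp: moment_section_def vec_eq_iff)

lemma continuous_on_moment_section: "continuous_on S moment_section"
  unfolding moment_section_def by (intro continuous_intros) auto

lemma continuous_on_moment_map: "continuous_on S moment_map"
  unfolding moment_map_def by (intro continuous_intros)

definition positive_orthant :: "(real ^ 'n) set" where
  "positive_orthant = {x. \<forall>j. 0 < x $ j}"

lemma open_positive_orthant: "open (positive_orthant :: (real ^ 'n) set)"
proof -
  have eq: "positive_orthant = (\<Inter>j. {x::real^'n. 0 < x $ j})" by (auto simp: positive_orthant_def)
  have "open {x::real^'n. 0 < x $ j}" for j
    by (intro open_Collect_less continuous_intros)
  then show ?thesis unfolding eq by (intro open_INT) auto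
qed

lemma convex_positive_orthant: "convex positive_orthant"
  unfolding convex_alt
proof (intro ballI allI impI)
  fix x y :: "real ^ 'n" and u :: real
  assume xy: "x \<in> positive_orthant" "y \<in> positive_orthant" and u: "0 \<le> u \<and> u \<le> 1"
  have "0 < (1 - u) * x $ j + u * y $ j" for j
  proof (cases "u = 0")
    case False
    have "0 < x $ j" "0 < y $ j" using xy by (auto simp: positive_orthant_def)
    then have "0 \<le> (1 - u) * x $ j" "0 < u * y $ j" using u False by auto
    then show ?thesis by linarith
  qed (use xy in \<open>simp add: positive_orthant_def\<close>)
  then show "(1 - u) *\<^sub>R x + u *\<^sub>R y \<in> positive_orthant" by (simp add: positive_orthant_def)
qed

lemma positive_orthant_subset: "positive_orthant \<subseteq> orthant - {0}"
  by (auto simp: positive_orthant_def orthant_def less_imp_le)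

lemma orthant_shift_positive: "x \<in> orthant \<Longrightarrow> 0 < t \<Longrightarrow> x + t *\<^sub>R (\<chi> j. 1) \<in> positive_orthant"
  by (auto simp: positive_orthant_def orthant_def add_nonneg_pos)

lemma shift_tendsto: "(\<lambda>n. x + (1 / real (Suc n)) *\<^sub>R (\<chi> j. 1)) \<longlonglongrightarrow> (x :: real ^ 'n)"
proof -
  have "(\<lambda>n. 1 / real (Suc n)) \<longlonglongrightarrow> 0" using LIMSEQ_Suc[OF lim_1_over_n[where 'a=real]] by simp
  from tendsto_add[OF tendsto_const tendsto_scaleR[OF this tendsto_const]]
  have "(\<lambda>n. x + (1 / real (Suc n)) *\<^sub>R (\<chi> j. 1)) \<longlonglongrightarrow> x + 0 *\<^sub>R (\<chi> j. 1)" .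
  then show ?thesis by simp
qed

lemma orthant_subset_closure_positive: "(orthant :: (real ^ 'n) set) \<subseteq> closure positive_orthant"
proof
  fix x :: "real ^ 'n" assume x: "x \<in> orthant"
  show "x \<in> closure positive_orthant"
    unfolding closure_sequential
    using orthant_shift_positive[OF x] shift_tendsto[of x]
    by (intro exI[of _ "\<lambda>n. x + (1 / real (Suc n)) *\<^sub>R (\<chi> j. 1)"]) simp
qed

context toric_star_domain
begin

text \<open>The Minkowski functional of \<open>\<Omega>\<close>. The moment map is quadratic, so the square makes it homogeneous of degree 1.\<close>

definition height :: "real ^ 'n \<Rightarrow> real" where
  "height x = (minkowski (moment_section x))\<^sup>2"

text \<open>The angular speeds as a function on the orthant, homogeneous of degree 0.\<close>

definition speed_vector :: "real ^ 'n \<Rightarrow> real ^ 'n" where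
  "speed_vector x = (\<chi> j. angular_speed j (moment_section x /\<^sub>R minkowski (moment_section x)))"

lemma height_scale: "0 < t \<Longrightarrow> height (t *\<^sub>R x) = t * height x"
  by (simp add: height_def moment_section_scale minkowski_scale power_mult_distrib)

lemma height_le_1_iff: "x \<in> orthant \<Longrightarrow> height x \<le> 1 \<longleftrightarrow> x \<in> \<Omega>"
  using minkowski_nonneg[of "moment_section x"] minkowski_le_1_iff[of "moment_section x"]
  by (simp add: height_def power_le_one_iff toric_domain_iff moment_map_section)

lemma height_eq_1_iff: "height x = 1 \<longleftrightarrow> moment_section x \<in> F"
  using minkowski_nonneg[of "moment_section x"]
  by (auto simp: height_def frontier_iff_minkowski power2_eq_1_iff)

lemma height_moment_map: "height (moment_map z) = 1 \<longleftrightarrow> z \<in> F"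
  by (simp add: height_eq_1_iff moment_section_map)

lemma height_pos: "x \<in> orthant \<Longrightarrow> x \<noteq> 0 \<Longrightarrow> 0 < height x"
  using minkowski_pos[OF moment_section_nonzero, of x] by (simp add: height_def less_imp_neq[symmetric])

lemma height_eq_1_nonzero: "height x = 1 \<Longrightarrow> x \<noteq> 0"
proof
  assume "height x = 1" "x = 0"
  then have "moment_section x \<in> F" by (simp add: height_eq_1_iff)
  then show False using frontier_nonzero[of "moment_section x"] \<open>x = 0\<close> by (simp add: moment_section_def vec_eq_iff)
qed

lemma continuous_on_height: "continuous_on (orthant - {0}) height"
  unfolding height_def
  by (intro continuous_on_power continuous_on_compose2[OF continuous_on_minkowski] continuous_on_moment_section)
     (auto dest: moment_section_nonzero)

lemma speed_vector_eq: "height x = 1 \<Longrightarrow> speed_vector x $ j = angular_speed j (moment_section x)"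
  unfolding height_eq_1_iff by (simp add: frontier_iff_minkowski speed_vector_def)

lemma speed_vector_moment_map: "z \<in> F \<Longrightarrow> speed_vector (moment_map z) $ j = angular_speed j z"
  using angular_speed_cong[of z "moduli z" j]
  by (simp add: speed_vector_eq height_moment_map moment_section_map)

lemma speed_vector_inner_self:
  assumes "x \<in> orthant" "height x = 1"
  shows "speed_vector x \<bullet> x = 2 * pi"
proof -
  define z where "z = moment_section x"
  have z: "z \<in> F" "x = moment_map z" using assms by (simp_all add: z_def height_eq_1_iff moment_map_section)
  have "speed_vector x \<bullet> x = (\<Sum>j\<in>UNIV. pi * (angular_speed j z * (cmod (z $ j))\<^sup>2))"
    unfolding inner_vec_def z(2) speed_vector_moment_map[OF z(1)] by (simp add: moment_map_def algebra_simps)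
  also have "\<dots> = 2 * pi"
    using sum_angular_speed[OF z(1)] by (simp add: sum_distrib_left[symmetric])
  finally show ?thesis .
qed

lemma height_has_derivative_interior:
  assumes x: "x \<in> positive_orthant"
  shows "(height has_derivative (\<lambda>v. (speed_vector x /\<^sub>R (2 * pi)) \<bullet> v)) (at x)"
proof -
  define y where "y = moment_section x"
  define g where "g = minkowski y"
  have "y \<noteq> 0" unfolding y_def using moment_section_nonzero positive_orthant_subset x by blast
  then have g: "g > 0" unfolding g_def by (rule minkowski_pos)
  define z where "z = y /\<^sub>R g"
  have z: "z \<in> F" unfolding z_def g_def by (rule normalize_mem_frontier[OF \<open>y \<noteq> 0\<close>])
  define c where "c j = sqrt (x $ j / pi)" for j
  have c: "c j > 0" for j using x by (simp add: positive_orthant_def c_def)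
  have yc: "y $ j = of_real (c j)" for j by (simp add: y_def moment_section_def c_def)
  let ?S = "\<lambda>v::real^'n. \<chi> j. complex_of_real (v $ j / (2 * pi * c j))"
  have "(moment_section has_derivative ?S) (at x)"
    unfolding moment_section_def
  proof (intro has_derivative_vec_lambda has_derivative_of_real)
    fix j
    have nth: "((\<lambda>x. x $ j / pi) has_derivative (\<lambda>v. v $ j / pi)) (at x)"
      by (rule bounded_linear.has_derivative[OF bounded_linear_divide
            bounded_linear.has_derivative[OF bounded_linear_vec_nth has_derivative_ident]])
    have "DERIV sqrt (x $ j / pi) :> inverse (sqrt (x $ j / pi)) / 2"
      using x by (intro DERIV_real_sqrt) (simp add: positive_orthant_def)
    from has_derivative_compose[OF nth this[unfolded has_field_derivative_def]]
    have "((\<lambda>x. sqrt (x $ j / pi)) has_derivative (\<lambda>v. inverse (c j) / 2 * (v $ j / pi))) (at x)"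
      unfolding c_def .
    moreover have "inverse (c j) / 2 * (t / pi) = t / (2 * pi * c j)" for t
      using c[of j] by (simp add: field_simps)
    ultimately show "((\<lambda>x. sqrt (x $ j / pi)) has_derivative (\<lambda>v. v $ j / (2 * pi * c j))) (at x)"
      by (simp only:)
  qed
  from has_derivative_compose[OF this minkowski_has_derivative[OF \<open>y \<noteq> 0\<close>, unfolded y_def]]
  have d: "((\<lambda>x. minkowski (moment_section x)) has_derivative (\<lambda>v. conormal z \<bullet> ?S v)) (at x)"
    by (simp add: y_def z_def g_def)
  have "(height has_derivative (\<lambda>v. g * (conormal z \<bullet> ?S v) + (conormal z \<bullet> ?S v) * g)) (at x)"
    using has_derivative_mult[OF d d] by (simp add: height_def[abs_def] power2_eq_square g_def y_def)
  then have "(height has_derivative (\<lambda>v. g * (2 * (conormal z \<bullet> ?S v)))) (at x)"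
    by (rule has_derivative_eq_rhs) (simp add: fun_eq_iff)
  moreover have "g * (2 * (conormal z \<bullet> ?S v)) = (speed_vector x /\<^sub>R (2 * pi)) \<bullet> v" for v
  proof -
    have *: "angular_speed j z * Re (cnj (z $ j) * ?S v $ j) = (angular_speed j z / (2 * pi) * v $ j) / g" for j
      using c[of j] g by (simp add: z_def yc field_simps)
    have "2 * (conormal z \<bullet> ?S v) = (\<Sum>j\<in>UNIV. angular_speed j z / (2 * pi) * v $ j) / g"
      unfolding inner_conormal[OF z] * by (simp add: sum_divide_distrib)
    also have "\<dots> = (\<Sum>j\<in>UNIV. angular_speed j z * v $ j) / (2 * pi) / g"
      by (simp add: sum_divide_distrib)
    also have "(\<Sum>j\<in>UNIV. angular_speed j z * v $ j) = speed_vector x \<bullet> v"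
      by (simp add: inner_vec_def speed_vector_def z_def g_def y_def)
    finally show ?thesis using g by (simp add: field_simps)
  qed
  ultimately show ?thesis by (simp only:)
qed

lemma boundary_plus_iff: "x \<in> boundary_plus \<Omega> \<longleftrightarrow> x \<in> positive_orthant \<and> height x = 1"
proof (cases "x \<in> positive_orthant")
  case True
  have O: "y \<in> orthant" if "y \<in> positive_orthant" for y using that positive_orthant_subset by blast
  have cont: "continuous_on positive_orthant height"
    by (rule continuous_on_subset[OF continuous_on_height positive_orthant_subset])
  have lt: "open {y \<in> positive_orthant. height y < 1}" and gt: "open {y \<in> positive_orthant. height y > 1}"
  proof -
    have "open (height -` B \<inter> positive_orthant)" if "open B" for B
      using that cont continuous_on_open_vimage[OF open_positive_orthant, of height] by simp
    from this[of "{..<1}"] this[of "{1<..}"]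
    show "open {y \<in> positive_orthant. height y < 1}" "open {y \<in> positive_orthant. height y > 1}"
      by (simp_all add: vimage_def Int_def conj_commute)
  qed
  have "x \<in> frontier \<Omega> \<longleftrightarrow> height x = 1"
  proof
    assume f: "x \<in> frontier \<Omega>"
    have "\<not> height x < 1"
    proof
      assume "height x < 1"
      moreover have "{y \<in> positive_orthant. height y < 1} \<subseteq> \<Omega>" using O height_le_1_iff by fastforce
      ultimately have "x \<in> interior \<Omega>" using lt True by (intro interiorI) auto
      then show False using f by (simp add: frontier_def)
    qed
    moreover have "\<not> height x > 1"
    proof
      assume "height x > 1"
      moreover have "{y \<in> positive_orthant. height y > 1} \<subseteq> - \<Omega>" using O height_le_1_iff by fastforce
      ultimately have "x \<in> interior (- \<Omega>)" using gt True by (intro interiorI) auto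
      then show False using f by (simp add: frontier_def closure_interior)
    qed
    ultimately show "height x = 1" by linarith
  next
    assume h: "height x = 1"
    then have "x \<in> \<Omega>" using height_le_1_iff[OF O[OF True]] by simp
    moreover have "x \<notin> interior \<Omega>"
    proof
      assume "x \<in> interior \<Omega>"
      moreover have "((\<lambda>h. (1 + h) *\<^sub>R x) \<longlongrightarrow> (1 + 0) *\<^sub>R x) (at_right 0)"
        by (intro tendsto_intros)
      ultimately have "eventually (\<lambda>h. (1 + h) *\<^sub>R x \<in> interior \<Omega>) (at_right 0)"
        by (intro topological_tendstoD) auto
      moreover have "eventually (\<lambda>h::real. h > 0) (at_right 0)"
        by (rule eventually_at_right_less)
      ultimately have "eventually (\<lambda>h::real. False) (at_right 0)"
      proof eventually_elim
        case (elim k)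
        have "(1 + k) *\<^sub>R x \<in> orthant" using O[OF True] elim by (auto simp: orthant_def)
        then have "height ((1 + k) *\<^sub>R x) \<le> 1" using height_le_1_iff interior_subset elim by blast
        then show False using height_scale[of "1+k" x] elim h by simp
      qed
      then show False by simp
    qed
    ultimately show "x \<in> frontier \<Omega>" using closure_subset by (auto simp: frontier_def)
  qed
  then show ?thesis using True by (auto simp: boundary_plus_def positive_orthant_def)
qed (auto simp: boundary_plus_def positive_orthant_def)

lemma closure_boundary_plus: "closure (boundary_plus \<Omega>) = {x \<in> orthant. height x = 1}"
proof (intro equalityI subsetI)
  have "{x \<in> orthant. height x = 1} = moment_map ` F"
  proof (intro equalityI subsetI)
    fix x assume "x \<in> {x \<in> orthant. height x = 1}"
    then show "x \<in> moment_map ` F"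
      by (intro image_eqI[of _ _ "moment_section x"]) (simp_all add: moment_map_section height_eq_1_iff)
  qed (auto simp: height_moment_map)
  then have "closed {x \<in> orthant. height x = 1}"
    using compact_imp_closed[OF compact_continuous_image[OF continuous_on_moment_map compact_frontier[OF compact_X]]]
    by simp
  moreover have "boundary_plus \<Omega> \<subseteq> {x \<in> orthant. height x = 1}"
    using boundary_plus_iff positive_orthant_subset by blast
  ultimately have "closure (boundary_plus \<Omega>) \<subseteq> {x \<in> orthant. height x = 1}" by (intro closure_minimal)
  then show "x \<in> closure (boundary_plus \<Omega>) \<Longrightarrow> x \<in> {x \<in> orthant. height x = 1}" for x by blast
next
  fix x assume "x \<in> {x \<in> orthant. height x = 1}"
  then have x: "x \<in> orthant" "height x = 1" "x \<noteq> 0" using height_eq_1_nonzero by auto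
  define y where "y n = x + (1 / real (Suc n)) *\<^sub>R (\<chi> j. 1)" for n
  have y: "y n \<in> positive_orthant" for n unfolding y_def by (rule orthant_shift_positive[OF x(1)]) simp
  then have y': "y n \<in> orthant - {0}" for n using positive_orthant_subset by blast
  have lim: "y \<longlonglongrightarrow> x" unfolding y_def by (rule shift_tendsto)
  have "(\<lambda>n. height (y n)) \<longlonglongrightarrow> height x"
    by (rule continuous_on_tendsto_compose[OF continuous_on_height lim]) (use x y' in auto)
  then have "(\<lambda>n. y n /\<^sub>R height (y n)) \<longlonglongrightarrow> x /\<^sub>R height x"
    using x(2) by (intro tendsto_intros lim) auto
  moreover have "y n /\<^sub>R height (y n) \<in> boundary_plus \<Omega>" for n
    using y[of n] height_pos[of "y n"] y'[of n] height_scale[of "inverse (height (y n))" "y n"]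
    by (simp add: boundary_plus_iff positive_orthant_def)
  ultimately show "x \<in> closure (boundary_plus \<Omega>)"
    unfolding closure_sequential using x(2) by (intro exI[of _ "\<lambda>n. y n /\<^sub>R height (y n)"]) auto
qed

end

context toric_star_domain_4
begin

lemma continuous_on_speed_vector: "continuous_on (orthant - {0}) speed_vector"
proof -
  have g: "continuous_on (orthant - {0}) (\<lambda>x. minkowski (moment_section x))"
    by (intro continuous_on_compose2[OF continuous_on_minkowski] continuous_on_moment_section)
       (auto dest: moment_section_nonzero)
  have "continuous_on (orthant - {0}) (\<lambda>x. moment_section x /\<^sub>R minkowski (moment_section x))"
    by (intro continuous_intros g continuous_on_moment_section)
       (use minkowski_pos[OF moment_section_nonzero] in force)
  then have "continuous_on (orthant - {0}) (\<lambda>x. angular_speed j (moment_section x /\<^sub>R minkowski (moment_section x)))" for j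
    by (rule continuous_on_compose2[OF continuous_on_angular_speed])
       (auto intro!: normalize_mem_frontier simp: moment_section_nonzero)
  then show ?thesis unfolding speed_vector_def by (intro continuous_on_vec_lambda)
qed

lemma height_has_derivative:
  assumes x: "x \<in> orthant" "height x = 1"
  shows "(height has_derivative (\<lambda>v. (speed_vector x /\<^sub>R (2 * pi)) \<bullet> v)) (at x within orthant)"
proof -
  have "x \<noteq> 0" using height_eq_1_nonzero x by blast
  have "(height has_derivative (\<lambda>v. (speed_vector x /\<^sub>R (2 * pi)) \<bullet> v)) (at x within orthant - {0})"
  proof (rule derivative_extends_to_boundary[OF open_positive_orthant convex_positive_orthant positive_orthant_subset])
    show "orthant - {0} \<subseteq> closure (positive_orthant :: (real ^ 2) set)"
      using orthant_subset_closure_positive by blast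
    show "x \<in> orthant - {0}" using x \<open>x \<noteq> 0\<close> by blast
    then have "(speed_vector \<longlongrightarrow> speed_vector x) (at x within orthant - {0})"
      using continuous_on_speed_vector unfolding continuous_on_def by blast
    then show "((\<lambda>y. speed_vector y /\<^sub>R (2 * pi)) \<longlongrightarrow> speed_vector x /\<^sub>R (2 * pi)) (at x within orthant - {0})"
      by (intro tendsto_scaleR tendsto_const)
  qed (rule continuous_on_height height_has_derivative_interior; assumption)+
  moreover have "at x within orthant - {0} = at x within orthant"
    by (rule at_within_nhd[of _ "- {0}"]) (use \<open>x \<noteq> 0\<close> in auto)
  ultimately show ?thesis by simp
qed

lemma speed_vector_outward_normal:
  assumes O: "\<Omega> \<subseteq> orthant" and x: "x \<in> closure (boundary_plus \<Omega>)"
  shows "outward_normal \<Omega> x (speed_vector x)"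
  unfolding outward_normal_def
proof (intro conjI ballI)
  have x': "x \<in> orthant" "height x = 1" using x closure_boundary_plus by auto
  have "speed_vector x \<bullet> x \<noteq> 0" using speed_vector_inner_self[OF x'] by simp
  then show "speed_vector x \<noteq> 0" by auto
  have along: "((\<lambda>t. height (c t)) has_vector_derivative (speed_vector x /\<^sub>R (2 * pi)) \<bullet> w) (at 0 within {0..})"
    if "c 0 = x" "\<And>t. 0 \<le> t \<Longrightarrow> c t \<in> orthant" "(c has_vector_derivative w) (at 0 within {0..})" for c w
    using has_vector_derivative_along_curve[OF height_has_derivative[OF x'], of c w] that by blast
  fix w
  {
    assume "w \<in> tangent_cone (closure (boundary_plus \<Omega>)) x"
    then obtain c where c: "c 0 = x" "\<And>t. 0 \<le> t \<Longrightarrow> c t \<in> closure (boundary_plus \<Omega>)"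
      "(c has_vector_derivative w) (at 0 within {0..})"
      unfolding tangent_cone_def by auto
    then have c': "\<And>t. 0 \<le> t \<Longrightarrow> c t \<in> orthant" "\<And>t. 0 \<le> t \<Longrightarrow> height (c t) = 1"
      using closure_boundary_plus by auto
    have "((\<lambda>t. 1) has_vector_derivative (speed_vector x /\<^sub>R (2 * pi)) \<bullet> w) (at (0::real) within {0..})"
      by (rule has_vector_derivative_transform[OF _ _ along[OF c(1) c'(1) c(3)]]) (use c' in auto)
    then have "(speed_vector x /\<^sub>R (2 * pi)) \<bullet> w = 0"
      using vector_derivative_unique_at_0 has_vector_derivative_const by blast
    then show "speed_vector x \<bullet> w = 0" by simp
  }
  assume "w \<in> tangent_cone \<Omega> x"
  then obtain c where c: "c 0 = x" "\<And>t. 0 \<le> t \<Longrightarrow> c t \<in> \<Omega>"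
    "(c has_vector_derivative w) (at 0 within {0..})"
    unfolding tangent_cone_def by auto
  then have "\<And>t. 0 \<le> t \<Longrightarrow> c t \<in> orthant" "\<And>t. 0 \<le> t \<Longrightarrow> height (c t) \<le> 1"
    using O height_le_1_iff by blast+
  then have "(speed_vector x /\<^sub>R (2 * pi)) \<bullet> w \<le> 0"
    using c x' by (intro one_sided_derivative_nonpos[OF along]) auto
  then have "2 * pi * ((speed_vector x /\<^sub>R (2 * pi)) \<bullet> w) \<le> 0"
    by (intro mult_nonneg_nonpos) auto
  then show "speed_vector x \<bullet> w \<le> 0" by (simp add: mult.assoc[symmetric])
qed

text \<open>On an axis only one of the two directions orthogonal to \<open>speed_vector x\<close> points into the orthant, and such a direction exists
  because both speeds are positive. Projecting the ray from \<open>x\<close> in this direction radially gives a curve in the boundary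
  with the same velocity. So \<open>v\<close> is orthogonal to this direction, which in the plane determines it up to a factor. The radial curve
  from \<open>x\<close> towards the origin stays in \<open>\<Omega>\<close> and determines the sign of the factor.\<close>

lemma outward_normal_direction:
  assumes O: "\<Omega> \<subseteq> orthant" and x: "x \<in> closure (boundary_plus \<Omega>)"
    and pos: "\<And>j. 0 < speed_vector x $ j" and v: "outward_normal \<Omega> x v"
  shows "\<exists>c>0. v = c *\<^sub>R speed_vector x"
proof -
  define s where "s = speed_vector x"
  have x': "x \<in> orthant" "height x = 1" using x closure_boundary_plus by auto
  have "x \<noteq> 0" using height_eq_1_nonzero x' by blast
  have xnn: "0 \<le> x $ j" for j using x' by (simp add: orthant_def)
  have sp: "s $ 1 > 0" "s $ 2 > 0" using pos by (auto simp: s_def)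
  have "\<exists>w. (w = vector [- s$2, s$1] \<or> w = vector [s$2, - s$1]) \<and>
      (\<exists>\<delta>>0. \<forall>t. 0 \<le> t \<and> t < \<delta> \<longrightarrow> x + t *\<^sub>R w \<in> orthant)"
  proof (cases "x $ 1 = 0")
    case True
    then have "x $ 2 > 0" using xnn[of 2] \<open>x \<noteq> 0\<close> by (auto simp: vec_eq_iff forall_2 less_le)
    then have "\<forall>t. 0 \<le> t \<and> t < x $ 2 / s $ 1 \<longrightarrow> x + t *\<^sub>R vector [s$2, - s$1] \<in> orthant"
      using True sp by (auto simp: orthant_def forall_2 field_simps)
    then show ?thesis using \<open>x $ 2 > 0\<close> sp divide_pos_pos by blast
  next
    case False
    then have "x $ 1 > 0" using xnn[of 1] by (simp add: less_le)
    then have "\<forall>t. 0 \<le> t \<and> t < x $ 1 / s $ 2 \<longrightarrow> x + t *\<^sub>R vector [- s$2, s$1] \<in> orthant"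
      using xnn[of 2] sp by (auto simp: orthant_def forall_2 field_simps)
    then show ?thesis using \<open>x $ 1 > 0\<close> sp divide_pos_pos by blast
  qed
  then obtain w \<delta> where w: "w = vector [- s$2, s$1] \<or> w = vector [s$2, - s$1]"
     and \<delta>: "\<delta> > 0" "\<And>t. 0 \<le> t \<Longrightarrow> t < \<delta> \<Longrightarrow> x + t *\<^sub>R w \<in> orthant" by blast
  have sw: "s \<bullet> w = 0" using w by (auto simp: inner_vec_def sum_2)
  have "eventually (\<lambda>t. x + t *\<^sub>R w \<noteq> 0) (at 0 within {0..})"
  proof -
    have "((\<lambda>t. x + t *\<^sub>R w) \<longlongrightarrow> x + 0 *\<^sub>R w) (at 0 within {0..})" by (intro tendsto_intros)
    then show ?thesis using \<open>x \<noteq> 0\<close> by (intro tendsto_imp_eventually_ne[of _ x]) auto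
  qed
  then obtain d where d: "d > 0" "\<forall>t\<in>{0..}. t \<noteq> 0 \<and> dist t 0 < d \<longrightarrow> x + t *\<^sub>R w \<noteq> 0"
    unfolding eventually_at by blast
  have d2: "x + t *\<^sub>R w \<noteq> 0" if "0 \<le> t" "t < d" for t
    using d(2) that \<open>x \<noteq> 0\<close> by (cases "t = 0") auto
  define c where "c t = (if t < min \<delta> d then x + t *\<^sub>R w else x)" for t
  have c: "c t \<in> orthant - {0}" if "0 \<le> t" for t
    using that \<delta>(2)[of t] d2[of t] x'(1) \<open>x \<noteq> 0\<close> by (auto simp: c_def)
  have c0: "c 0 = x" by (simp add: c_def)
  have cd: "(c has_vector_derivative w) (at 0 within {0..})"
  proof (rule has_vector_derivative_transform_within[of "\<lambda>t. x + t *\<^sub>R w"])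
    show "((\<lambda>t. x + t *\<^sub>R w) has_vector_derivative w) (at 0 within {0..})"
      by (auto intro!: derivative_eq_intros)
    show "0 < min \<delta> d" using \<delta>(1) d(1) by simp
  qed (auto simp: c_def dist_real_def)
  have hd: "((\<lambda>t. height (c t)) has_vector_derivative 0) (at 0 within {0..})"
    using has_vector_derivative_along_curve[OF height_has_derivative[OF x'] c0 _ cd] c sw by (auto simp: s_def)
  then have "((\<lambda>t. inverse (height (c t))) has_real_derivative 0) (at 0 within {0..})"
    unfolding has_real_derivative_iff_has_vector_derivative[symmetric]
    using DERIV_inverse_fun[of "\<lambda>t. height (c t)" 0 0 "{0..}"] c0 x'(2) by simp
  then have "((\<lambda>t. inverse (height (c t)) *\<^sub>R c t) has_vector_derivative
      (inverse (height (c 0)) *\<^sub>R w + 0 *\<^sub>R c 0)) (at 0 within {0..})"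
    using cd by (rule has_vector_derivative_scaleR)
  then have "((\<lambda>t. c t /\<^sub>R height (c t)) has_vector_derivative w) (at 0 within {0..})"
    using c0 x'(2) by simp
  moreover have "c t /\<^sub>R height (c t) \<in> closure (boundary_plus \<Omega>)" if "0 \<le> t" for t
  proof -
    have "height (c t) > 0" using height_pos c[OF that] by blast
    then show ?thesis
      using c[OF that] height_scale[of "inverse (height (c t))" "c t"]
      unfolding closure_boundary_plus by (auto simp: orthant_def)
  qed
  ultimately have "w \<in> tangent_cone (closure (boundary_plus \<Omega>)) x"
    unfolding tangent_cone_def
    by (intro CollectI exI[of _ "\<lambda>t. c t /\<^sub>R height (c t)"]) (use c0 x'(2) in auto)
  then have "v \<bullet> w = 0" using v unfolding outward_normal_def by blast
  then have v12: "v $ 1 * s $ 2 = v $ 2 * s $ 1"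
    using w by (auto simp: inner_vec_def sum_2)
  define k where "k = v $ 1 / s $ 1"
  have vk: "v = k *\<^sub>R s"
    unfolding vec_eq_iff forall_2 using v12 sp by (simp add: k_def field_simps)
  \<comment> \<open>The curve has to stay in \<open>\<Omega>\<close> for all times, so it stops at the origin.\<close>
  have "- x \<in> tangent_cone \<Omega> x"
    unfolding tangent_cone_def
  proof (intro CollectI exI[of _ "\<lambda>t. (1 - min t 1) *\<^sub>R x"] conjI allI impI)
    fix t :: real assume t: "0 \<le> t"
    show "(1 - min t 1) *\<^sub>R x \<in> \<Omega>"
    proof -
      have "moment_section x \<in> X"
        using x' height_eq_1_iff frontier_subset by blast
      then have "sqrt (1 - min t 1) *\<^sub>R moment_section x \<in> X" using t by (intro scale_mem) auto
      then have "moment_map (moment_section ((1 - min t 1) *\<^sub>R x)) \<in> \<Omega>"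
        by (simp add: toric_domain_iff moment_section_scale)
      moreover have "(1 - min t 1) *\<^sub>R x \<in> orthant" using x'(1) by (simp add: orthant_def)
      ultimately show ?thesis by (simp add: moment_map_section)
    qed
  next
    have "((\<lambda>t. x - t *\<^sub>R x) has_vector_derivative - x) (at 0 within {0..})"
      by (auto intro!: derivative_eq_intros)
    then show "((\<lambda>t. (1 - min t 1) *\<^sub>R x) has_vector_derivative - x) (at 0 within {0..})"
      by (rule has_vector_derivative_transform_within[of _ _ _ _ 1]) (auto simp: dist_real_def algebra_simps)
  qed simp
  then have "v \<bullet> (- x) \<le> 0" using v unfolding outward_normal_def by blast
  then have "0 \<le> k * (2 * pi)" using speed_vector_inner_self[OF x'] by (simp add: vk s_def)
  then have "0 \<le> k" using pi_gt_zero by (simp add: zero_le_mult_iff not_le[symmetric] del: not_le)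
  moreover have "k \<noteq> 0" using v vk unfolding outward_normal_def by auto
  ultimately show ?thesis using vk s_def by (intro exI[of _ k]) simp
qed

end

lemma orthant_domain_subset: "orthant_domain \<Omega> \<Longrightarrow> (\<Omega> :: (real ^ 'a) set) \<subseteq> orthant"
proof -
  assume "orthant_domain \<Omega>"
  then obtain U where U: "openin (top_of_set orthant) U" "\<Omega> = closure U" unfolding orthant_domain_def by auto
  have eq: "orthant = (\<Inter>j. {x::real^'a. 0 \<le> x $ j})" by (auto simp: orthant_def)
  have "closed {x::real^'a. 0 \<le> x $ j}" for j by (intro closed_Collect_le continuous_intros)
  then have "closed (orthant :: (real^'a) set)" unfolding eq by (intro closed_INT) auto
  moreover have "U \<subseteq> orthant" using U(1) openin_imp_subset by blast
  ultimately show ?thesis unfolding U(2) by (intro closure_minimal)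
qed

text \<open>The set \<open>\<Omega>\<close> is determined by its toric domain, because the moment map is onto the orthant.\<close>

lemma (in toric_star_domain_4) strictly_monotone_iff:
  assumes "orthant_domain \<Omega>"
  shows "strictly_monotone_toric_domain X \<longleftrightarrow> (\<forall>z\<in>F. \<forall>j. 0 < angular_speed j z)"
proof
  have O: "\<Omega> \<subseteq> orthant" by (rule orthant_domain_subset[OF assms])
  {
    assume "strictly_monotone_toric_domain X"
    then obtain \<Omega>' where \<Omega>': "orthant_domain \<Omega>'" "X = toric_domain \<Omega>'"
      and n: "\<And>\<mu> v. \<mu> \<in> closure (boundary_plus \<Omega>') \<Longrightarrow> outward_normal \<Omega>' \<mu> v \<Longrightarrow> \<forall>j. 0 < v $ j"
      unfolding strictly_monotone_toric_domain_def by blast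
    have "x \<in> \<Omega>' \<longleftrightarrow> x \<in> \<Omega>" for x
    proof (cases "x \<in> orthant")
      case True
      have "moment_section x \<in> toric_domain \<Omega>' \<longleftrightarrow> moment_section x \<in> X" using \<Omega>'(2) by simp
      then show ?thesis using True by (simp add: toric_domain_iff moment_map_section)
    next
      case False
      then show ?thesis using O orthant_domain_subset[OF \<Omega>'(1)] by blast
    qed
    then have "\<Omega>' = \<Omega>" by blast
    show "\<forall>z\<in>F. \<forall>j. 0 < angular_speed j z"
    proof (intro ballI allI)
      fix z j assume z: "z \<in> F"
      have "moment_map z \<in> closure (boundary_plus \<Omega>)"
        unfolding closure_boundary_plus using z by (simp add: height_moment_map)
      then have "0 < speed_vector (moment_map z) $ j"
        using n[of "moment_map z" "speed_vector (moment_map z)"] speed_vector_outward_normal[OF O]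
        unfolding \<open>\<Omega>' = \<Omega>\<close> by blast
      then show "0 < angular_speed j z" using speed_vector_moment_map[OF z] by simp
    qed
  next
    assume pos: "\<forall>z\<in>F. \<forall>j. 0 < angular_speed j z"
    have "0 < v $ j" if x: "x \<in> closure (boundary_plus \<Omega>)" and v: "outward_normal \<Omega> x v" for x v j
    proof -
      have "height x = 1" using x closure_boundary_plus by auto
      then have sp: "0 < speed_vector x $ k" for k
        using pos by (simp add: speed_vector_eq height_eq_1_iff)
      obtain c where "c > 0" "v = c *\<^sub>R speed_vector x"
        using outward_normal_direction[OF O x sp v] by blast
      then show ?thesis using sp by simp
    qed
    then show "strictly_monotone_toric_domain X"
      unfolding strictly_monotone_toric_domain_def
      using compact_X smooth_boundary_X assms by blast
  }
qed


section \<open>The Reeb flow and its linearization\<close>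

text \<open>At a zero of \<open>h\<close> the product rule only asks the other factor to be continuous. This is applied to the rotation of
  \<open>z\<^sub>j\<close> at points where \<open>z\<^sub>j = 0\<close>.\<close>

lemma has_derivative_mult_vanishing:
  fixes f h :: "'a::real_normed_vector \<Rightarrow> 'b::real_normed_algebra"
  assumes f: "(f \<longlongrightarrow> f z) (at z within S)" and h: "(h has_derivative h') (at z within S)" "h z = 0"
  shows "((\<lambda>x. f x * h x) has_derivative (\<lambda>v. f z * h' v)) (at z within S)"
proof -
  have lin: "bounded_linear h'" using h(1) by (rule has_derivative_bounded_linear)
  obtain B where B: "\<And>v. norm (h' v) \<le> norm v * B" using bounded_linear.bounded[OF lin] by blast
  have "((\<lambda>y. norm (f y) * norm ((h y - h z - h' (y - z)) /\<^sub>R norm (y - z)) + norm (f y - f z) * \<bar>B\<bar>) \<longlongrightarrow>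
      norm (f z) * norm (0::'b) + norm (f z - f z) * \<bar>B\<bar>) (at z within S)"
    using h(1) unfolding has_derivative_at_within by (intro tendsto_intros f) auto
  then have lim: "((\<lambda>y. norm (f y) * norm ((h y - h z - h' (y - z)) /\<^sub>R norm (y - z)) + norm (f y - f z) * \<bar>B\<bar>) \<longlongrightarrow> 0) (at z within S)"
    by simp
  have "((\<lambda>y. (f y * h y - f z * h z - f z * h' (y - z)) /\<^sub>R norm (y - z)) \<longlongrightarrow> 0) (at z within S)"
  proof (rule Lim_null_comparison[OF _ lim], rule always_eventually, rule allI)
    fix y
    have "f y * h y - f z * h z - f z * h' (y - z) = f y * (h y - h z - h' (y - z)) + (f y - f z) * h' (y - z)"
      using h(2) by (simp add: algebra_simps)
    then have "norm (f y * h y - f z * h z - f z * h' (y - z))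
        \<le> norm (f y * (h y - h z - h' (y - z))) + norm ((f y - f z) * h' (y - z))"
      by (simp only: norm_triangle_ineq)
    also have "\<dots> \<le> norm (f y) * norm (h y - h z - h' (y - z)) + norm (f y - f z) * norm (h' (y - z))"
      by (intro add_mono norm_mult_ineq)
    also have "norm (f y - f z) * norm (h' (y - z)) \<le> norm (f y - f z) * (norm (y - z) * \<bar>B\<bar>)"
      by (intro mult_left_mono order_trans[OF B] abs_ge_self) auto
    finally have le: "norm (f y * h y - f z * h z - f z * h' (y - z))
      \<le> norm (f y) * norm (h y - h z - h' (y - z)) + norm (f y - f z) * (norm (y - z) * \<bar>B\<bar>)" by simp
    show "norm ((f y * h y - f z * h z - f z * h' (y - z)) /\<^sub>R norm (y - z))
      \<le> norm (f y) * norm ((h y - h z - h' (y - z)) /\<^sub>R norm (y - z)) + norm (f y - f z) * \<bar>B\<bar>"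
    proof (cases "y = z")
      case False
      define r where "r = norm (y - z)"
      have r: "r > 0" using False by (simp add: r_def)
      define a where "a = norm (f y * h y - f z * h z - f z * h' (y - z))"
      define b where "b = norm (h y - h z - h' (y - z))"
      have "a \<le> norm (f y) * b + norm (f y - f z) * (r * \<bar>B\<bar>)" using le by (simp only: a_def b_def r_def)
      then have "a / r \<le> norm (f y) * (b / r) + norm (f y - f z) * \<bar>B\<bar>"
        using r by (simp add: field_simps)
      then show ?thesis using r by (simp only: norm_scaleR flip: a_def b_def r_def) (simp add: divide_inverse mult_ac)
    qed simp
  qed
  moreover have "bounded_linear (\<lambda>v. f z * h' v)"
    using bounded_linear_mult_right lin by (rule bounded_linear_compose)
  ultimately show ?thesis unfolding has_derivative_at_within by blast
qed

lemma zero_vector_derivative_constant: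
  fixes f :: "real \<Rightarrow> 'a::real_normed_vector"
  assumes "\<And>t. (f has_vector_derivative 0) (at t)"
  shows "f s = f t"
  using has_derivative_zero_unique[OF convex_UNIV, of f s t] assms by (simp add: has_vector_derivative_def)

context toric_star_domain
begin

definition speeds :: "complex ^ 'n \<Rightarrow> real ^ 'n" where
  "speeds z = (\<chi> j. angular_speed j z)"

lemma reeb_trajectory_rot:
  assumes z: "z \<in> F"
  shows "reeb_trajectory X (\<lambda>t. rot (t *\<^sub>R speeds z) z)"
  unfolding reeb_trajectory_def
proof (intro allI conjI)
  fix t
  show "rot (t *\<^sub>R speeds z) z \<in> F" using z by simp
  have "((\<lambda>t. rot (t *\<^sub>R speeds z) z) has_derivative
      (\<lambda>h. \<chi> j. h *\<^sub>R (\<i> * of_real (angular_speed j z) * (cis (t * angular_speed j z) * z $ j)))) (at t)"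
    unfolding rot_def
  proof (rule has_derivative_vec_lambda)
    fix j
    show "((\<lambda>t. cis ((t *\<^sub>R speeds z) $ j) * z $ j) has_derivative
        (\<lambda>h. h *\<^sub>R (\<i> * of_real (angular_speed j z) * (cis (t * angular_speed j z) * z $ j)))) (at t)"
      using has_vector_derivative_cis[of "angular_speed j z" "z $ j" t UNIV]
      by (simp add: speeds_def has_vector_derivative_def)
  qed
  moreover have "(\<lambda>h. \<chi> j. h *\<^sub>R (\<i> * of_real (angular_speed j z) * (cis (t * angular_speed j z) * z $ j)))
      = (\<lambda>h. h *\<^sub>R reeb_vector X (rot (t *\<^sub>R speeds z) z))"
    using z by (simp add: fun_eq_iff vec_eq_iff reeb_vector_component speeds_def)
  ultimately show "((\<lambda>t. rot (t *\<^sub>R speeds z) z) has_vector_derivative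
      reeb_vector X (rot (t *\<^sub>R speeds z) z)) (at t)"
    by (simp add: has_vector_derivative_def)
qed

text \<open>The field is tangent to the torus orbits, so the moduli and with them the angular speeds are constant along a trajectory.
  Each coordinate then solves a linear equation with constant coefficient.\<close>

lemma reeb_trajectory_unique:
  assumes c: "reeb_trajectory X c"
  shows "c t = rot (t *\<^sub>R speeds (c 0)) (c 0)"
proof -
  have cF: "c t \<in> F" for t using c unfolding reeb_trajectory_def by blast
  have der: "((\<lambda>t. c t $ j) has_vector_derivative \<i> * of_real (angular_speed j (c t)) * c t $ j) (at t)" for j t
  proof -
    have "(c has_vector_derivative reeb_vector X (c t)) (at t)" using c unfolding reeb_trajectory_def by blast
    from bounded_linear.has_vector_derivative[OF bounded_linear_vec_nth this, of j]
    show ?thesis using reeb_vector_component[OF cF] by simp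
  qed
  have "cmod (c t $ j) = cmod (c 0 $ j)" for j t
  proof -
    have "((\<lambda>t. c t $ j \<bullet> c t $ j) has_vector_derivative 0) (at t)" for t
    proof -
      have "x \<bullet> (\<i> * of_real a * x) = 0" for x a by (simp add: inner_complex_def algebra_simps)
      then show ?thesis
        using bounded_bilinear.has_vector_derivative[OF bounded_bilinear_inner der[of j t] der[of j t]]
        by (simp add: inner_commute)
    qed
    from zero_vector_derivative_constant[OF this, of t 0]
    show ?thesis by (simp only: norm_eq_sqrt_inner)
  qed
  then have "moduli (c t) = moduli (c 0)" for t by (simp add: moduli_eq_iff)
  then have a: "angular_speed j (c t) = angular_speed j (c 0)" for j t
    by (intro angular_speed_cong cF)
  have "c t $ j = cis (t * angular_speed j (c 0)) * c 0 $ j" for j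
  proof -
    let ?a = "angular_speed j (c 0)"
    have "((\<lambda>t. cis (t * (- ?a)) * 1 * c t $ j) has_vector_derivative 0) (at t)" for t
    proof (rule has_vector_derivative_eq_rhs)
      show "((\<lambda>t. cis (t * (- ?a)) * 1 * c t $ j) has_vector_derivative
          cis (t * (- ?a)) * 1 * (\<i> * of_real (angular_speed j (c t)) * c t $ j) +
          \<i> * of_real (- ?a) * (cis (t * (- ?a)) * 1) * c t $ j) (at t)"
        by (rule has_vector_derivative_mult[OF has_vector_derivative_cis der])
    qed (simp only: a[of j t] of_real_minus, simp)
    note const = zero_vector_derivative_constant[OF this, of t 0]
    have "c t $ j = cis (t * ?a) * (cis (t * (- ?a)) * 1 * c t $ j)"
      by (simp add: mult.assoc[symmetric] cis_mult)
    also note const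
    finally show ?thesis by simp
  qed
  then show ?thesis by (simp add: vec_eq_iff speeds_def)
qed

lemma reeb_flow_eq:
  assumes z: "z \<in> F"
  shows "reeb_flow X t z = rot (t *\<^sub>R speeds z) z"
  unfolding reeb_flow_def
proof (rule the_equality)
  show "\<exists>c. reeb_trajectory X c \<and> c 0 = z \<and> c t = rot (t *\<^sub>R speeds z) z"
    using reeb_trajectory_rot[OF z]
    by (intro exI[of _ "\<lambda>t. rot (t *\<^sub>R speeds z) z"]) (simp add: vec_eq_iff)
  fix w assume "\<exists>c. reeb_trajectory X c \<and> c 0 = z \<and> c t = w"
  then obtain c where "reeb_trajectory X c" "c 0 = z" "c t = w" by blast
  then show "w = rot (t *\<^sub>R speeds z) z" using reeb_trajectory_unique[of c t] by simp
qed

text \<open>The derivative of the \<open>j\<close>-th angular speed along \<open>v\<close>, which produces the shear in the linearized flow. It only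
  occurs multiplied by \<open>z\<^sub>j\<close>, so the value 0 is harmless where \<open>z\<^sub>j = 0\<close>.\<close>

definition twist :: "'n \<Rightarrow> complex ^ 'n \<Rightarrow> complex ^ 'n \<Rightarrow> real" where
  "twist j z v = (if z $ j = 0 then 0 else frechet_derivative (angular_speed j) (at z within F) v)"

lemma twist_torus_direction:
  assumes z: "z \<in> F"
  shows "twist j z (\<chi> k. \<i> * of_real (a $ k) * z $ k) = 0"
proof (cases "z $ j = 0")
  case False
  have d: "(angular_speed j has_derivative frechet_derivative (angular_speed j) (at z within F)) (at z within F)"
    unfolding frechet_derivative_works[symmetric] by (rule angular_speed_differentiable[OF z False])
  have c: "((\<lambda>t. rot (t *\<^sub>R a) z) has_vector_derivative (\<chi> k. \<i> * of_real (a $ k) * z $ k)) (at 0 within {0..})"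
    by (rule torus_curve_derivative)
  have "((\<lambda>t. angular_speed j (rot (t *\<^sub>R a) z)) has_vector_derivative
     frechet_derivative (angular_speed j) (at z within F) (\<chi> k. \<i> * of_real (a $ k) * z $ k)) (at 0 within {0..})"
    by (rule has_vector_derivative_along_curve[OF d _ _ c]) (use z in \<open>auto simp: vec_eq_iff\<close>)
  then have "((\<lambda>t. angular_speed j z) has_vector_derivative
     frechet_derivative (angular_speed j) (at z within F) (\<chi> k. \<i> * of_real (a $ k) * z $ k)) (at 0 within {0..})"
    using z by simp
  from vector_derivative_unique_at_0[OF this has_vector_derivative_const]
  show ?thesis using False by (simp add: twist_def)
qed (simp add: twist_def)

end

context toric_star_domain_4
begin

lemma reeb_flow_has_derivative:
  assumes z: "z \<in> F"
  shows "(reeb_flow X t has_derivative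
     (\<lambda>v. \<chi> j. cis (t * angular_speed j z) * (v $ j + \<i> * of_real (t * twist j z v) * z $ j))) (at z within F)"
proof (rule has_derivative_transform[OF z])
  show "x \<in> F \<Longrightarrow> reeb_flow X t x = (\<chi> j. cis (t * angular_speed j x) * x $ j)" for x
    by (simp add: reeb_flow_eq rot_def speeds_def)
  show "((\<lambda>x. \<chi> j. cis (t * angular_speed j x) * x $ j) has_derivative
     (\<lambda>v. \<chi> j. cis (t * angular_speed j z) * (v $ j + \<i> * of_real (t * twist j z v) * z $ j))) (at z within F)"
  proof (rule has_derivative_vec_lambda)
    fix j
    have n: "((\<lambda>x::complex^2. x $ j) has_derivative (\<lambda>v. v $ j)) (at z within F)"
      by (rule bounded_linear.has_derivative[OF bounded_linear_vec_nth has_derivative_ident])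
    show "((\<lambda>x. cis (t * angular_speed j x) * x $ j) has_derivative
      (\<lambda>v. cis (t * angular_speed j z) * (v $ j + \<i> * of_real (t * twist j z v) * z $ j))) (at z within F)"
    proof (cases "z $ j = 0")
      case True
      have a: "(angular_speed j \<longlongrightarrow> angular_speed j z) (at z within F)"
        using continuous_on_angular_speed z unfolding continuous_on_def by blast
      have "isCont cis (t * angular_speed j z)"
        using continuous_on_cis[OF continuous_on_id, of UNIV] by (simp add: continuous_on_eq_continuous_at)
      then have "((\<lambda>x. cis (t * angular_speed j x)) \<longlongrightarrow> cis (t * angular_speed j z)) (at z within F)"
        by (rule isCont_tendsto_compose) (intro tendsto_intros a)
      from has_derivative_mult_vanishing[OF this n True] show ?thesis using True by simp
    next
      case False
      have "(angular_speed j has_derivative twist j z) (at z within F)"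
        using angular_speed_differentiable[OF z False, unfolded frechet_derivative_works] False
        by (simp add: twist_def[abs_def])
      then have "((\<lambda>x. t * angular_speed j x) has_derivative (\<lambda>v. t * twist j z v)) (at z within F)"
        by (rule has_derivative_mult_right)
      from has_derivative_mult[OF has_derivative_cis[OF this] n]
      show ?thesis
        by (rule has_derivative_eq_rhs) (simp add: fun_eq_iff scaleR_conv_of_real algebra_simps)
    qed
  qed
qed

lemma linearized_reeb_flow_eq:
  assumes z: "z \<in> F" and v: "v \<in> tangent_cone F z"
  shows "linearized_reeb_flow X t z v $ j =
    cis (t * angular_speed j z) * (v $ j + \<i> * of_real (t * twist j z v) * z $ j)"
proof -
  have "reeb_flow X t differentiable (at z within F)"
    using reeb_flow_has_derivative[OF z] by (rule differentiableI)
  then have "(reeb_flow X t has_derivative linearized_reeb_flow X t z) (at z within F)"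
    unfolding linearized_reeb_flow_def frechet_derivative_works .
  from derivative_within_unique_on_tangent_cone[OF this reeb_flow_has_derivative[OF z] v]
  show ?thesis by simp
qed

lemma linearized_reeb_flow_tangent:
  assumes z: "z \<in> F" and v: "v \<in> tangent_cone F z"
  shows "linearized_reeb_flow X t z v \<in> tangent_cone F (reeb_flow X t z)"
proof -
  have "reeb_flow X t differentiable (at z within F)"
    using reeb_flow_has_derivative[OF z] by (rule differentiableI)
  then have "(reeb_flow X t has_derivative linearized_reeb_flow X t z) (at z within F)"
    unfolding linearized_reeb_flow_def frechet_derivative_works .
  then show ?thesis
    by (rule derivative_maps_tangent_cone[OF _ _ v]) (auto simp: reeb_flow_eq)
qed

end


section \<open>Trivializations of the contact structure\<close>

text \<open>Two continuous arguments differ by a continuous function with values in \<open>2\<pi>\<int>\<close>.\<close>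

lemma angle_change_exp:
  assumes t: "0 \<le> t" and L: "continuous_on {0..t} L" and w: "\<And>s. s \<in> {0..t} \<Longrightarrow> w s = exp (L s)"
  shows "angle_change w t = Im (L t) - Im (L 0)"
  unfolding angle_change_def
proof (rule the_equality)
  have pol: "w s = rcis (cmod (w s)) (Im (L s))" if "s \<in> {0..t}" for s
    using w[OF that] by (simp add: rcis_def exp_eq_polar norm_mult)
  show "\<exists>\<theta>. continuous_on {0..t} \<theta> \<and> (\<forall>s\<in>{0..t}. w s = rcis (cmod (w s)) (\<theta> s)) \<and> Im (L t) - Im (L 0) = \<theta> t - \<theta> 0"
    using L pol by (intro exI[of _ "\<lambda>s. Im (L s)"] conjI continuous_intros) auto
  fix d assume "\<exists>\<theta>. continuous_on {0..t} \<theta> \<and> (\<forall>s\<in>{0..t}. w s = rcis (cmod (w s)) (\<theta> s)) \<and> d = \<theta> t - \<theta> 0"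
  then obtain \<theta> where \<theta>: "continuous_on {0..t} \<theta>" "\<And>s. s \<in> {0..t} \<Longrightarrow> w s = rcis (cmod (w s)) (\<theta> s)"
    "d = \<theta> t - \<theta> 0" by blast
  define f where "f s = \<theta> s - Im (L s)" for s
  have f: "\<exists>n. f s = 2 * pi * of_int n" if "s \<in> {0..t}" for s
  proof -
    have "w s \<noteq> 0" using w[OF that] by simp
    moreover have "of_real (cmod (w s)) * cis (\<theta> s) = of_real (cmod (w s)) * cis (Im (L s))"
      using pol[OF that] \<theta>(2)[OF that] by (simp only: rcis_def)
    ultimately have "cis (\<theta> s) = cis (Im (L s))" by simp
    then have "cis (f s) = 1" by (simp add: f_def flip: cis_divide)
    then have "cos (f s) = 1" by (simp add: complex_eq_iff)
    then show ?thesis using cos_one_2pi_int[of "f s"] by (auto simp: mult_ac)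
  qed
  have "f constant_on {0..t}"
  proof (rule continuous_discrete_range_constant)
    show "continuous_on {0..t} f" unfolding f_def by (intro continuous_intros \<theta>(1) L)
    fix s assume s: "s \<in> {0..t}"
    have "2 * pi \<le> norm (f y - f s)" if y: "y \<in> {0..t}" "f y \<noteq> f s" for y
    proof -
      obtain m n where mn: "f y = 2 * pi * of_int m" "f s = 2 * pi * of_int n" using f s y by blast
      then have "m \<noteq> n" using y by auto
      then have "1 \<le> \<bar>real_of_int (m - n)\<bar>" by linarith
      then have "2 * pi * 1 \<le> 2 * pi * \<bar>real_of_int (m - n)\<bar>" by (intro mult_left_mono) auto
      also have "\<dots> = norm (f y - f s)" unfolding mn by (simp add: abs_mult flip: right_diff_distrib)
      finally show ?thesis by simp
    qed
    then show "\<exists>e>0. \<forall>y. y \<in> {0..t} \<and> f y \<noteq> f s \<longrightarrow> e \<le> norm (f y - f s)"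
      by (intro exI[of _ "2 * pi"]) auto
  qed simp
  then obtain c where "\<And>s. s \<in> {0..t} \<Longrightarrow> f s = c" unfolding constant_on_def by blast
  then have "f t = f 0" using t by simp
  then show "d = Im (L t) - Im (L 0)" using \<theta>(3) by (simp add: f_def)
qed

definition cdet :: "complex ^ 2 \<Rightarrow> complex ^ 2 \<Rightarrow> complex" where
  "cdet z w = z $ 1 * w $ 2 - z $ 2 * w $ 1"

text \<open>Left multiplication by the quaternion \<open>j\<close>. For \<open>z \<noteq> 0\<close>, the vectors \<open>z\<close>, \<open>i z\<close>, \<open>quat_j z\<close>
  and \<open>i quat_j z\<close> are an orthogonal real basis.\<close>

definition quat_j :: "complex ^ 2 \<Rightarrow> complex ^ 2" where
  "quat_j z = vector [- cnj (z $ 2), cnj (z $ 1)]"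

lemma quat_j_nth [simp]: "quat_j z $ 1 = - cnj (z $ 2)" "quat_j z $ 2 = cnj (z $ 1)"
  by (simp_all add: quat_j_def)

lemma cdet_diff: "cdet z (x - y) = cdet z x - cdet z y"
  and cdet_add: "cdet z (x + y) = cdet z x + cdet z y"
  and cdet_scaleR: "cdet z (c *\<^sub>R x) = c *\<^sub>R cdet z x"
  and cdet_self: "cdet z z = 0"
  and cdet_smult: "cdet z (a *s x) = a * cdet z x"
  by (simp_all add: cdet_def algebra_simps)

lemma cdet_quat_j: "cdet z (quat_j z) = of_real ((norm z)\<^sup>2)"
proof -
  have "(norm z)\<^sup>2 = (cmod (z $ 1))\<^sup>2 + (cmod (z $ 2))\<^sup>2"
    by (simp add: norm_vec_def L2_set_def sum_2)
  then show ?thesis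
    using complex_norm_square[of "z $ 1"] complex_norm_square[of "z $ 2"] by (simp add: cdet_def)
qed

lemma inner_quat_j:
  "quat_j z \<bullet> z = 0" "(\<i> *s quat_j z) \<bullet> z = 0" "(\<i> *s z) \<bullet> quat_j z = 0" "z \<bullet> quat_j z = 0"
  "quat_j z \<bullet> quat_j z = (norm z)\<^sup>2"
  by (simp_all add: inner_complex_vec sum_2 power2_norm_eq_inner algebra_simps)

lemma continuous_on_quat_j: "continuous_on S quat_j"
proof -
  have "quat_j = (\<lambda>z. \<chi> k. if k = 1 then - cnj (z $ 2) else cnj (z $ 1))"
    by (simp add: fun_eq_iff vec_eq_iff forall_2)
  moreover have "continuous_on S (\<lambda>z::complex^2. \<chi> k::2. if k = 1 then - cnj (z $ 2) else cnj (z $ 1))"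
  proof (rule continuous_on_vec_lambda)
    fix k :: 2
    show "continuous_on S (\<lambda>z::complex^2. if k = 1 then - cnj (z $ 2) else cnj (z $ 1))"
      by (cases "k = 1") (auto intro!: continuous_intros)
  qed
  ultimately show ?thesis by (simp only:)
qed

lemma symplectic_form_linear:
  "symplectic_form (x + y) w = symplectic_form x w + symplectic_form y w"
  "symplectic_form w (x + y) = symplectic_form w x + symplectic_form w y"
  "symplectic_form (c *\<^sub>R x) w = c * symplectic_form x w"
  "symplectic_form w (c *\<^sub>R x) = c * symplectic_form w x"
  "symplectic_form w w = 0"
  "symplectic_form w x = - symplectic_form x w"
  by (simp_all add: symplectic_form_def sum.distrib[symmetric] sum_distrib_left sum_negf[symmetric] algebra_simps del: sum_negf)

lemma triv_coord_linear:
  "triv_coord e1 e2 z (x + y) = triv_coord e1 e2 z x + triv_coord e1 e2 z y"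
  "triv_coord e1 e2 z (c *\<^sub>R x) = c *\<^sub>R triv_coord e1 e2 z x"
  by (simp_all add: triv_coord_def symplectic_form_linear(1-5) complex_eq_iff)

lemma continuous_on_symplectic_form:
  "continuous_on S f \<Longrightarrow> continuous_on S g \<Longrightarrow> continuous_on S (\<lambda>x. symplectic_form (f x) (g x))"
  unfolding symplectic_form_def by (intro continuous_intros)

context toric_star_domain_4
begin

lemma contact_structure_iff:
  "z \<in> F \<Longrightarrow> v \<in> contact_structure X z \<longleftrightarrow> conormal z \<bullet> v = 0 \<and> (\<i> *s z) \<bullet> v = 0"
  by (simp add: contact_structure_def tangent_cone_frontier liouville_form_eq_inner)

text \<open>A zero of the determinant is a complex multiple \<open>c z\<close>. The contact plane contains no such vector other than 0, since the
  Liouville form detects the imaginary part of \<open>c\<close> and the conormal its real part.\<close>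

lemma cdet_eq_0_imp:
  assumes z: "z \<in> F" and x: "x \<in> contact_structure X z" "cdet z x = 0"
  shows "x = 0"
proof -
  have "\<exists>c. x = c *s z"
  proof (cases "z $ 1 = 0")
    case True
    then have "z $ 2 \<noteq> 0" using frontier_nonzero[OF z] by (auto simp: vec_eq_iff forall_2)
    then show ?thesis using x(2) True
      by (intro exI[of _ "x $ 2 / z $ 2"]) (auto simp: vec_eq_iff forall_2 cdet_def)
  next
    case False
    then show ?thesis using x(2)
      by (intro exI[of _ "x $ 1 / z $ 1"]) (auto simp: vec_eq_iff forall_2 cdet_def field_simps)
  qed
  then obtain c where c: "x = c *s z" by blast
  have c': "x = Re c *\<^sub>R z + Im c *\<^sub>R (\<i> *s z)"
    unfolding c by (simp add: vec_eq_iff complex_eq_iff algebra_simps)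
  have "(\<i> *s z) \<bullet> x = Im c * (z \<bullet> z)"
    unfolding c' by (simp add: inner_add_right inner_i_i inner_i_left[of z z] inner_i_self)
  then have "Im c = 0" using x(1) z frontier_nonzero[OF z] by (simp add: contact_structure_iff)
  moreover have "conormal z \<bullet> x = Re c"
    unfolding c' using \<open>Im c = 0\<close> conormal_inner_self[OF z] by (simp add: inner_add_right)
  ultimately have "c = 0" using x(1) z by (simp add: contact_structure_iff complex_eq_iff)
  then show ?thesis using c by simp
qed

text \<open>The vectors \<open>quat_j z\<close> and \<open>i quat_j z\<close> are annihilated by the Liouville form at \<open>z\<close>, and so is \<open>z\<close>. Adding
  multiples of \<open>z\<close> makes them tangent to the boundary and leaves their determinant with \<open>z\<close> unchanged.\<close>

definition frame1 :: "complex ^ 2 \<Rightarrow> complex ^ 2" where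
  "frame1 z = quat_j z - (conormal z \<bullet> quat_j z) *\<^sub>R z"

definition frame2 :: "complex ^ 2 \<Rightarrow> complex ^ 2" where
  "frame2 z = \<i> *s quat_j z - (conormal z \<bullet> (\<i> *s quat_j z)) *\<^sub>R z"

lemma frame_contact:
  assumes z: "z \<in> F"
  shows "frame1 z \<in> contact_structure X z" "frame2 z \<in> contact_structure X z"
  using conormal_inner_self[OF z]
  by (simp_all add: contact_structure_iff[OF z] frame1_def frame2_def inner_diff_right inner_quat_j
      inner_i_i inner_i_left[of z z] inner_i_self)

lemma cdet_frame:
  "cdet z (frame1 z) = of_real ((norm z)\<^sup>2)" "cdet z (frame2 z) = \<i> * of_real ((norm z)\<^sup>2)"
  unfolding frame1_def frame2_def cdet_diff cdet_scaleR cdet_self cdet_smult cdet_quat_j by simp_all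

lemma symplectic_form_frame: "symplectic_form (frame1 z) (frame2 z) = (norm z)\<^sup>2"
proof -
  have "\<i> *s (x - c *\<^sub>R y) = \<i> *s x - c *\<^sub>R (\<i> *s y)" for x y :: "complex ^ 2" and c
    by (simp add: vec_eq_iff algebra_simps)
  then show ?thesis
    unfolding symplectic_form_eq_inner frame1_def frame2_def
    by (simp add: inner_diff_right inner_diff_left inner_quat_j inner_i_i inner_i_left[of z z] inner_i_self)
qed

lemma continuous_on_frame: "continuous_on F frame1" "continuous_on F frame2"
  unfolding frame1_def frame2_def vector_scalar_mult_def
  by (intro continuous_intros continuous_on_quat_j continuous_on_conormal)+

lemma contact_frame_expansion:
  assumes z: "z \<in> F" and x: "x \<in> contact_structure X z"
  shows "(norm z)\<^sup>2 *\<^sub>R x = Re (cdet z x) *\<^sub>R frame1 z + Im (cdet z x) *\<^sub>R frame2 z"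
proof -
  let ?y = "(norm z)\<^sup>2 *\<^sub>R x - (Re (cdet z x) *\<^sub>R frame1 z + Im (cdet z x) *\<^sub>R frame2 z)"
  have "cdet z ?y = 0"
    unfolding cdet_diff cdet_add cdet_scaleR cdet_frame by (simp add: complex_eq_iff algebra_simps)
  moreover have "?y \<in> contact_structure X z"
    using x frame_contact[OF z] by (simp add: contact_structure_iff[OF z] inner_diff_right inner_add_right)
  ultimately have "?y = 0" using cdet_eq_0_imp[OF z] by blast
  then show ?thesis by simp
qed

lemma frame_symplectic_trivialization:
  "symplectic_trivialization X (\<lambda>z. frame1 z /\<^sub>R norm z) (\<lambda>z. frame2 z /\<^sub>R norm z)"
  unfolding symplectic_trivialization_def
proof (intro conjI ballI)
  show "continuous_on F (\<lambda>z. frame1 z /\<^sub>R norm z)" "continuous_on F (\<lambda>z. frame2 z /\<^sub>R norm z)"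
    using frontier_nonzero by (intro continuous_intros continuous_on_frame; simp)+
  fix z assume z: "z \<in> F"
  show "frame1 z /\<^sub>R norm z \<in> contact_structure X z" "frame2 z /\<^sub>R norm z \<in> contact_structure X z"
    using frame_contact[OF z] by (simp_all add: contact_structure_iff[OF z])
  show "symplectic_form (frame1 z /\<^sub>R norm z) (frame2 z /\<^sub>R norm z) = 1"
    using frontier_nonzero[OF z] by (simp add: symplectic_form_linear(1-5) symplectic_form_frame power2_eq_square field_simps)
qed

text \<open>Both \<open>triv_coord e1 e2 z\<close> and \<open>cdet z\<close> are real-linear isomorphisms from the contact plane to the complex numbers. The change between
  them is \<open>d \<mapsto> A d + B cnj d\<close>, and \<open>|B| < |A|\<close> says that it preserves the orientation; this holds because the symplectic form
  is positive on both frames.\<close>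

lemma triv_coord_decomposition:
  assumes e: "symplectic_trivialization X e1 e2"
  shows "\<exists>A B. continuous_on F A \<and> continuous_on F B \<and> (\<forall>z\<in>F. cmod (B z) < cmod (A z)) \<and>
    (\<forall>z\<in>F. \<forall>x\<in>contact_structure X z.
       triv_coord e1 e2 z x = A z * cdet z x + B z * cnj (cdet z x))"
proof -
  let ?P = "\<lambda>z. triv_coord e1 e2 z (frame1 z)"
  let ?Q = "\<lambda>z. triv_coord e1 e2 z (frame2 z)"
  let ?A = "\<lambda>z. (?P z - \<i> * ?Q z) / of_real (2 * (norm z)\<^sup>2)"
  let ?B = "\<lambda>z. (?P z + \<i> * ?Q z) / of_real (2 * (norm z)\<^sup>2)"
  have ec: "continuous_on F e1" "continuous_on F e2" using e unfolding symplectic_trivialization_def by auto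
  have "continuous_on F ?P" "continuous_on F ?Q"
    unfolding triv_coord_def Complex_eq
    by (intro continuous_intros continuous_on_symplectic_form ec continuous_on_frame)+
  then have "continuous_on F ?A \<and> continuous_on F ?B"
    using frontier_nonzero by (intro conjI continuous_intros; simp)
  moreover have "cmod (?B z) < cmod (?A z) \<and> (\<forall>x\<in>contact_structure X z.
       triv_coord e1 e2 z x = ?A z * cdet z x + ?B z * cnj (cdet z x))" if z: "z \<in> F" for z
  proof (intro conjI ballI)
  define N where "N = (norm z)\<^sup>2"
  have N: "N > 0" using frontier_nonzero[OF z] by (simp add: N_def)
  {
    fix x assume x: "x \<in> contact_structure X z"
    have "N *\<^sub>R triv_coord e1 e2 z x = triv_coord e1 e2 z (N *\<^sub>R x)" by (simp add: triv_coord_linear)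
    also have "\<dots> = Re (cdet z x) *\<^sub>R ?P z + Im (cdet z x) *\<^sub>R ?Q z"
      unfolding N_def contact_frame_expansion[OF z x] by (simp add: triv_coord_linear)
    finally have eq: "of_real N * triv_coord e1 e2 z x
        = of_real (Re (cdet z x)) * ?P z + of_real (Im (cdet z x)) * ?Q z"
      by (simp add: scaleR_conv_of_real)
    have d: "2 * complex_of_real (Re d) = d + cnj d" "2 * complex_of_real (Im d) = - \<i> * (d - cnj d)" for d
      by (simp_all add: complex_eq_iff)
    have "2 * of_real N * triv_coord e1 e2 z x
       = (2 * of_real (Re (cdet z x))) * ?P z + (2 * of_real (Im (cdet z x))) * ?Q z"
      using arg_cong[OF eq, of "\<lambda>x. 2 * x"] by (simp add: algebra_simps)
    also have "\<dots> = (?P z - \<i> * ?Q z) * cdet z x + (?P z + \<i> * ?Q z) * cnj (cdet z x)"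
      unfolding d by (simp add: algebra_simps)
    finally have h: "(?P z - \<i> * ?Q z) * cdet z x + (?P z + \<i> * ?Q z) * cnj (cdet z x)
      = of_real (2 * N) * triv_coord e1 e2 z x" by simp
    have div: "(a / c) * y + (b / c) * w = (a * y + b * w) / c" for a b c y w :: complex
      by (simp add: add_divide_distrib)
    have "?A z * cdet z x + ?B z * cnj (cdet z x)
      = ((?P z - \<i> * ?Q z) * cdet z x + (?P z + \<i> * ?Q z) * cnj (cdet z x)) / of_real (2 * N)"
      unfolding N_def by (rule div)
    then show "triv_coord e1 e2 z x = ?A z * cdet z x + ?B z * cnj (cdet z x)"
      unfolding h using N by simp
  }
  have ez: "e1 z \<in> contact_structure X z" "e2 z \<in> contact_structure X z" "symplectic_form (e1 z) (e2 z) = 1"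
    using e z unfolding symplectic_trivialization_def by auto
  \<comment> \<open>The determinant \<open>p s - q r\<close> turns out to be \<open>N\<close>, because \<open>\<omega>(e\<^sub>1, e\<^sub>2) = 1\<close>. So the coordinates of
    \<open>frame1 z\<close> and \<open>frame2 z\<close> with respect to \<open>e\<^sub>1, e\<^sub>2\<close> are the entries of the adjugate matrix.\<close>
  define p where "p = Re (cdet z (e1 z))"
  define q where "q = Im (cdet z (e1 z))"
  define r where "r = Re (cdet z (e2 z))"
  define s where "s = Im (cdet z (e2 z))"
  have e1: "N *\<^sub>R e1 z = p *\<^sub>R frame1 z + q *\<^sub>R frame2 z"
    and e2: "N *\<^sub>R e2 z = r *\<^sub>R frame1 z + s *\<^sub>R frame2 z"
    using contact_frame_expansion[OF z] ez by (simp_all add: N_def p_def q_def r_def s_def)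
  have f: "symplectic_form (frame1 z) (frame2 z) = N" "symplectic_form (frame2 z) (frame1 z) = - N"
    using symplectic_form_frame[of z] symplectic_form_linear(6)[of "frame2 z" "frame1 z"] by (simp_all add: N_def)
  have "N * (N * symplectic_form (e1 z) (e2 z)) = symplectic_form (N *\<^sub>R e1 z) (N *\<^sub>R e2 z)"
    by (simp add: symplectic_form_linear(3,4))
  also have "\<dots> = N * (p * s - q * r)"
    unfolding e1 e2 by (simp add: symplectic_form_linear(1-5) f algebra_simps)
  finally have psqr: "p * s - q * r = N" using N ez(3) by simp
  have "N * symplectic_form (frame1 z) (e2 z) = N * s"
    using symplectic_form_linear(4)[of "frame1 z" N "e2 z", symmetric] unfolding e2
    by (simp add: symplectic_form_linear(1-5) f mult.commute)
  moreover have "N * symplectic_form (frame2 z) (e2 z) = N * (- r)"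
    using symplectic_form_linear(4)[of "frame2 z" N "e2 z", symmetric] unfolding e2
    by (simp add: symplectic_form_linear(1-5) f mult.commute)
  moreover have "N * symplectic_form (e1 z) (frame1 z) = N * (- q)"
    using symplectic_form_linear(3)[of N "e1 z" "frame1 z", symmetric] unfolding e1
    by (simp add: symplectic_form_linear(1-5) f mult.commute)
  moreover have "N * symplectic_form (e1 z) (frame2 z) = N * p"
    using symplectic_form_linear(3)[of N "e1 z" "frame2 z", symmetric] unfolding e1
    by (simp add: symplectic_form_linear(1-5) f mult.commute)
  ultimately have "symplectic_form (frame1 z) (e2 z) = s" "symplectic_form (frame2 z) (e2 z) = - r"
    "symplectic_form (e1 z) (frame1 z) = - q" "symplectic_form (e1 z) (frame2 z) = p"
    using N unfolding mult_cancel_left by auto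
  then have PQ: "?P z = Complex s (- q)" "?Q z = Complex (- r) p" by (simp_all add: triv_coord_def)
  have "(cmod (?P z - \<i> * ?Q z))\<^sup>2 - (cmod (?P z + \<i> * ?Q z))\<^sup>2 = 4 * (p * s - q * r)"
    unfolding PQ cmod_power2 by (simp add: power2_eq_square algebra_simps)
  then have "(cmod (?P z + \<i> * ?Q z))\<^sup>2 < (cmod (?P z - \<i> * ?Q z))\<^sup>2" using psqr N by simp
  then have "cmod (?P z + \<i> * ?Q z) < cmod (?P z - \<i> * ?Q z)" by (rule power2_less_imp_less) simp
  then show "cmod (?B z) < cmod (?A z)"
    using N unfolding N_def[symmetric] norm_divide by (intro divide_strict_right_mono) auto
  qed
  ultimately show ?thesis by (intro exI[of _ ?A] exI[of _ ?B]) blast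
qed

lemma triv_coord_reeb_vector:
  assumes e: "symplectic_trivialization X e1 e2" and z: "z \<in> F"
  shows "triv_coord e1 e2 z (reeb_vector X z) = 0"
proof -
  have T: "e1 z \<in> tangent_cone F z" "e2 z \<in> tangent_cone F z"
    using e z unfolding symplectic_trivialization_def contact_structure_def by auto
  have "symplectic_form (reeb_vector X z) v = 0" if "v \<in> tangent_cone F z" for v
  proof -
    have "\<i> *s (2 *\<^sub>R (\<i> *s conormal z)) = - 2 *\<^sub>R conormal z" by (simp add: vec_eq_iff complex_eq_iff)
    then show ?thesis
      using that by (simp add: symplectic_form_eq_inner reeb_vector_eq[OF z] tangent_cone_frontier[OF z])
  qed
  with T show ?thesis
    using symplectic_form_linear(6)[of "e1 z" "reeb_vector X z"] by (simp add: triv_coord_def complex_eq_iff)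
qed


section \<open>Rotation numbers\<close>

text \<open>The component of the linearized flow along the Reeb field has no effect on \<open>triv_coord\<close>. Subtracting it replaces the shear coefficients
  \<open>twist j z v\<close> by \<open>b j\<close>, and the determinant is then a rotating factor times an affine function of \<open>t\<close>. A zero of this function would
  make \<open>v\<close> tangent to the torus orbit. The angular speeds have derivative 0 in such a direction, so all \<open>b j\<close>
  vanish, and \<open>v\<close> with them.\<close>

lemma linearized_flow_contact_component:
  assumes z: "z \<in> F" and v: "v \<in> contact_structure X z" "v \<noteq> 0"
  shows "\<exists>d0 C. (\<forall>t. d0 + of_real t * C \<noteq> 0) \<and>
    (\<forall>t. \<exists>w k. w \<in> contact_structure X (rot (t *\<^sub>R speeds z) z) \<and>
        linearized_reeb_flow X t z v = w + k *\<^sub>R reeb_vector X (rot (t *\<^sub>R speeds z) z) \<and>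
        cdet (rot (t *\<^sub>R speeds z) z) w = cis (t * (\<Sum>j\<in>UNIV. angular_speed j z)) * (d0 + of_real t * C))"
proof -
  have vT: "v \<in> tangent_cone F z" using v by (simp add: contact_structure_def)
  define a where "a j = angular_speed j z" for j
  define k where "k = (\<Sum>j\<in>UNIV. twist j z v * (cmod (z $ j))\<^sup>2) / 2"
  define b where "b j = twist j z v - k * a j" for j
  define g where "g t = rot (t *\<^sub>R speeds z) z" for t
  define w where "w t = linearized_reeb_flow X t z v - (t * k) *\<^sub>R reeb_vector X (g t)" for t
  have gF: "g t \<in> F" for t using z by (simp add: g_def)
  have gj: "g t $ j = cis (t * a j) * z $ j" for t j by (simp add: g_def speeds_def a_def)
  have R: "reeb_vector X (g t) $ j = \<i> * of_real (a j) * g t $ j" for t j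
    using reeb_vector_component[OF gF] z by (simp add: g_def a_def)
  have lin: "linearized_reeb_flow X t z v $ j = cis (t * a j) * (v $ j + \<i> * of_real (t * twist j z v) * z $ j)" for t j
    unfolding a_def by (rule linearized_reeb_flow_eq[OF z vT])
  have wj: "w t $ j = cis (t * a j) * (v $ j + \<i> * of_real (t * b j) * z $ j)" for t j
    unfolding w_def vector_minus_component vector_scaleR_component lin R gj
    by (simp add: b_def scaleR_conv_of_real algebra_simps)
  have gT: "linearized_reeb_flow X t z v \<in> tangent_cone F (g t)" for t
    using linearized_reeb_flow_tangent[OF z vT, of t] reeb_flow_eq[OF z] by (simp add: g_def)
  have liou: "(\<i> *s g t) \<bullet> linearized_reeb_flow X t z v = 2 * t * k" for t
  proof -
    have c: "Re (cnj (\<i> * (cis x * y)) * (cis x * u)) = Re (cnj (\<i> * y) * u)" for x y u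
    proof -
      have *: "cnj (\<i> * (cis x * y)) * (cis x * u) = (cis (- x) * cis x) * (cnj (\<i> * y) * u)"
        by (simp add: cis_cnj)
      show ?thesis unfolding * by (simp add: cis_mult)
    qed
    have n: "Re (cnj (\<i> * y) * (\<i> * of_real s * y)) = s * (cmod y)\<^sup>2" for y s
      unfolding cmod_power2 by (simp add: power2_eq_square algebra_simps)
    have "(\<i> *s g t) \<bullet> linearized_reeb_flow X t z v =
        (\<Sum>j\<in>UNIV. Re (cnj (\<i> * z $ j) * (v $ j + \<i> * of_real (t * twist j z v) * z $ j)))"
      unfolding inner_complex_vec vector_smult_component lin gj c ..
    also have "\<dots> = (\<Sum>j\<in>UNIV. Re (cnj (\<i> * z $ j) * v $ j) + t * twist j z v * (cmod (z $ j))\<^sup>2)"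
      unfolding distrib_left plus_complex.sel n ..
    also have "\<dots> = (\<i> *s z) \<bullet> v + t * (\<Sum>j\<in>UNIV. twist j z v * (cmod (z $ j))\<^sup>2)"
      unfolding sum.distrib inner_complex_vec vector_smult_component by (simp add: sum_distrib_left mult.assoc)
    also have "\<dots> = 2 * t * k" using v(1) z by (simp add: contact_structure_iff k_def)
    finally show ?thesis .
  qed
  have wc: "w t \<in> contact_structure X (g t)" for t
  proof -
    have "conormal (g t) \<bullet> linearized_reeb_flow X t z v = 0" using gT gF by (simp add: tangent_cone_frontier)
    moreover have "conormal (g t) \<bullet> reeb_vector X (g t) = 0" by (simp add: reeb_vector_eq[OF gF] inner_i_self)
    moreover have "(\<i> *s g t) \<bullet> reeb_vector X (g t) = 2"
      using conormal_inner_self[OF gF] by (simp add: reeb_vector_eq[OF gF] inner_i_i inner_commute)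
    ultimately show ?thesis
      unfolding contact_structure_iff[OF gF] w_def by (simp add: inner_diff_right liou)
  qed
  define d0 where "d0 = cdet z v"
  define C where "C = \<i> * of_real (b 2 - b 1) * z $ 1 * z $ 2"
  have det: "cdet (g t) (w t) = cis (t * (a 1 + a 2)) * (d0 + of_real t * C)" for t
  proof -
    have "cis (t * (a 1 + a 2)) = cis (t * a 1) * cis (t * a 2)" by (simp add: cis_mult distrib_left)
    then show ?thesis unfolding cdet_def wj gj d0_def C_def by (simp add: algebra_simps)
  qed
  have nz: "d0 + of_real t * C \<noteq> 0" for t
  proof
    assume "d0 + of_real t * C = 0"
    then have "w t = 0" using cdet_eq_0_imp[OF gF wc] det by simp
    then have vj: "v $ j = \<i> * of_real (- t * b j) * z $ j" for j
    proof -
      have "v $ j + \<i> * of_real (t * b j) * z $ j = 0" using wj[of t j] \<open>w t = 0\<close> by simp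
      then show ?thesis by (simp add: eq_neg_iff_add_eq_0)
    qed
    then have "v = (\<chi> j. \<i> * of_real ((\<chi> j. - t * b j) $ j) * z $ j)" by (simp add: vec_eq_iff)
    then have tw: "twist j z v = 0" for j using twist_torus_direction[OF z, of j "\<chi> j. - t * b j"] by simp
    then have "k = 0" by (simp add: k_def)
    then have "b j = 0" for j using tw by (simp add: b_def)
    then have "v = 0" using vj by (simp add: vec_eq_iff)
    then show False using v(2) by simp
  qed
  have "linearized_reeb_flow X t z v = w t + (t * k) *\<^sub>R reeb_vector X (g t)" for t by (simp add: w_def)
  then have "\<exists>w k. w \<in> contact_structure X (g t) \<and>
        linearized_reeb_flow X t z v = w + k *\<^sub>R reeb_vector X (g t) \<and>
        cdet (g t) w = cis (t * (\<Sum>j\<in>UNIV. angular_speed j z)) * (d0 + of_real t * C)" for t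
    using wc[of t] det[of t] unfolding sum_2 a_def by blast
  then show ?thesis unfolding g_def using nz by (intro exI[of _ d0] exI[of _ C] conjI allI)
qed

text \<open>The coordinate of the transported vector is a product of four factors, each with a continuous logarithm: \<open>A\<close> along the
  orbit, the rotating factor, the affine function \<open>d0 + t C = d0 (1 + t q)\<close>, and \<open>1 + u\<close> with \<open>|u| < 1\<close>. Only the
  rotating factor has an unbounded argument. The principal logarithm serves for the last two, since a real value
  \<open>1 + t q \<le> 0\<close> would force a zero of the affine function at some time between 0 and \<open>t\<close>.\<close>

lemma angle_change_estimate:
  assumes e: "symplectic_trivialization X e1 e2"
  shows "\<exists>M. \<forall>z\<in>F. \<forall>v\<in>contact_structure X z - {0}. \<forall>t\<ge>0.
     \<bar>angle_change (\<lambda>t. triv_coord e1 e2 (rot (t *\<^sub>R speeds z) z) (linearized_reeb_flow X t z v)) t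
        - t * (\<Sum>j\<in>UNIV. angular_speed j z)\<bar> \<le> M"
proof -
  from triv_coord_decomposition[OF e]
  obtain A B where AB: "continuous_on F A" "continuous_on F B" "\<forall>z\<in>F. cmod (B z) < cmod (A z)"
    "\<forall>z\<in>F. \<forall>x\<in>contact_structure X z.
       triv_coord e1 e2 z x = A z * cdet z x + B z * cnj (cdet z x)"
    by (elim exE conjE) (rule that)
  have Anz: "A z \<noteq> 0" if "z \<in> F" for z using bspec[OF AB(3) that] by auto
  have "Borsukian F" by (rule Borsukian_frontier) simp
  then obtain l where l: "continuous_on F l" "\<And>z. z \<in> F \<Longrightarrow> A z = exp (l z)"
  proof -
    have "A \<in> F \<rightarrow> - {0}" using Anz by auto
    then have "\<exists>l. continuous_on F l \<and> (\<forall>z\<in>F. A z = exp (l z))"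
      using \<open>Borsukian F\<close> AB(1) unfolding Borsukian_continuous_logarithm by simp
    then show ?thesis using that by blast
  qed
  have "bounded (l ` F)"
    by (rule compact_imp_bounded[OF compact_continuous_image[OF l(1) compact_frontier[OF compact_X]]])
  then obtain K where "\<forall>x\<in>l ` F. cmod x \<le> K" unfolding bounded_iff by (elim exE) (rule that)
  then have K: "cmod (l z) \<le> K" if "z \<in> F" for z using that by simp
  show ?thesis
  proof (rule exI[of _ "2 * K + 4 * pi"], intro ballI allI impI)
    fix z v and T :: real
    assume z: "z \<in> F" and v': "v \<in> contact_structure X z - {0}" and T: "0 \<le> T"
    then have v: "v \<in> contact_structure X z" "v \<noteq> 0" by auto
    define \<omega> where "\<omega> = (\<Sum>j\<in>UNIV. angular_speed j z)"
    define g where "g t = rot (t *\<^sub>R speeds z) z" for t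
    have gF: "g t \<in> F" for t using z by (simp add: g_def)
    from linearized_flow_contact_component[OF z v, folded g_def \<omega>_def]
    obtain d0 C where nz: "\<forall>t. d0 + of_real t * C \<noteq> 0"
      and dec: "\<forall>t. \<exists>w k. w \<in> contact_structure X (g t) \<and>
        linearized_reeb_flow X t z v = w + k *\<^sub>R reeb_vector X (g t) \<and>
        cdet (g t) w = cis (t * \<omega>) * (d0 + of_real t * C)"
      by (elim exE conjE) (rule that)
    have d0: "d0 \<noteq> 0" "\<And>t. d0 + of_real t * C \<noteq> 0" using nz[rule_format, of 0] nz by auto
    define d where "d t = cis (t * \<omega>) * (d0 + of_real t * C)" for t
    have dnz: "d t \<noteq> 0" for t using d0(2) by (simp add: d_def)
    have tri: "triv_coord e1 e2 (g t) (linearized_reeb_flow X t z v) = A (g t) * d t + B (g t) * cnj (d t)" for t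
    proof -
      obtain w k where w: "w \<in> contact_structure X (g t)"
        "linearized_reeb_flow X t z v = w + k *\<^sub>R reeb_vector X (g t)" "cdet (g t) w = d t"
        using dec[rule_format, of t] unfolding d_def by blast
      then show ?thesis
        using bspec[OF bspec[OF AB(4) gF] w(1)] triv_coord_reeb_vector[OF e gF] by (simp add: triv_coord_linear)
    qed
    define q where "q = C / d0"
    define u where "u t = (B (g t) / A (g t)) * (cnj (d t) / d t)" for t
    have u: "cmod (u t) < 1" for t
      using bspec[OF AB(3) gF, of t] dnz[of t] Anz[OF gF, of t] by (simp add: u_def norm_mult norm_divide)
    have slit_u: "1 + u t \<notin> \<real>\<^sub>\<le>\<^sub>0" for t
    proof
      assume "1 + u t \<in> \<real>\<^sub>\<le>\<^sub>0"
      then have "Re (1 + u t) \<le> 0" by (simp add: complex_nonpos_Reals_iff)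
      then show False using u[of t] abs_Re_le_cmod[of "u t"] by simp
    qed
    have slit_q: "1 + of_real t * q \<notin> \<real>\<^sub>\<le>\<^sub>0" if t: "0 \<le> t" for t
    proof
      assume "1 + of_real t * q \<in> \<real>\<^sub>\<le>\<^sub>0"
      then obtain r where r: "r \<le> 0" "1 + of_real t * q = of_real r" by (auto elim: nonpos_Reals_cases)
      \<comment> \<open>The time at which \<open>1 + s q = 0\<close>, since \<open>t q = r - 1\<close>.\<close>
      define s where "s = t / (1 - r)"
      have tq: "of_real t * q = of_real (r - 1)" using r(2) by (simp add: algebra_simps)
      have "of_real s * q = (of_real t * q) / of_real (1 - r)" by (simp add: s_def)
      also have "\<dots> = - 1" unfolding tq using r(1) by (simp add: field_simps)
      finally have "d0 + of_real s * C = 0" using d0(1) by (simp add: q_def field_simps)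
      then show False using d0(2) by blast
    qed
    define L where "L t = l (g t) + (\<i> * of_real (t * \<omega>) + Ln d0 + Ln (1 + of_real t * q) + Ln (1 + u t))" for t
    have cg: "continuous_on {0..T} g"
    proof (rule continuous_on_subset[of UNIV])
      have "(g has_vector_derivative reeb_vector X (g t)) (at t)" for t
        using reeb_trajectory_rot[OF z] unfolding reeb_trajectory_def g_def by blast
      then show "continuous_on UNIV g"
        by (auto intro!: continuous_at_imp_continuous_on has_vector_derivative_continuous)
    qed simp
    have cd: "continuous_on {0..T} d" unfolding d_def
      by (intro continuous_intros)
    have comp: "continuous_on {0..T} (\<lambda>t. h (g t))" if "continuous_on F h" for h :: "complex ^ 2 \<Rightarrow> complex"
      using continuous_on_compose2[OF that cg] gF by blast
    have cu: "continuous_on {0..T} u" unfolding u_def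
      by (intro continuous_intros comp AB(1,2) cd) (use Anz[OF gF] dnz in auto)
    have contL: "continuous_on {0..T} L" unfolding L_def
      by (intro continuous_intros comp l(1) cu) (use slit_q slit_u in auto)
    have expL: "triv_coord e1 e2 (g t) (linearized_reeb_flow X t z v) = exp (L t)" if "t \<in> {0..T}" for t
    proof -
      have n: "1 + of_real t * q \<noteq> 0" "1 + u t \<noteq> 0"
        using slit_q[of t] slit_u[of t] that by auto
      have "exp (L t) = A (g t) * (cis (t * \<omega>) * (d0 * (1 + of_real t * q)) * (1 + u t))"
        unfolding L_def exp_add l(2)[OF gF, symmetric] cis_conv_exp[symmetric]
          exp_Ln[OF d0(1)] exp_Ln[OF n(1)] exp_Ln[OF n(2)] by (simp only: mult.assoc)
      also have "d0 * (1 + of_real t * q) = d0 + of_real t * C" using d0(1) by (simp add: q_def field_simps)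
      also have "cis (t * \<omega>) * (d0 + of_real t * C) = d t" by (simp add: d_def)
      also have "A (g t) * (d t * (1 + u t)) = A (g t) * d t + B (g t) * cnj (d t)"
        using Anz[OF gF, of t] dnz[of t] by (simp add: u_def field_simps)
      finally show ?thesis using tri by simp
    qed
    have ang: "angle_change (\<lambda>t. triv_coord e1 e2 (g t) (linearized_reeb_flow X t z v)) T = Im (L T) - Im (L 0)"
      by (rule angle_change_exp[OF T contL expL])
    have l_bd: "\<bar>Im (l (g t))\<bar> \<le> K" for t using abs_Im_le_cmod[of "l (g t)"] K[OF gF, of t] by linarith
    have u_bd: "\<bar>Im (Ln (1 + u t))\<bar> \<le> pi" for t
      using Im_Ln_le_pi[of "1 + u t"] mpi_less_Im_Ln[of "1 + u t"] slit_u[of t] by (cases "1 + u t = 0") auto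
    have q_bd: "\<bar>Im (Ln (1 + of_real T * q))\<bar> \<le> pi"
      using Im_Ln_le_pi[of "1 + of_real T * q"] mpi_less_Im_Ln[of "1 + of_real T * q"] slit_q[OF T]
      by (cases "1 + of_real T * q = 0") auto
    have "Im (L T) - Im (L 0) - T * \<omega> = Im (l (g T)) - Im (l (g 0)) + Im (Ln (1 + of_real T * q))
        + Im (Ln (1 + u T)) - Im (Ln (1 + u 0))"
      by (simp add: L_def)
    then have "\<bar>Im (L T) - Im (L 0) - T * \<omega>\<bar> \<le> 2 * K + 4 * pi"
      using l_bd[of T] l_bd[of 0] u_bd[of T] u_bd[of 0] q_bd pi_ge_zero by linarith
    then show "\<bar>angle_change (\<lambda>t. triv_coord e1 e2 (rot (t *\<^sub>R speeds z) z) (linearized_reeb_flow X t z v)) T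
        - T * (\<Sum>j\<in>UNIV. angular_speed j z)\<bar> \<le> 2 * K + 4 * pi"
      using ang unfolding g_def \<omega>_def by simp
  qed
qed

text \<open>Over \<open>k\<close> periods the angle is \<open>k T (a\<^sub>1 + a\<^sub>2)\<close> up to a bounded error, which disappears in the mean.\<close>

lemma rotation_number_eq:
  assumes e: "symplectic_trivialization X e1 e2" and \<gamma>: "reeb_orbit X \<gamma> T"
  shows "rotation_number X e1 e2 \<gamma> T = T * (\<Sum>j\<in>UNIV. angular_speed j (\<gamma> 0)) / (2 * pi)"
proof -
  define z where "z = \<gamma> 0"
  define \<omega> where "\<omega> = (\<Sum>j\<in>UNIV. angular_speed j z)"
  have traj: "reeb_trajectory X \<gamma>" and T: "T > 0" using \<gamma> unfolding reeb_orbit_def by auto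
  have z: "z \<in> F" using traj unfolding reeb_trajectory_def z_def by blast
  have \<gamma>eq: "rot (t *\<^sub>R speeds z) z = \<gamma> t" for t
    using reeb_trajectory_unique[OF traj, of t] unfolding z_def by simp
  from angle_change_estimate[OF e] obtain M where
    M: "\<forall>z\<in>F. \<forall>v\<in>contact_structure X z - {0}. \<forall>t\<ge>0.
     \<bar>angle_change (\<lambda>t. triv_coord e1 e2 (rot (t *\<^sub>R speeds z) z) (linearized_reeb_flow X t z v)) t
        - t * (\<Sum>j\<in>UNIV. angular_speed j z)\<bar> \<le> M"
    by (elim exE) (rule that)
  let ?ac = "\<lambda>v. angle_change (\<lambda>t. triv_coord e1 e2 (\<gamma> t) (linearized_reeb_flow X t (\<gamma> 0) v))"
  have lim: "(\<lambda>k. ?ac v (real k * T) / (2 * pi * real k)) \<longlonglongrightarrow> T * \<omega> / (2 * pi)"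
    if v: "v \<in> contact_structure X (\<gamma> 0) - {0}" for v
  proof -
    have est: "\<bar>?ac v (real k * T) - real k * T * \<omega>\<bar> \<le> M" for k
      using M[rule_format, OF z, of v "real k * T"] v T unfolding \<gamma>eq \<omega>_def
      by (simp add: z_def)
    have "(\<lambda>k. (M / (2 * pi)) * (1 / real k)) \<longlonglongrightarrow> (M / (2 * pi)) * 0"
      by (intro tendsto_mult tendsto_const lim_1_over_n)
    then have lim0: "(\<lambda>k. (M / (2 * pi)) * (1 / real k)) \<longlonglongrightarrow> 0" by simp
    have "(\<lambda>k. ?ac v (real k * T) / (2 * pi * real k) - T * \<omega> / (2 * pi)) \<longlonglongrightarrow> 0"
    proof (rule Lim_null_comparison[OF _ lim0])
      show "\<forall>\<^sub>F k in sequentially. norm (?ac v (real k * T) / (2 * pi * real k) - T * \<omega> / (2 * pi)) \<le> (M / (2 * pi)) * (1 / real k)"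
        using eventually_gt_at_top[of 0]
      proof eventually_elim
        case (elim k)
        have "?ac v (real k * T) / (2 * pi * real k) - T * \<omega> / (2 * pi)
            = (?ac v (real k * T) - real k * T * \<omega>) / (2 * pi * real k)"
          using elim by (simp add: field_simps)
        also have "norm \<dots> = \<bar>?ac v (real k * T) - real k * T * \<omega>\<bar> / (2 * pi * real k)"
          by (simp add: abs_mult)
        also have "\<dots> \<le> M / (2 * pi * real k)" by (intro divide_right_mono est) auto
        finally show ?case by simp
      qed
    qed
    then show ?thesis by (rule LIM_zero_cancel)
  qed
  have "frame1 z \<noteq> 0"
    using cdet_frame(1)[of z] frontier_nonzero[OF z] by (auto simp: cdet_def)
  then have ne: "frame1 z \<in> contact_structure X (\<gamma> 0) - {0}"
    using frame_contact(1)[OF z] by (simp add: z_def)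
  have "rotation_number X e1 e2 \<gamma> T = T * \<omega> / (2 * pi)"
    unfolding rotation_number_def
  proof (rule the_equality)
    show "\<forall>v\<in>contact_structure X (\<gamma> 0) - {0}.
        (\<lambda>k. ?ac v (real k * T) / (2 * pi * real k)) \<longlonglongrightarrow> T * \<omega> / (2 * pi)"
      using lim by blast
    fix \<rho> assume "\<forall>v\<in>contact_structure X (\<gamma> 0) - {0}.
        (\<lambda>k. ?ac v (real k * T) / (2 * pi * real k)) \<longlonglongrightarrow> \<rho>"
    then show "\<rho> = T * \<omega> / (2 * pi)" using LIMSEQ_unique lim[OF ne] ne by blast
  qed
  then show ?thesis by (simp add: \<omega>_def z_def)
qed


section \<open>Dynamical convexity\<close>

lemma angular_speed_of_zero_other:
  assumes z: "z \<in> F" and i: "UNIV = {i, j}" "i \<noteq> j" and 0: "angular_speed j z * (cmod (z $ j))\<^sup>2 = 0"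
  shows "angular_speed i z > 0"
proof -
  have "angular_speed i z * (cmod (z $ i))\<^sup>2 = 2"
    using sum_angular_speed[OF z] i(2) 0 unfolding i(1) by simp
  then show ?thesis by (metis zero_less_mult_pos2 zero_le_power2 less_eq_real_def mult_zero_right zero_less_numeral zero_neq_numeral)
qed

text \<open>At a zero of the \<open>j\<close>-th speed, the flow only rotates the other coordinate, and one turn of it is a closed orbit with
  rotation number exactly 1.\<close>

lemma dynamically_convex_imp_angular_speed_nonzero:
  assumes dc: "dynamically_convex X" and z: "z \<in> F"
  shows "angular_speed j z \<noteq> 0"
proof
  assume 0: "angular_speed j z = 0"
  obtain i where i: "i \<noteq> j" "UNIV = {i, j}" by (rule two_indices)
  have pos: "angular_speed i z > 0" using angular_speed_of_zero_other[OF z i(2,1)] 0 by simp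
  define T where "T = 2 * pi / angular_speed i z"
  have T: "T > 0" using pos by (simp add: T_def)
  let ?g = "\<lambda>t. rot (t *\<^sub>R speeds z) z"
  have per: "cis ((t + T) * angular_speed k z) = cis (t * angular_speed k z)" for t k
  proof -
    have "k = i \<or> k = j" using i(2) by blast
    moreover have "(t + T) * angular_speed i z = t * angular_speed i z + 2 * pi"
      using pos by (simp add: T_def field_simps)
    ultimately show ?thesis using 0 by (auto simp: cis_mult[symmetric])
  qed
  have orbit: "reeb_orbit X ?g T"
    unfolding reeb_orbit_def using T reeb_trajectory_rot[OF z] per by (simp add: vec_eq_iff speeds_def)
  obtain e1 e2 where e: "symplectic_trivialization X e1 e2"
    "\<And>\<gamma> T. reeb_orbit X \<gamma> T \<Longrightarrow> rotation_number X e1 e2 \<gamma> T > 1"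
    using dc unfolding dynamically_convex_def by blast
  have "?g 0 = z" by (simp add: vec_eq_iff)
  then have "rotation_number X e1 e2 ?g T = T * (\<Sum>k\<in>UNIV. angular_speed k z) / (2 * pi)"
    using rotation_number_eq[OF e(1) orbit] by simp
  also have "(\<Sum>k\<in>UNIV. angular_speed k z) = angular_speed i z" using i 0 unfolding i(2) by simp
  also have "T * angular_speed i z / (2 * pi) = 1" using pos by (simp add: T_def)
  finally show False using e(2)[OF orbit] by simp
qed

text \<open>At a boundary point on the \<open>j\<close>-th coordinate line the \<open>j\<close>-th speed is positive. Having no zero on the connected boundary, it is positive
  everywhere. Conversely, a closed orbit makes \<open>T a\<^sub>j\<close> a positive multiple of \<open>2\<pi>\<close> for some \<open>j\<close>.\<close>

lemma dynamically_convex_iff: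
  "dynamically_convex X \<longleftrightarrow> (\<forall>z\<in>F. \<forall>j. 0 < angular_speed j z)"
proof
  assume dc: "dynamically_convex X"
  show "\<forall>z\<in>F. \<forall>j. 0 < angular_speed j z"
  proof (intro ballI allI, rule ccontr)
    fix z j assume z: "z \<in> F" and neg: "\<not> 0 < angular_speed j z"
    obtain i where i: "i \<noteq> j" "UNIV = {i, j}" by (rule two_indices)
    have ax: "axis j 1 \<noteq> (0 :: complex ^ 2)" by (simp add: axis_eq_0_iff)
    define p where "p = axis j (1::complex) /\<^sub>R minkowski (axis j 1)"
    have p: "p \<in> F" unfolding p_def by (rule normalize_mem_frontier[OF ax])
    have "p $ i = 0" using i(1) by (simp add: p_def axis_def)
    then have "0 < angular_speed j p"
      using angular_speed_of_zero_other[OF p, of j i] i by (simp add: insert_commute)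
    moreover have "connected (angular_speed j ` F)"
      by (rule connected_continuous_image[OF continuous_on_angular_speed connected_frontier]) simp
    ultimately have "0 \<in> angular_speed j ` F"
      using connectedD_interval[of "angular_speed j ` F" "angular_speed j z" "angular_speed j p" 0] z p neg
      by auto
    then show False using dynamically_convex_imp_angular_speed_nonzero[OF dc] by auto
  qed
next
  assume pos: "\<forall>z\<in>F. \<forall>j. 0 < angular_speed j z"
  have "rotation_number X e1 e2 \<gamma> T > 1"
    if e: "symplectic_trivialization X e1 e2" and \<gamma>: "reeb_orbit X \<gamma> T" for e1 e2 \<gamma> T
  proof -
    define z where "z = \<gamma> 0"
    have traj: "reeb_trajectory X \<gamma>" and T: "T > 0" and "\<gamma> (0 + T) = \<gamma> 0"
      using \<gamma> unfolding reeb_orbit_def by blast+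
    have z: "z \<in> F" using traj unfolding reeb_trajectory_def z_def by blast
    have per: "rot (T *\<^sub>R speeds z) z = z"
      using reeb_trajectory_unique[OF traj, of T] \<open>\<gamma> (0 + T) = \<gamma> 0\<close> by (simp add: z_def)
    obtain j where j: "z $ j \<noteq> 0" using frontier_nonzero[OF z] by (auto simp: vec_eq_iff)
    obtain i where i: "i \<noteq> j" "UNIV = {i, j}" by (rule two_indices)
    have "cis (T * angular_speed j z) * z $ j = z $ j"
      using arg_cong[OF per, of "\<lambda>y. y $ j"] by (simp add: speeds_def)
    then have "cis (T * angular_speed j z) = 1" using j by simp
    then have "cos (T * angular_speed j z) = 1" by (simp add: complex_eq_iff)
    then obtain n :: int where n: "T * angular_speed j z = real_of_int n * 2 * pi" using cos_one_2pi_int by blast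
    have pj: "0 < T * angular_speed j z" "0 < T * angular_speed i z" using pos z T by auto
    then have "0 < real_of_int n" unfolding n by (simp add: zero_less_mult_iff)
    then have "1 \<le> real_of_int n" by simp
    then have "2 * pi \<le> T * angular_speed j z" unfolding n by simp
    then have "2 * pi < T * (\<Sum>k\<in>UNIV. angular_speed k z)"
      using pj i(1) unfolding i(2) by (simp add: distrib_left)
    then show ?thesis unfolding rotation_number_eq[OF e \<gamma>] z_def[symmetric] by (simp add: field_simps)
  qed
  then show "dynamically_convex X"
    unfolding dynamically_convex_def
    using compact_X smooth_boundary_X star_shaped_X frame_symplectic_trivialization by blast
qed

end

theorem proposition1p8:
  fixes \<Omega> :: "(real ^ 2) set"
  assumes "orthant_domain \<Omega>"
    and "compact (toric_domain \<Omega>)"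
    and "smooth_boundary (toric_domain \<Omega>)"
    and "star_shaped_domain (toric_domain \<Omega>)"
  shows "dynamically_convex (toric_domain \<Omega>) \<longleftrightarrow> strictly_monotone_toric_domain (toric_domain \<Omega>)"
proof -
  interpret toric_star_domain_4 \<Omega> by unfold_locales (rule assms)+
  show ?thesis using dynamically_convex_iff strictly_monotone_iff[OF assms(1)] by blast
qed

end
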